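(* Consider a Markov decision process with state space $\mathbb{X}$, action space $\mathbb{A}$, one-step cost $c$ and transition probability $q$ satisfying Assumptions (W* ) and (B) (stated in the context). Let $\{\alpha_n\}_{n=1,2,\ldots}$ be a sequence of nonnegative discount factors with $\alpha_n\uparrow 1$. Suppose that the sequence of functions $\{u_{\alpha_n}\}_{n=1,2,\ldots}$ is equicontinuous on $\mathbb{X}$ and that there exists a nonnegative measurable function $U(x)$, $x\in\mathbb{X}$, such that $U(x)\ge u_{\alpha_n}(x)$ for all $x\in\mathbb{X}$ and $n=1,2,\ldots$, and $\int_{\mathbb{X}}U(y)\,q(dy|x,a)<+\infty$ for all $x\in\mathbb{X}$ and $a\in\mathbb{A}$. Then the following statements hold. (i) There exists a subsequence $\{\alpha_{n_k}\}_{k=1,2,\ldots}$ of $\{\alpha_n\}_{n=1,2,\ldots}$ such that $u_{\alpha_{n_k}}(x)\to\tilde u(x)$ as $k\to\infty$ for every $x\in\mathbb{X}$, where $\tilde u$ is the average-cost relative value function defined (see context) for the sequence $\{\alpha_{n_k}\}_{k=1,2,\ldots}$. In addition, the function $\tilde u$ is continuous. (ii) There exists a stationary policy $\phi$ satisfying the average-cost optimality equation with the nonnegative function $\tilde u$ defined for the subsequence $\{\alpha_{n_k}\}_{k=1,2,\ldots}$ from (i), that is, for all $x\in\mathbb{X}$, $$w+\tilde u(x)=c(x,\phi(x))+\int_{\mathbb{X}}\tilde u(y)\,q(dy|x,\phi(x))=\min_{a\in\mathbb{A}}\Big[c(x,a)+\int_{\mathbb{X}}\tilde u(y)\,q(dy|x,a)\Big],$$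 and every stationary policy $\phi$ satisfying these equalities for all $x\in\mathbb{X}$ is average-cost optimal.
   Context: Setting. $\mathbb{X}$ and $\mathbb{A}$ are Borel subsets of Polish spaces. The one-step cost is a function $c:\mathbb{X}\times\mathbb{A}\to\mathbb{R}\cup\{+\infty\}$ and $q(B|x,a)$ is a transition kernel: the probability that the next state is in the Borel set $B\subseteq\mathbb{X}$ when action $a$ is chosen in state $x$. A function $f:\mathcal{U}\to\mathbb{R}\cup\{+\infty\}$ on a metric space $\mathcal{U}$ is inf-compact if $\{u\in \mathcal{U}: f(u)\le\lambda\}$ is compact for every $\lambda\in\mathbb{R}$. A function $f:\mathbb{X}\times\mathbb{A}\to\mathbb{R}\cup\{+\infty\}$ is $\mathbb{K}$-inf-compact if for every nonempty compact $K\subseteq\mathbb{X}$ its restriction to $K\times\mathbb{A}$ is inf-compact. Policies. Let $H_t=(\mathbb{X}\times\mathbb{A})^t\times\mathbb{X}$, $t=0,1,\ldots$. A (randomized) policy $\pi=(\pi_0,\pi_1,\ldots)$ is a sequence of regular transition probabilities $\pi_t$ from $H_t$ to $\mathbb{A}$; $\Pi$ is the set of all policies. A stationary policy is a non-randomized policy whose decisions depend only on the current state; it is identified with a measurable map $\phi:\mathbb{X}\to\mathbb{A}$. An initial state $x$ and a policy $\pi$ define, by the Ionescu Tulcea theorem, a probability on trajectories $(x_0,a_0,x_1,a_1,\ldots)$ with $x_0=x$; $\mathbb{E}_x^\pi$ denotes the corresponding expectation. Costs. For $N=0,1,\ldots$ and $\alpha\in[0,1]$, $v_{N,\alpha}^\pi(x)=\mathbb{E}_x^\pi\sum_{t=0}^{N-1}\alpha^t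 c(x_t,a_t)$ (with $v_{0,\alpha}^\pi=0$). For $\alpha\in[0,1)$, $v_\alpha^\pi(x)=\mathbb{E}_x^\pi\sum_{t=0}^{\infty}\alpha^t c(x_t,a_t)$ and $v_\alpha(x)=\inf_{\pi\in\Pi}v_\alpha^\pi(x)$. The average cost per unit time is $w^\pi(x)=\limsup_{N\to\infty}\frac1N v_{N,1}^\pi(x)$, and $w(x)=\inf_{\pi\in\Pi}w^\pi(x)$. A policy $\pi$ is average-cost optimal if $w^\pi(x)=w(x)$ for all $x\in\mathbb{X}$. For $\alpha\in[0,1)$ put $m_\alpha=\inf_{x\in\mathbb{X}}v_\alpha(x)$ and $u_\alpha(x)=v_\alpha(x)-m_\alpha$ (the discounted relative value function). Assumption (W* ): (i) $c$ is $\mathbb{K}$-inf-compact and bounded below; (ii) $q(\cdot|x,a)$ is weakly continuous in $(x,a)\in\mathbb{X}\times\mathbb{A}$, i.e. for every bounded continuous $f:\mathbb{X}\to\mathbb{R}$ the function $(x,a)\mapsto\int_{\mathbb{X}}f(y)\,q(dy|x,a)$ is continuous on $\mathbb{X}\times\mathbb{A}$. Assumption (B): (i) $w^*:=\inf_{x\in\mathbb{X}}w(x)<+\infty$; (ii) $\sup_{\alpha\in[0,1)}u_\alpha(x)<\infty$ for every $x\in\mathbb{X}$. The constant in the optimality equation is $w:=\liminf_{\alpha\uparrow1}(1-\alpha)m_\alpha$. (Known: under (W* ) and (B), $w=\lim_{\alpha\uparrow1}(1-\alpha)m_\alpha=w^*$, and $w(x)=w$ for every $x\in\mathbb{X}$.)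 For a sequence $\{\beta_n\}_{n\ge1}$ of nonnegative discount factors with $\beta_n\uparrow1$, the average-cost relative value function defined for this sequence is $$\tilde u(x)=\liminf_{n\to\infty,\;y\to x}u_{\beta_n}(y),\qquad x\in\mathbb{X},$$ i.e. $\tilde u(x)$ is the largest number such that $\tilde u(x)\le\liminf_{n\to\infty}u_{\beta_n}(y_n)$ for all sequences $y_n\to x$. A family $\mathcal{H}$ of real-valued functions on a metric space $X$ is equicontinuous at $x\in X$ if for each $\epsilon>0$ there is an open set $G\ni x$ such that $|h(y)-h(x)|<\epsilon$ for all $y\in G$ and all $h\in\mathcal{H}$; it is equicontinuous on $X$ if this holds at every $x\in X$. *)

theory Defs
  imports "HOL-Probability.Probability"
begin

text \<open>
  State and action spaces are Borel subsets \<open>states M\<close>, \<open>actions M\<close> of Polish types.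
  The cost and the transition kernel are total functions in Isabelle/HOL; only their values on
  \<open>states M \<times> actions M\<close> matter.
\<close>

record ('x, 'a) mdp =
  states :: "'x set"
  actions :: "'a set"
  cost :: "'x \<times> 'a \<Rightarrow> ereal"
  trans_prob :: "'x \<times> 'a \<Rightarrow> 'x measure"

definition state_space :: "('x::polish_space, 'a::polish_space) mdp \<Rightarrow> 'x measure" where
  "state_space M = restrict_space borel (states M)"

definition action_space :: "('x::polish_space, 'a::polish_space) mdp \<Rightarrow> 'a measure" where
  "action_space M = restrict_space borel (actions M)"

definition sa_space :: "('x::polish_space, 'a::polish_space) mdp \<Rightarrow> ('x \<times> 'a) measure" where
  "sa_space M = state_space M \<Otimes>\<^sub>M action_space M"

definition is_mdp :: "('x::polish_space, 'a::polish_space) mdp \<Rightarrow> bool" where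
  "is_mdp M \<longleftrightarrow>
     states M \<in> sets borel \<and> actions M \<in> sets borel \<and>
     (\<forall>z\<in>states M \<times> actions M. cost M z \<noteq> -\<infinity>) \<and>
     trans_prob M \<in> sa_space M \<rightarrow>\<^sub>M prob_algebra (state_space M)"


subsection \<open>Extended expectations\<close>

text \<open>
  The integral of an extended real function, positive part minus negative part. It is used only
  for functions that are bounded below on probability spaces, so \<open>\<infinity> - \<infinity>\<close> does not occur.
\<close>

definition eintegral :: "'b measure \<Rightarrow> ('b \<Rightarrow> ereal) \<Rightarrow> ereal" where
  "eintegral N f =
     enn2ereal (\<integral>\<^sup>+ z. e2ennreal (f z) \<partial>N) - enn2ereal (\<integral>\<^sup>+ z. e2ennreal (- f z) \<partial>N)"


subsection \<open>Policies and the strategic measure\<close>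

text \<open>
  A history in \<open>H\<^sub>t = (X \<times> A)\<^sup>t \<times> X\<close> is a pair of a function on \<open>{0..<t}\<close>, giving the past
  state-action pairs, and the current state.
\<close>

type_synonym ('x, 'a) policy = "nat \<Rightarrow> (nat \<Rightarrow> 'x \<times> 'a) \<times> 'x \<Rightarrow> 'a measure"

definition history_space ::
  "('x::polish_space, 'a::polish_space) mdp \<Rightarrow> nat \<Rightarrow> ((nat \<Rightarrow> 'x \<times> 'a) \<times> 'x) measure" where
  "history_space M t = PiM {0..<t} (\<lambda>_. sa_space M) \<Otimes>\<^sub>M state_space M"

definition policies :: "('x::polish_space, 'a::polish_space) mdp \<Rightarrow> ('x, 'a) policy set" where
  "policies M = {\<pi>. \<forall>t. \<pi> t \<in> history_space M t \<rightarrow>\<^sub>M prob_algebra (action_space M)}"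

definition stationary_maps :: "('x::polish_space, 'a::polish_space) mdp \<Rightarrow> ('x \<Rightarrow> 'a) set" where
  "stationary_maps M = state_space M \<rightarrow>\<^sub>M action_space M"

definition stationary_policy ::
  "('x::polish_space, 'a::polish_space) mdp \<Rightarrow> ('x \<Rightarrow> 'a) \<Rightarrow> ('x, 'a) policy" where
  "stationary_policy M \<phi> = (\<lambda>t (h, x). return (action_space M) (\<phi> x))"

text \<open>
  Conditional law of \<open>(x\<^sub>t, a\<^sub>t)\<close> given the first \<open>t\<close> state-action pairs \<open>h\<close>: draw \<open>x\<^sub>t\<close>
  (equal to the initial state if \<open>t = 0\<close>), then \<open>a\<^sub>t\<close> from \<open>\<pi>\<^sub>t(\<cdot> | h, x\<^sub>t)\<close>.
\<close>

definition next_state ::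
  "('x::polish_space, 'a::polish_space) mdp \<Rightarrow> 'x \<Rightarrow> nat \<Rightarrow> (nat \<Rightarrow> 'x \<times> 'a) \<Rightarrow> 'x measure" where
  "next_state M x t h =
     (case t of 0 \<Rightarrow> return (state_space M) x | Suc s \<Rightarrow> trans_prob M (h s))"

definition step_kernel ::
  "('x::polish_space, 'a::polish_space) mdp \<Rightarrow> ('x, 'a) policy \<Rightarrow> 'x
     \<Rightarrow> nat \<Rightarrow> (nat \<Rightarrow> 'x \<times> 'a) \<Rightarrow> ('x \<times> 'a) measure" where
  "step_kernel M \<pi> x t h =
     next_state M x t h \<bind> (\<lambda>y. \<pi> t (h, y) \<bind> (\<lambda>a. return (sa_space M) (y, a)))"

definition trajectory_measure ::
  "('x::polish_space, 'a::polish_space) mdp \<Rightarrow> ('x, 'a) policy \<Rightarrow> 'x \<Rightarrow> (nat \<Rightarrow> 'x \<times> 'a) measure" where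
  "trajectory_measure M \<pi> x =
     projective_family.lim UNIV (Ionescu_Tulcea.CI (step_kernel M \<pi> x) (\<lambda>_. sa_space M))
       (\<lambda>_. sa_space M)"


subsection \<open>Cost criteria\<close>

definition finite_horizon_cost ::
  "('x::polish_space, 'a::polish_space) mdp \<Rightarrow> nat \<Rightarrow> real \<Rightarrow> ('x, 'a) policy \<Rightarrow> 'x \<Rightarrow> ereal" where
  "finite_horizon_cost M N \<alpha> \<pi> x =
     eintegral (trajectory_measure M \<pi> x) (\<lambda>\<omega>. \<Sum>t<N. ereal (\<alpha> ^ t) * cost M (\<omega> t))"

definition discounted_cost ::
  "('x::polish_space, 'a::polish_space) mdp \<Rightarrow> real \<Rightarrow> ('x, 'a) policy \<Rightarrow> 'x \<Rightarrow> ereal" where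
  "discounted_cost M \<alpha> \<pi> x =
     eintegral (trajectory_measure M \<pi> x) (\<lambda>\<omega>. \<Sum>t. ereal (\<alpha> ^ t) * cost M (\<omega> t))"

definition discounted_value ::
  "('x::polish_space, 'a::polish_space) mdp \<Rightarrow> real \<Rightarrow> 'x \<Rightarrow> ereal" where
  "discounted_value M \<alpha> x = (INF \<pi>\<in>policies M. discounted_cost M \<alpha> \<pi> x)"

definition average_cost ::
  "('x::polish_space, 'a::polish_space) mdp \<Rightarrow> ('x, 'a) policy \<Rightarrow> 'x \<Rightarrow> ereal" where
  "average_cost M \<pi> x = limsup (\<lambda>N. ereal (1 / real N) * finite_horizon_cost M N 1 \<pi> x)"

definition average_value :: "('x::polish_space, 'a::polish_space) mdp \<Rightarrow> 'x \<Rightarrow> ereal" where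
  "average_value M x = (INF \<pi>\<in>policies M. average_cost M \<pi> x)"

definition average_cost_optimal ::
  "('x::polish_space, 'a::polish_space) mdp \<Rightarrow> ('x, 'a) policy \<Rightarrow> bool" where
  "average_cost_optimal M \<pi> \<longleftrightarrow>
     \<pi> \<in> policies M \<and> (\<forall>x\<in>states M. average_cost M \<pi> x = average_value M x)"

definition min_discounted :: "('x::polish_space, 'a::polish_space) mdp \<Rightarrow> real \<Rightarrow> ereal" where
  "min_discounted M \<alpha> = (INF x\<in>states M. discounted_value M \<alpha> x)"

definition disc_relative_value ::
  "('x::polish_space, 'a::polish_space) mdp \<Rightarrow> real \<Rightarrow> 'x \<Rightarrow> ereal" where
  "disc_relative_value M \<alpha> x = discounted_value M \<alpha> x - min_discounted M \<alpha>"

definition acoe_constant :: "('x::polish_space, 'a::polish_space) mdp \<Rightarrow> ereal" where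
  "acoe_constant M = Liminf (at_left 1) (\<lambda>\<alpha>. ereal (1 - \<alpha>) * min_discounted M \<alpha>)"

text \<open>In the lower limit, \<open>y\<close> ranges over the states and \<open>y = x\<close> is allowed.\<close>

definition avg_relative_value ::
  "('x::polish_space, 'a::polish_space) mdp \<Rightarrow> (nat \<Rightarrow> real) \<Rightarrow> 'x \<Rightarrow> ereal" where
  "avg_relative_value M \<beta> x =
     Liminf (sequentially \<times>\<^sub>F inf (nhds x) (principal (states M)))
       (\<lambda>(n, y). disc_relative_value M (\<beta> n) y)"


subsection \<open>Assumptions\<close>

definition inf_compact_on :: "'b::metric_space set \<Rightarrow> ('b \<Rightarrow> ereal) \<Rightarrow> bool" where
  "inf_compact_on S f \<longleftrightarrow> (\<forall>l::real. compact {u\<in>S. f u \<le> ereal l})"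

definition K_inf_compact ::
  "'x::metric_space set \<Rightarrow> 'a::metric_space set \<Rightarrow> ('x \<times> 'a \<Rightarrow> ereal) \<Rightarrow> bool" where
  "K_inf_compact X A f \<longleftrightarrow>
     (\<forall>K. K \<noteq> {} \<and> compact K \<and> K \<subseteq> X \<longrightarrow> inf_compact_on (K \<times> A) f)"

definition weakly_continuous_kernel :: "('x::polish_space, 'a::polish_space) mdp \<Rightarrow> bool" where
  "weakly_continuous_kernel M \<longleftrightarrow>
     (\<forall>f :: 'x \<Rightarrow> real. continuous_on (states M) f \<and> bounded (f ` states M) \<longrightarrow>
        continuous_on (states M \<times> actions M) (\<lambda>z. \<integral>y. f y \<partial>trans_prob M z))"

definition assumption_W :: "('x::polish_space, 'a::polish_space) mdp \<Rightarrow> bool" where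
  "assumption_W M \<longleftrightarrow>
     K_inf_compact (states M) (actions M) (cost M) \<and>
     (\<exists>b::real. \<forall>z\<in>states M \<times> actions M. ereal b \<le> cost M z) \<and>
     weakly_continuous_kernel M"

definition assumption_B :: "('x::polish_space, 'a::polish_space) mdp \<Rightarrow> bool" where
  "assumption_B M \<longleftrightarrow>
     (INF x\<in>states M. average_value M x) < \<infinity> \<and>
     (\<forall>x\<in>states M. (SUP \<alpha>\<in>{0..<1}. disc_relative_value M \<alpha> x) < \<infinity>)"

text \<open>
  Equicontinuity of a family \<open>H\<close> of functions on \<open>X\<close>, for values in \<open>ereal\<close>: if \<open>h x\<close> is infinite
  then \<open>\<bar>h x - h x\<bar> = \<infinity>\<close>, so every member of an equicontinuous family is automatically real-valued.
\<close>

definition equicontinuous_on :: "'b::metric_space set \<Rightarrow> ('b \<Rightarrow> ereal) set \<Rightarrow> bool" where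
  "equicontinuous_on X H \<longleftrightarrow>
     (\<forall>x\<in>X. \<forall>e>0. \<exists>G. openin (top_of_set X) G \<and> x \<in> G \<and>
        (\<forall>y\<in>G. \<forall>h\<in>H. \<bar>h y - h x\<bar> < ereal e))"


subsection \<open>The average-cost optimality equation\<close>

definition acoe_rhs ::
  "('x::polish_space, 'a::polish_space) mdp \<Rightarrow> ('x \<Rightarrow> ereal) \<Rightarrow> 'x \<Rightarrow> 'a \<Rightarrow> ereal" where
  "acoe_rhs M u x a = cost M (x, a) + eintegral (trans_prob M (x, a)) u"

text \<open>
  Since \<open>\<phi> x\<close> is an action, the second equality says that the infimum is attained, so it is the
  minimum required in the equation.
\<close>

definition satisfies_acoe ::
  "('x::polish_space, 'a::polish_space) mdp \<Rightarrow> ('x \<Rightarrow> ereal) \<Rightarrow> ('x \<Rightarrow> 'a) \<Rightarrow> bool" where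
  "satisfies_acoe M u \<phi> \<longleftrightarrow>
     \<phi> \<in> stationary_maps M \<and>
     (\<forall>x\<in>states M.
        acoe_constant M + u x = acoe_rhs M u x (\<phi> x) \<and>
        acoe_rhs M u x (\<phi> x) = (INF a\<in>actions M. acoe_rhs M u x a))"

end

theory Submission
  imports Defs "HOL-Library.Diagonal_Subsequence"
begin

text \<open>
  Write the cost as \<open>c - R\<close> with \<open>c \<ge> 0\<close> and a constant \<open>R\<close>. All dynamic programming then takes
  place with values in \<open>[0, \<infinity>]\<close>, where integrals and series need no integrability conditions.

  For a fixed discount factor \<open>\<alpha>\<close>, value iteration from zero increases to a lower semicontinuous
  function \<open>V\<close>. The cost has compact level sets in the action and the kernel is weakly continuous,
  so minimisation over actions commutes with increasing limits of lower semicontinuous functions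
  (\<open>increasing_lsc_minimiser\<close>); hence \<open>V\<close> solves the discounted optimality equation. Its minimisers can be
  chosen measurably (\<open>lsc_minimiser_selection\<close>). Iterating the equation along trajectories shows
  that \<open>V\<close> is at most the cost of every policy and at least the cost of the selected one, so
  \<open>V\<close> is the discounted value, which is finite because the relative values are. With \<open>m\<^sub>\<alpha> = inf V\<close> and \<open>u\<^sub>\<alpha> = V - m\<^sub>\<alpha>\<close> the equation reads
  \<open>(1 - \<alpha>) m\<^sub>\<alpha> + u\<^sub>\<alpha>(x) = min\<^sub>a (c(x, a) + \<alpha> \<integral> u\<^sub>\<alpha> dq(x, a))\<close>.

  The optimality equation of the average cost is the limit of these equations along the given
  discount factors, and three things have to converge.

  \<^item> The constants. The normalised minimum \<open>(1 - \<alpha>) m\<^sub>\<alpha>\<close> is nondecreasing in \<open>\<alpha>\<close>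
    (\<open>gain_mono\<close>): a discounted sum with factor \<open>\<alpha>\<close> is a positive combination of the tails of the
    stream discounted with a smaller factor \<open>\<beta>\<close>, and every tail costs at least \<open>m\<^sub>\<beta>\<close>. So the lower
    limit in the definition of the constant \<open>w\<close> is the limit along every sequence of factors below 1
    that tends to 1. An Abelian inequality bounds it by the average cost of every policy (\<open>acoe_constant_le_average_cost\<close>).

  \<^item> The functions. Equicontinuity and the bound \<open>U\<close> give a subsequence of relative values that
    converges pointwise to a continuous limit, which is also the joint lower limit
    defining \<open>avg_relative_value\<close>.

  \<^item> The integrals. For a fixed action, dominated convergence with \<open>U\<close> gives the inequality
    \<open>\<le>\<close> in the limit. For \<open>\<ge>\<close> the minimisers move with \<open>\<alpha>\<close>; here the relative values are
    bounded below by the infima of their tails, which are lower semicontinuous by equicontinuity and increase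
    to the limit, so the minimum can again be interchanged with the limit.

  Finally, iterating the limit equation along a stationary policy that satisfies it bounds its
  \<open>N\<close>-stage cost by \<open>N w + u(x)\<close>. Its average cost is therefore at most \<open>w\<close>, a lower bound for all
  policies.
\<close>

section \<open>Lower semicontinuity\<close>

text \<open>
  Sequential lower semicontinuity relative to \<open>S\<close>, for functions with values in \<open>[0, \<infinity>]\<close>. Only limits
  inside \<open>S\<close> are tested, because state and action spaces are Borel sets and need not be closed.
\<close>

definition lsc_on :: "'b::metric_space set \<Rightarrow> ('b \<Rightarrow> ennreal) \<Rightarrow> bool" where
  "lsc_on S f \<longleftrightarrow>
     (\<forall>z\<in>S. \<forall>s. (\<forall>n. s n \<in> S) \<longrightarrow> s \<longlonglongrightarrow> z \<longrightarrow> f z \<le> liminf (\<lambda>n. f (s n)))"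

lemma lsc_onD:
  "lsc_on S f \<Longrightarrow> z \<in> S \<Longrightarrow> (\<And>n. s n \<in> S) \<Longrightarrow> s \<longlonglongrightarrow> z \<Longrightarrow> f z \<le> liminf (\<lambda>n. f (s n))"
  by (auto simp: lsc_on_def)

lemma lsc_on_subset: "lsc_on S f \<Longrightarrow> T \<subseteq> S \<Longrightarrow> lsc_on T f"
  unfolding lsc_on_def by blast

text \<open>
  Lower limits are superadditive in \<open>[0, \<infinity>]\<close>, since the infima over the tails increase and suprema of increasing
  sequences add up.
\<close>

lemma lsc_on_add:
  assumes f: "lsc_on S f" and g: "lsc_on S g"
  shows "lsc_on S (\<lambda>z. f z + g z)"
  unfolding lsc_on_def
proof (intro ballI allI impI)
  fix z s assume s: "z \<in> S" "\<forall>n. s n \<in> S" "s \<longlonglongrightarrow> z"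
  have inc: "incseq (\<lambda>n. INF m\<in>{n..}. h m)" for h :: "nat \<Rightarrow> ennreal"
    by (intro incseq_SucI INF_superset_mono) auto
  have "f z + g z \<le> liminf (\<lambda>n. f (s n)) + liminf (\<lambda>n. g (s n))"
    using s by (intro add_mono lsc_onD[OF f] lsc_onD[OF g]) auto
  also have "\<dots> = (SUP n. (INF m\<in>{n..}. f (s m)) + (INF m\<in>{n..}. g (s m)))"
    unfolding liminf_SUP_INF by (intro ennreal_SUP_add[symmetric] inc)
  also have "\<dots> \<le> liminf (\<lambda>n. f (s n) + g (s n))"
    unfolding liminf_SUP_INF by (intro SUP_mono') (intro INF_greatest add_mono INF_lower; simp)
  finally show "f z + g z \<le> liminf (\<lambda>n. f (s n) + g (s n))" .
qed

lemma lsc_on_cmult: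
  assumes f: "lsc_on S f"
  shows "lsc_on S (\<lambda>z. c * f z)"
  unfolding lsc_on_def
proof (intro ballI allI impI)
  fix z s assume s: "z \<in> S" "\<forall>n. s n \<in> S" "s \<longlonglongrightarrow> z"
  have "c * f z \<le> c * liminf (\<lambda>n. f (s n))"
    using s by (intro mult_left_mono lsc_onD[OF f]) auto
  also have "\<dots> = (SUP n. c * (INF m\<in>{n..}. f (s m)))"
    unfolding liminf_SUP_INF by (rule SUP_mult_left_ennreal)
  also have "\<dots> \<le> liminf (\<lambda>n. c * f (s n))"
    unfolding liminf_SUP_INF
    by (intro SUP_mono') (intro INF_greatest mult_left_mono INF_lower; simp)
  finally show "c * f z \<le> liminf (\<lambda>n. c * f (s n))" .
qed

lemma lsc_on_SUP:
  assumes "\<And>i. i \<in> I \<Longrightarrow> lsc_on S (f i)"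
  shows "lsc_on S (\<lambda>z. SUP i\<in>I. f i z)"
  unfolding lsc_on_def
proof (intro ballI allI impI SUP_least)
  fix z s i assume s: "z \<in> S" "\<forall>n. s n \<in> S" "s \<longlonglongrightarrow> z" and i: "i \<in> I"
  have "f i z \<le> liminf (\<lambda>n. f i (s n))"
    using s by (intro lsc_onD[OF assms[OF i]]) auto
  also have "\<dots> \<le> liminf (\<lambda>n. SUP i\<in>I. f i (s n))"
    using i by (intro Liminf_mono always_eventually allI SUP_upper)
  finally show "f i z \<le> liminf (\<lambda>n. SUP i\<in>I. f i (s n))" .
qed

lemma liminf_lessE:
  fixes f :: "nat \<Rightarrow> ennreal"
  assumes "liminf f < l"
  obtains r :: "nat \<Rightarrow> nat" where "strict_mono r" "\<And>n. f (r n) < l"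
proof -
  have "\<exists>\<^sub>F n in sequentially. f n < l"
  proof (rule ccontr)
    assume "\<not> ?thesis"
    then have "\<forall>\<^sub>F n in sequentially. l \<le> f n"
      by (simp add: not_frequently not_less)
    then have "l \<le> liminf f" by (rule Liminf_bounded)
    with assms show False by simp
  qed
  then have "infinite {n. f n < l}" by (simp add: cofinite_eq_sequentially[symmetric] frequently_cofinite)
  from infinite_enumerate[OF this] show ?thesis using that by blast
qed

lemma lsc_on_open_neighbourhood:
  assumes f: "lsc_on S f" and x: "x \<in> S" and l: "l < f x"
  obtains d where "0 < d" "\<And>y. y \<in> S \<Longrightarrow> dist x y < d \<Longrightarrow> l < f y"
proof -
  have "\<exists>d>0. \<forall>y\<in>S. dist x y < d \<longrightarrow> l < f y"
  proof (rule ccontr)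
    assume "\<not> ?thesis"
    then have "\<forall>n::nat. \<exists>y\<in>S. dist x y < inverse (real (Suc n)) \<and> f y \<le> l"
      by (metis inverse_positive_iff_positive not_less of_nat_0_less_iff zero_less_Suc)
    then obtain s where s: "\<And>n. s n \<in> S" "\<And>n. dist x (s n) < inverse (real (Suc n))" "\<And>n. f (s n) \<le> l"
      by metis
    have "(\<lambda>n. dist x (s n)) \<longlonglongrightarrow> 0"
      by (rule tendsto_sandwich[OF _ _ tendsto_const LIMSEQ_inverse_real_of_nat])
         (intro always_eventually allI zero_le_dist less_imp_le[OF s(2)])+
    then have "s \<longlonglongrightarrow> x" by (subst tendsto_dist_iff) (simp add: dist_commute)
    then have "f x \<le> liminf (\<lambda>n. f (s n))" by (intro lsc_onD[OF f x s(1)])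
    also have "\<dots> \<le> l" by (intro Liminf_le always_eventually allI s) simp
    finally show False using l by simp
  qed
  then show ?thesis using that by blast
qed

lemma borel_measurable_lsc_on:
  assumes f: "lsc_on S f"
  shows "f \<in> borel_measurable (restrict_space borel S)"
proof (rule borel_measurableI_greater)
  fix l
  have "\<exists>d>0. \<forall>y\<in>S. dist x y < d \<longrightarrow> l < f y" if "x \<in> S" "l < f x" for x
    using lsc_on_open_neighbourhood[OF f that] by metis
  then obtain d where d: "\<And>x y. x \<in> S \<Longrightarrow> l < f x \<Longrightarrow> y \<in> S \<Longrightarrow> dist x y < d x \<Longrightarrow> l < f y"
    and d0: "\<And>x. x \<in> S \<Longrightarrow> l < f x \<Longrightarrow> 0 < d x" by metis
  have "{x \<in> S. l < f x} = S \<inter> (\<Union>x\<in>{x\<in>S. l < f x}. ball x (d x))"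
  proof (intro equalityI subsetI)
    fix y assume "y \<in> S \<inter> (\<Union>x\<in>{x\<in>S. l < f x}. ball x (d x))"
    then obtain x where "y \<in> S" "x \<in> S" "l < f x" "dist x y < d x" by auto
    then show "y \<in> {x \<in> S. l < f x}" using d by blast
  qed (use d0 in auto)
  also have "\<dots> \<in> sets (restrict_space borel S)"
    by (auto simp: sets_restrict_space intro!: imageI borel_open open_UN)
  finally show "{x \<in> space (restrict_space borel S). l < f x} \<in> sets (restrict_space borel S)"
    by (simp add: space_restrict_space)
qed

text \<open>
  The Pasch-Hausdorff envelope: the largest \<open>k\<close>-Lipschitz function on \<open>S\<close> below the truncation of \<open>f\<close> at \<open>k\<close>.
  These envelopes are bounded and continuous, so weak continuity of a kernel applies to them.
\<close>

definition lipschitz_envelope :: "'b::metric_space set \<Rightarrow> ('b \<Rightarrow> ennreal) \<Rightarrow> nat \<Rightarrow> 'b \<Rightarrow> ennreal" where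
  "lipschitz_envelope S f k x = (INF y\<in>S. min (f y) (of_nat k) + of_nat k * ennreal (dist x y))"

lemma lipschitz_envelope_le:
  assumes "x \<in> S"
  shows "lipschitz_envelope S f k x \<le> min (f x) (of_nat k)"
  using INF_lower[OF assms, of "\<lambda>y. min (f y) (of_nat k) + of_nat k * ennreal (dist x y)"]
  by (simp add: lipschitz_envelope_def)

lemma lipschitz_envelope_mono: "k \<le> l \<Longrightarrow> lipschitz_envelope S f k x \<le> lipschitz_envelope S f l x"
  unfolding lipschitz_envelope_def
  by (intro INF_mono' add_mono mult_right_mono min.mono) auto

lemma lipschitz_envelope_lipschitz:
  "lipschitz_envelope S f k x \<le> lipschitz_envelope S f k x' + of_nat k * ennreal (dist x x')"
proof (cases "S = {}")
  case False
  have "lipschitz_envelope S f k x \<le>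
      min (f y) (of_nat k) + of_nat k * ennreal (dist x' y) + of_nat k * ennreal (dist x x')" if "y \<in> S" for y
  proof -
    have "ennreal (dist x y) \<le> ennreal (dist x' y) + ennreal (dist x x')"
      using dist_triangle[of x y x'] by (simp add: ennreal_plus[symmetric] ennreal_leI del: ennreal_plus)
    then have "of_nat k * ennreal (dist x y) \<le> of_nat k * ennreal (dist x' y) + of_nat k * ennreal (dist x x')"
      by (simp add: distrib_left[symmetric] mult_left_mono)
    then show ?thesis
      unfolding lipschitz_envelope_def
      by (intro INF_lower2[OF that]) (auto simp: add.assoc intro: add_left_mono)
  qed
  moreover have "of_nat k * ennreal (dist x x') \<noteq> top"
    by (simp add: ennreal_of_nat_eq_real_of_nat ennreal_mult[symmetric])
  ultimately have "lipschitz_envelope S f k x - of_nat k * ennreal (dist x x') \<le> lipschitz_envelope S f k x'"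
    unfolding lipschitz_envelope_def[of S f k x']
    by (intro INF_greatest) (simp add: ennreal_minus_le_iff add.commute)
  with \<open>of_nat k * ennreal (dist x x') \<noteq> top\<close> show ?thesis
    by (simp add: ennreal_minus_le_iff add.commute)
qed (simp add: lipschitz_envelope_def)

text \<open>
  If \<open>l < f x\<close>, points \<open>y\<close> near \<open>x\<close> have \<open>f y > l\<close> and at distant points the penalty \<open>k * dist x y\<close>
  exceeds \<open>l\<close> as soon as \<open>k\<close> is large; so the envelope at \<open>x\<close> is eventually at least \<open>l\<close>.
\<close>

lemma SUP_lipschitz_envelope:
  assumes f: "lsc_on S f" and x: "x \<in> S"
  shows "(SUP k. lipschitz_envelope S f k x) = f x"
proof (rule antisym)
  show "(SUP k. lipschitz_envelope S f k x) \<le> f x"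
    using lipschitz_envelope_le[OF x, of f] by (intro SUP_least) simp
  show "f x \<le> (SUP k. lipschitz_envelope S f k x)"
  proof (rule dense_le)
    fix l assume l: "l < f x"
    then obtain d where d: "0 < d" "\<And>y. y \<in> S \<Longrightarrow> dist x y < d \<Longrightarrow> l < f y"
      using lsc_on_open_neighbourhood[OF f x] by metis
    obtain l' where l': "l = ennreal l'" "0 \<le> l'"
      using l by (cases l) (auto simp: top_unique)
    obtain k :: nat where k: "max l' (l' / d) \<le> real k" using real_arch_simple by blast
    have kd: "l' \<le> real k * d" using k d(1) by (simp add: divide_le_eq)
    have "l \<le> min (f y) (of_nat k) + of_nat k * ennreal (dist x y)" if y: "y \<in> S" for y
    proof (cases "dist x y < d")
      case True
      have "l \<le> of_nat k" using k l' by (simp add: ennreal_of_nat_eq_real_of_nat ennreal_leI)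
      with d(2)[OF y True] have "l \<le> min (f y) (of_nat k)" by simp
      then show ?thesis by (rule add_increasing2[rotated]) simp
    next
      case False
      have "l' \<le> real k * dist x y"
        using kd False by (meson linorder_not_less mult_left_mono of_nat_0_le_iff order_trans)
      then have "l \<le> of_nat k * ennreal (dist x y)"
        by (simp add: l' ennreal_of_nat_eq_real_of_nat ennreal_mult[symmetric] ennreal_leI)
      then show ?thesis by (rule add_increasing[rotated]) simp
    qed
    then have "l \<le> lipschitz_envelope S f k x"
      unfolding lipschitz_envelope_def by (rule INF_greatest)
    then show "l \<le> (SUP k. lipschitz_envelope S f k x)"
      by (rule SUP_upper2[rotated]) simp
  qed
qed

lemma continuous_on_lipschitz_envelope:
  "continuous_on S (\<lambda>x. enn2real (lipschitz_envelope S f k x))"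
proof -
  have fin: "lipschitz_envelope S f k x < top" if "x \<in> S" for x
    using lipschitz_envelope_le[OF that, of f k] of_nat_less_top[of k] by (auto intro: order_le_less_trans)
  have le: "enn2real (lipschitz_envelope S f k x) \<le> enn2real (lipschitz_envelope S f k y) + real k * dist x y"
    if "x \<in> S" "y \<in> S" for x y
  proof -
    have "enn2real (lipschitz_envelope S f k x) \<le>
        enn2real (lipschitz_envelope S f k y + of_nat k * ennreal (dist x y))"
      using fin[OF that(2)] by (intro enn2real_mono lipschitz_envelope_lipschitz)
         (simp add: ennreal_of_nat_eq_real_of_nat ennreal_mult[symmetric])
    also have "\<dots> = enn2real (lipschitz_envelope S f k y) + real k * dist x y"
      using fin[OF that(2)]
      by (subst enn2real_plus) (simp_all add: ennreal_of_nat_eq_real_of_nat ennreal_mult[symmetric])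
    finally show ?thesis .
  qed
  have "(real k)-lipschitz_on S (\<lambda>x. enn2real (lipschitz_envelope S f k x))"
  proof (rule lipschitz_onI)
    fix x y assume "x \<in> S" "y \<in> S"
    then show "dist (enn2real (lipschitz_envelope S f k x)) (enn2real (lipschitz_envelope S f k y)) \<le> real k * dist x y"
      using le[of x y] le[of y x] by (simp add: dist_real_def abs_le_iff dist_commute)
  qed simp
  then show ?thesis by (rule lipschitz_on_continuous_on)
qed

text \<open>
  The integral of \<open>f\<close> is the supremum of the integrals of its Lipschitz envelopes, each of which is continuous in \<open>z\<close>
  by weak continuity.
\<close>

lemma lsc_on_nn_integral_kernel:
  fixes q :: "'c::metric_space \<Rightarrow> 'b::metric_space measure"
  assumes q: "\<And>z. z \<in> Z \<Longrightarrow> prob_space (q z)" "\<And>z. z \<in> Z \<Longrightarrow> sets (q z) = sets (restrict_space borel S)"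
    and weak: "\<And>f :: 'b \<Rightarrow> real. continuous_on S f \<Longrightarrow> bounded (f ` S) \<Longrightarrow>
       continuous_on Z (\<lambda>z. \<integral>y. f y \<partial>q z)"
    and f: "lsc_on S f"
  shows "lsc_on Z (\<lambda>z. \<integral>\<^sup>+ y. f y \<partial>q z)"
proof -
  let ?e = "lipschitz_envelope S f"
  have sp: "space (q z) = S" if "z \<in> Z" for z
    using sets_eq_imp_space_eq[OF q(2)[OF that]] by (simp add: space_restrict_space)
  have e_le: "?e k x \<le> ennreal (real k)" if "x \<in> S" for k x
    using lipschitz_envelope_le[OF that, of f k] by (simp add: ennreal_of_nat_eq_real_of_nat)
  have e_real: "ennreal (enn2real (?e k x)) = ?e k x" if "x \<in> S" for k x
    using e_le[OF that, of k] by (simp add: order_le_less_trans[OF _ ennreal_less_top])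
  have e_meas: "(\<lambda>x. enn2real (?e k x)) \<in> borel_measurable (q z)" if "z \<in> Z" for k z
    using borel_measurable_continuous_on_restrict[OF continuous_on_lipschitz_envelope]
    by (simp add: measurable_cong_sets[OF q(2)[OF that] refl])
  have e_nn: "(\<integral>\<^sup>+ y. ?e k y \<partial>q z) = ennreal (\<integral>y. enn2real (?e k y) \<partial>q z)" if z: "z \<in> Z" for k z
  proof -
    interpret prob_space "q z" by (rule q[OF z])
    have "integrable (q z) (\<lambda>y. enn2real (?e k y))"
      using e_le e_real by (intro integrable_const_bound[where B="real k"] e_meas[OF z])
        (auto simp: sp[OF z] intro!: AE_I2 enn2real_leI)
    then have "(\<integral>\<^sup>+ y. ennreal (enn2real (?e k y)) \<partial>q z) = ennreal (\<integral>y. enn2real (?e k y) \<partial>q z)"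
      by (intro nn_integral_eq_integral) auto
    moreover have "(\<integral>\<^sup>+ y. ennreal (enn2real (?e k y)) \<partial>q z) = (\<integral>\<^sup>+ y. ?e k y \<partial>q z)"
      by (intro nn_integral_cong e_real) (simp add: sp[OF z])
    ultimately show ?thesis by simp
  qed
  have "lsc_on Z (\<lambda>z. \<integral>\<^sup>+ y. ?e k y \<partial>q z)" for k
    unfolding lsc_on_def
  proof (intro ballI allI impI)
    fix z s assume s: "z \<in> Z" "\<forall>n. s n \<in> Z" "s \<longlonglongrightarrow> z"
    have "bounded ((\<lambda>x. enn2real (?e k x)) ` S)"
      using e_le by (intro boundedI[where B="real k"]) (auto intro!: enn2real_leI)
    then have "continuous_on Z (\<lambda>z. \<integral>y. enn2real (?e k y) \<partial>q z)"
      by (intro weak continuous_on_lipschitz_envelope)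
    then have "(\<lambda>n. \<integral>y. enn2real (?e k y) \<partial>q (s n)) \<longlonglongrightarrow> (\<integral>y. enn2real (?e k y) \<partial>q z)"
      using s by (auto simp: continuous_on_sequentially comp_def)
    then have "(\<lambda>n. \<integral>\<^sup>+ y. ?e k y \<partial>q (s n)) \<longlonglongrightarrow> (\<integral>\<^sup>+ y. ?e k y \<partial>q z)"
      using s by (simp add: e_nn tendsto_ennrealI)
    then show "(\<integral>\<^sup>+ y. ?e k y \<partial>q z) \<le> liminf (\<lambda>n. \<integral>\<^sup>+ y. ?e k y \<partial>q (s n))"
      using lim_imp_Liminf[OF sequentially_bot] by (metis order_refl)
  qed
  then have lsc: "lsc_on Z (\<lambda>z. SUP k. \<integral>\<^sup>+ y. ?e k y \<partial>q z)"
    by (rule lsc_on_SUP)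
  have eq: "(\<integral>\<^sup>+ y. f y \<partial>q z) = (SUP k. \<integral>\<^sup>+ y. ?e k y \<partial>q z)" if z: "z \<in> Z" for z
  proof -
    have "(\<integral>\<^sup>+ y. f y \<partial>q z) = (\<integral>\<^sup>+ y. (SUP k. ?e k y) \<partial>q z)"
      by (intro nn_integral_cong) (simp add: sp[OF z] SUP_lipschitz_envelope[OF f])
    also have "\<dots> = (\<integral>\<^sup>+ y. (SUP k. ennreal (enn2real (?e k y))) \<partial>q z)"
      by (intro nn_integral_cong) (simp add: sp[OF z] e_real)
    also have "\<dots> = (SUP k. \<integral>\<^sup>+ y. ennreal (enn2real (?e k y)) \<partial>q z)"
    proof (rule nn_integral_monotone_convergence_SUP_AE)
      show "AE y in q z. ennreal (enn2real (?e k y)) \<le> ennreal (enn2real (?e (Suc k) y))" for k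
        by (intro AE_I2) (simp add: sp[OF z] e_real lipschitz_envelope_mono)
      show "(\<lambda>y. ennreal (enn2real (?e k y))) \<in> borel_measurable (q z)" for k
        using e_meas[OF z] by measurable
    qed
    also have "\<dots> = (SUP k. \<integral>\<^sup>+ y. ?e k y \<partial>q z)"
      by (intro SUP_cong refl nn_integral_cong) (simp add: sp[OF z] e_real)
    finally show ?thesis .
  qed
  from lsc show ?thesis by (simp add: lsc_on_def eq)
qed

section \<open>Minimisation over actions and measurable selection\<close>

text \<open>
  The sequential consequence of K-inf-compactness on which all minimisation rests: along a convergent
  sequence of states, actions with bounded cost have a convergent subsequence. In contrast to
  K-inf-compactness it passes to every larger function.
\<close>

definition action_compact :: "'b::metric_space set \<Rightarrow> 'c::metric_space set \<Rightarrow> ('b \<times> 'c \<Rightarrow> ennreal) \<Rightarrow> bool" where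
  "action_compact X A F \<longleftrightarrow>
     (\<forall>x\<in>X. \<forall>s a l. (\<forall>n. s n \<in> X) \<longrightarrow> s \<longlonglongrightarrow> x \<longrightarrow> (\<forall>n. a n \<in> A) \<longrightarrow> l < top \<longrightarrow>
        (\<forall>n::nat. F (s n, a n) \<le> l) \<longrightarrow> (\<exists>r b. strict_mono r \<and> b \<in> A \<and> (a \<circ> r) \<longlonglongrightarrow> b))"

lemma action_compactD:
  assumes "action_compact X A F" "x \<in> X" "\<And>n. s n \<in> X" "s \<longlonglongrightarrow> x" "\<And>n::nat. a n \<in> A"
    "l < top" "\<And>n. F (s n, a n) \<le> l"
  obtains r b where "strict_mono r" "b \<in> A" "(a \<circ> r) \<longlonglongrightarrow> b"
  using assms unfolding action_compact_def by metis

lemma action_compact_mono: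
  assumes F: "action_compact X A F" and le: "\<And>z. z \<in> X \<times> A \<Longrightarrow> F z \<le> G z"
  shows "action_compact X A G"
  unfolding action_compact_def
proof (intro ballI allI impI)
  fix x s a l
  assume *: "x \<in> X" "\<forall>n. s n \<in> X" "s \<longlonglongrightarrow> x" "\<forall>n. a n \<in> A" "l < top" "\<forall>n::nat. G (s n, a n) \<le> l"
  have "F (s n, a n) \<le> l" for n
    using le[of "(s n, a n)"] * by (auto intro: order_trans[of _ "G (s n, a n)"])
  with * obtain r b where "strict_mono r" "b \<in> A" "(a \<circ> r) \<longlonglongrightarrow> b"
    by (auto elim!: action_compactD[OF F, of x s a l])
  then show "\<exists>r b. strict_mono r \<and> b \<in> A \<and> (a \<circ> r) \<longlonglongrightarrow> b" by blast
qed

lemma action_compact_closed: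
  assumes F: "action_compact X A F" and B: "closed B"
  shows "action_compact X (A \<inter> B) F"
  unfolding action_compact_def
proof (intro ballI allI impI)
  fix x s a l
  assume *: "x \<in> X" "\<forall>n. s n \<in> X" "s \<longlonglongrightarrow> x" "\<forall>n. a n \<in> A \<inter> B" "l < top" "\<forall>n::nat. F (s n, a n) \<le> l"
  then obtain r b where rb: "strict_mono r" "b \<in> A" "(a \<circ> r) \<longlonglongrightarrow> b"
    by (auto elim!: action_compactD[OF F, of x s a l])
  moreover have "b \<in> B"
    using closed_sequentially[OF B _ rb(3)] *(4) by simp
  ultimately show "\<exists>r b. strict_mono r \<and> b \<in> A \<inter> B \<and> (a \<circ> r) \<longlonglongrightarrow> b" by blast
qed

text \<open>
  A sequence of states at which the infimum stays below \<open>l\<close> comes with nearly optimal actions; a limit point of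
  these actions witnesses that the infimum at the limit state is at most \<open>l\<close>.
\<close>

lemma lsc_on_partial_INF:
  assumes F: "lsc_on (X \<times> A) F" and comp: "action_compact X A F"
  shows "lsc_on X (\<lambda>x. INF a\<in>A. F (x, a))"
  unfolding lsc_on_def
proof (intro ballI allI impI)
  fix x s assume x: "x \<in> X" and s: "\<forall>n. s n \<in> X" "s \<longlonglongrightarrow> x"
  show "(INF a\<in>A. F (x, a)) \<le> liminf (\<lambda>n. INF a\<in>A. F (s n, a))"
  proof (rule ccontr)
    assume "\<not> ?thesis"
    then have less: "liminf (\<lambda>n. INF a\<in>A. F (s n, a)) < (INF a\<in>A. F (x, a))" by simp
    obtain l where l: "liminf (\<lambda>n. INF a\<in>A. F (s n, a)) < l" "l < (INF a\<in>A. F (x, a))"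
      using dense[OF less] by blast
    obtain r :: "nat \<Rightarrow> nat" where r: "strict_mono r" "\<And>n. (INF a\<in>A. F (s (r n), a)) < l"
      by (rule liminf_lessE[OF l(1)]) (rule that)
    then have "\<forall>n. \<exists>a\<in>A. F (s (r n), a) < l" by (simp add: INF_less_iff)
    then obtain a where a: "\<And>n. a n \<in> A" "\<And>n. F (s (r n), a n) < l" by metis
    have sr: "(\<lambda>n. s (r n)) \<longlonglongrightarrow> x"
      using LIMSEQ_subseq_LIMSEQ[OF s(2) r(1)] by (simp add: comp_def)
    obtain r' b where r': "strict_mono r'" "b \<in> A" "(a \<circ> r') \<longlonglongrightarrow> b"
    proof (rule action_compactD[OF comp x, of "\<lambda>n. s (r n)" a l])
      show "l < top" using l(2) by (rule order.strict_trans2) simp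
    qed (use s sr a in \<open>auto intro: less_imp_le\<close>)
    have "(\<lambda>n. (s (r (r' n)), a (r' n))) \<longlonglongrightarrow> (x, b)"
      using LIMSEQ_subseq_LIMSEQ[OF sr r'(1)] r'(3) by (intro tendsto_Pair) (simp_all add: comp_def)
    then have "F (x, b) \<le> liminf (\<lambda>n. F (s (r (r' n)), a (r' n)))"
      using s a x r' by (intro lsc_onD[OF F]) auto
    also have "\<dots> \<le> l"
      by (intro Liminf_le always_eventually allI less_imp_le a) simp
    finally have "(INF a\<in>A. F (x, a)) \<le> l" using r'(2) by (auto intro: INF_lower2)
    with l(2) show False by simp
  qed
qed

text \<open>
  Minimum and increasing limit can be interchanged: near-minimisers \<open>a\<^sub>n\<close> of \<open>F n\<close> have a limit point \<open>b\<close>, and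
  \<open>F n (x, b) \<le> liminf F n (x, a\<^sub>m) \<le> liminf F m (x, a\<^sub>m) \<le> l\<close> for every \<open>n\<close>.
\<close>

lemma increasing_lsc_minimiser:
  fixes F :: "nat \<Rightarrow> 'b::metric_space \<times> 'c::metric_space \<Rightarrow> ennreal"
  assumes F: "\<And>n. lsc_on (X \<times> A) (F n)" and comp: "action_compact X A (F 0)" and x: "x \<in> X"
    and mono: "\<And>m n a. a \<in> A \<Longrightarrow> m \<le> n \<Longrightarrow> F m (x, a) \<le> F n (x, a)"
    and le: "\<And>n. (INF a\<in>A. F n (x, a)) \<le> l" and l: "l < top"
  obtains a where "a \<in> A" "\<And>n. F n (x, a) \<le> l"
proof -
  let ?l = "\<lambda>n. l + ennreal (inverse (real (Suc n)))"
  have "(INF a\<in>A. F n (x, a)) < ?l n" for n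
  proof -
    have "l < l + ennreal (inverse (real (Suc n)))"
      using l ennreal_add_left_cancel_less[of l 0 "ennreal (inverse (real (Suc n)))"] by simp
    with le[of n] show ?thesis by (rule order_le_less_trans)
  qed
  then have "\<forall>n. \<exists>a\<in>A. F n (x, a) < ?l n" by (simp add: INF_less_iff)
  then obtain a where a: "\<And>n. a n \<in> A" "\<And>n. F n (x, a n) < ?l n" by metis
  have l1: "F n (x, a m) \<le> ?l n" if "n \<le> m" for n m
  proof -
    have "F n (x, a m) \<le> F m (x, a m)" by (intro mono a that)
    also have "\<dots> \<le> ?l m" using a(2) by (rule less_imp_le)
    also have "\<dots> \<le> ?l n" using that by (intro add_left_mono ennreal_leI) (simp add: field_simps)
    finally show ?thesis .
  qed
  obtain r b where r: "strict_mono r" "b \<in> A" "(a \<circ> r) \<longlonglongrightarrow> b"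
  proof (rule action_compactD[OF comp x, of "\<lambda>_. x" a "l + 1"])
    show "l + 1 < top" using l by (simp add: ennreal_add_less_top)
    show "F 0 (x, a n) \<le> l + 1" for n using l1[of 0 n] by simp
  qed (use x a in auto)
  have "F n (x, b) \<le> l" for n
  proof -
    have conv: "(\<lambda>m. (x, a (r m))) \<longlonglongrightarrow> (x, b)"
      using r(3) by (intro tendsto_Pair) (simp_all add: comp_def)
    have lim: "(\<lambda>m. ?l (r m)) \<longlonglongrightarrow> l + ennreal 0"
    proof (intro tendsto_add tendsto_const tendsto_ennrealI)
      show "(\<lambda>m. inverse (real (Suc (r m)))) \<longlonglongrightarrow> 0"
        using LIMSEQ_subseq_LIMSEQ[OF LIMSEQ_inverse_real_of_nat r(1)] by (simp add: comp_def)
    qed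
    have "F n (x, b) \<le> liminf (\<lambda>m. F n (x, a (r m)))"
      using x a r conv by (intro lsc_onD[OF F]) auto
    also have "\<dots> \<le> liminf (\<lambda>m. ?l (r m))"
    proof (rule Liminf_mono)
      show "\<forall>\<^sub>F m in sequentially. F n (x, a (r m)) \<le> ?l (r m)"
        using eventually_ge_at_top[of n]
      proof eventually_elim
        case (elim m)
        have "n \<le> r m" using elim seq_suble[OF r(1), of m] by simp
        then have "F n (x, a (r m)) \<le> F (r m) (x, a (r m))" by (intro mono a)
        also have "\<dots> \<le> ?l (r m)" using a(2) by (rule less_imp_le)
        finally show ?case .
      qed
    qed
    also have "\<dots> = l" using lim_imp_Liminf[OF sequentially_bot lim] by simp
    finally show ?thesis .
  qed
  with r(2) that show ?thesis by blast
qed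

lemma lsc_minimum_attained:
  assumes "lsc_on (X \<times> A) F" "action_compact X A F" "x \<in> X" "(INF a\<in>A. F (x, a)) < top"
  obtains a where "a \<in> A" "F (x, a) = (INF a\<in>A. F (x, a))"
proof -
  obtain a where "a \<in> A" "F (x, a) \<le> (INF a\<in>A. F (x, a))"
    using increasing_lsc_minimiser[of X A "\<lambda>_. F" x "INF a\<in>A. F (x, a)"] assms by auto
  then show ?thesis by (intro that antisym) (auto intro: INF_lower)
qed

text \<open>
  Measurable selection from compact sets whose hitting events are measurable. The selected point is the
  lexicographic minimiser of the distances to a dense sequence: minimise the distance to \<open>d 0\<close> on \<open>S x\<close>, then the
  distance to \<open>d 1\<close> on the set of minimisers, and so on. The sets stay compact and nonempty, so they have
  a common point; it is unique because it has prescribed distances to a dense sequence. Each step preserves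
  measurability of the hitting events, since the new set meets \<open>B\<close> if and only if every ball with centre \<open>d k\<close> and
  rational radius that meets the old set meets it within \<open>B\<close>.
\<close>

lemma compact_valued_measurable_selection:
  fixes S :: "'b \<Rightarrow> 'c::polish_space set"
  assumes comp: "\<And>x. x \<in> space N \<Longrightarrow> compact (S x)" and ne: "\<And>x. x \<in> space N \<Longrightarrow> S x \<noteq> {}"
    and hit: "\<And>B. closed B \<Longrightarrow> {x \<in> space N. S x \<inter> B \<noteq> {}} \<in> sets N"
  obtains \<phi> where "\<phi> \<in> borel_measurable N" "\<And>x. x \<in> space N \<Longrightarrow> \<phi> x \<in> S x"
proof -
  obtain D :: "'c set" where D: "countable D" "\<And>X. open X \<Longrightarrow> X \<noteq> {} \<Longrightarrow> \<exists>d\<in>D. d \<in> X"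
    using countable_dense_setE by blast
  define d where "d = from_nat_into D"
  have d: "\<exists>k. dist a (d k) < e" if "0 < e" for a e
  proof -
    have "ball a e \<noteq> {}" using that by simp
    then obtain b where "b \<in> D" "dist a b < e" using D(2)[of "ball a e"] by auto
    then show ?thesis unfolding d_def by (metis D(1) from_nat_into_surj)
  qed
  \<comment> \<open>\<open>T k x\<close>: the points of \<open>S x\<close> left after minimising the distances to \<open>d 0, ..., d (k - 1)\<close> in turn.\<close>
  define T where "T = rec_nat S (\<lambda>k T x. {a \<in> T x. \<forall>b\<in>T x. dist (d k) a \<le> dist (d k) b})"
  have T0: "T 0 = S" and TS: "\<And>k x. T (Suc k) x = {a \<in> T k x. \<forall>b\<in>T k x. dist (d k) a \<le> dist (d k) b}"
    by (simp_all add: T_def)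
  have T: "(\<forall>x\<in>space N. compact (T k x) \<and> T k x \<noteq> {}) \<and>
      (\<forall>B. closed B \<longrightarrow> {x \<in> space N. T k x \<inter> B \<noteq> {}} \<in> sets N)" for k
  proof (induction k)
    case 0 then show ?case using comp ne hit by (simp add: T0)
  next
    case (Suc k)
    have min: "\<exists>a\<in>C. \<forall>b\<in>C. dist (d k) a \<le> dist (d k) b" if "compact C" "C \<noteq> {}" for C
      using continuous_attains_inf[OF that continuous_on_dist[OF continuous_on_const continuous_on_id]] by auto
    have "compact (T (Suc k) x) \<and> T (Suc k) x \<noteq> {}" if x: "x \<in> space N" for x
    proof -
      obtain a where a: "a \<in> T k x" "\<forall>b\<in>T k x. dist (d k) a \<le> dist (d k) b"
        using min[of "T k x"] Suc x by auto
      have "T (Suc k) x = T k x \<inter> cball (d k) (dist (d k) a)"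
      proof (intro equalityI subsetI)
        fix b assume b: "b \<in> T k x \<inter> cball (d k) (dist (d k) a)"
        have "dist (d k) b \<le> dist (d k) c" if "c \<in> T k x" for c
          using b a(2)[rule_format, OF that] by simp
        with b show "b \<in> T (Suc k) x" by (simp add: TS)
      qed (use a in \<open>simp add: TS\<close>)
      moreover have "a \<in> T k x \<inter> cball (d k) (dist (d k) a)" using a(1) by simp
      moreover have "compact (T k x)" using Suc x by simp
      ultimately show ?thesis by (metis compact_Int_closed closed_cball empty_iff)
    qed
    moreover have "{x \<in> space N. T (Suc k) x \<inter> B \<noteq> {}} \<in> sets N" if B: "closed B" for B
    proof -
      have "{x \<in> space N. T (Suc k) x \<inter> B \<noteq> {}} =
        {x \<in> space N. \<forall>q::rat. T k x \<inter> cball (d k) (of_rat q) \<noteq> {} \<longrightarrow> T k x \<inter> (B \<inter> cball (d k) (of_rat q)) \<noteq> {}}"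
        (is "?L = ?R")
      proof (intro equalityI subsetI)
        fix x assume "x \<in> ?L"
        then obtain a where a: "x \<in> space N" "a \<in> T k x" "a \<in> B" "\<forall>b\<in>T k x. dist (d k) a \<le> dist (d k) b"
          by (auto simp: TS)
        have "a \<in> T k x \<inter> (B \<inter> cball (d k) (of_rat q))" if q: "T k x \<inter> cball (d k) (of_rat q) \<noteq> {}" for q
        proof -
          obtain b where "b \<in> T k x" "dist (d k) b \<le> of_rat q" using q by auto
          with a show ?thesis by (auto intro: order_trans[of _ "dist (d k) b"])
        qed
        with a(1) show "x \<in> ?R" by blast
      next
        fix x assume x: "x \<in> ?R"
        then have xs: "x \<in> space N" by simp
        obtain b where b: "b \<in> T k x" "\<forall>c\<in>T k x. dist (d k) b \<le> dist (d k) c"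
          using min[of "T k x"] Suc xs by auto
        have hits: "T k x \<inter> (B \<inter> cball (d k) (of_rat q)) \<noteq> {}" if "dist (d k) b \<le> of_rat q" for q
        proof -
          have "b \<in> T k x \<inter> cball (d k) (of_rat q)" using b(1) that by simp
          with x show ?thesis by blast
        qed
        have "compact (T k x \<inter> B)" using Suc xs B by (simp add: compact_Int_closed)
        moreover have "T k x \<inter> B \<noteq> {}"
        proof -
          obtain q where "dist (d k) b < of_rat q"
            using of_rat_dense[of "dist (d k) b" "dist (d k) b + 1"] by auto
          then show ?thesis using hits[of q] by auto
        qed
        ultimately obtain a where a: "a \<in> T k x \<inter> B" "\<forall>c\<in>T k x \<inter> B. dist (d k) a \<le> dist (d k) c"
          using min[of "T k x \<inter> B"] by auto
        have "dist (d k) a \<le> dist (d k) b"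
        proof (rule ccontr)
          assume "\<not> ?thesis"
          then obtain q where q: "dist (d k) b < of_rat q" "of_rat q < dist (d k) a"
            using of_rat_dense[of "dist (d k) b" "dist (d k) a"] by auto
          then obtain c where "c \<in> T k x" "c \<in> B" "dist (d k) c \<le> of_rat q"
            using hits[of q] by auto
          with a(2) have "dist (d k) a \<le> dist (d k) c" by simp
          with q \<open>dist (d k) c \<le> of_rat q\<close> show False by simp
        qed
        then have "dist (d k) a \<le> dist (d k) c" if "c \<in> T k x" for c
          using b(2)[rule_format, OF that] by simp
        then have "a \<in> T (Suc k) x" using a(1) by (simp add: TS)
        with a(1) xs show "x \<in> ?L" by auto
      qed
      also have "\<dots> = (\<Inter>q::rat. {x \<in> space N. T k x \<inter> cball (d k) (of_rat q) \<noteq> {} \<longrightarrow>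
          T k x \<inter> (B \<inter> cball (d k) (of_rat q)) \<noteq> {}})" by auto
      also have "\<dots> \<in> sets N"
      proof (rule sets.countable_INT', goal_cases)
        case 3
        have "{x \<in> space N. T k x \<inter> cball (d k) (of_rat q) \<noteq> {} \<longrightarrow>
          T k x \<inter> (B \<inter> cball (d k) (of_rat q)) \<noteq> {}} \<in> sets N" for q :: rat
        proof -
        have "Measurable.pred N (\<lambda>x. T k x \<inter> cball (d k) (of_rat q) \<noteq> {})"
          using Suc by (simp add: pred_def)
        moreover have "Measurable.pred N (\<lambda>x. T k x \<inter> (B \<inter> cball (d k) (of_rat q)) \<noteq> {})"
          using Suc B by (simp add: pred_def closed_Int)
        ultimately show ?thesis
          by (intro predE) (rule pred_intros_logic)
        qed
        then show ?case by blast
      qed simp_all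
      finally show ?thesis .
    qed
    ultimately show ?case by blast
  qed
  have dec: "T (Suc k) x \<subseteq> T k x" for k x by (auto simp: TS)
  have nested: "(\<Inter>k. T k x \<inter> B) \<noteq> {}" if x: "x \<in> space N" and B: "closed B" and h: "\<And>k. T k x \<inter> B \<noteq> {}" for x B
  proof -
    have mono: "T n x \<subseteq> T m x" if "m \<le> n" for m n
      using lift_Suc_antimono_le[of "\<lambda>k. T k x", OF dec that] .
    have comp: "compact (T k x \<inter> B)" for k using T x B by (simp add: compact_Int_closed)
    have "(T 0 x \<inter> B) \<inter> (\<Inter>k\<in>UNIV. T k x \<inter> B) \<noteq> {}"
    proof (rule compact_imp_fip_image)
      fix I :: "nat set" assume I: "finite I"
      have "T (Max (insert 0 I)) x \<subseteq> T k x" if "k \<in> insert 0 I" for k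
        using I that by (intro mono Max_ge) auto
      then have "T (Max (insert 0 I)) x \<inter> B \<subseteq> (T 0 x \<inter> B) \<inter> (\<Inter>k\<in>I. T k x \<inter> B)"
        by blast
      then show "(T 0 x \<inter> B) \<inter> (\<Inter>k\<in>I. T k x \<inter> B) \<noteq> {}"
        using h[of "Max (insert 0 I)"] by blast
    qed (use comp in \<open>auto intro: compact_imp_closed\<close>)
    then show ?thesis by auto
  qed
  define \<phi> where "\<phi> x = (SOME a. \<forall>k. a \<in> T k x)" for x
  have phi: "\<phi> x \<in> T k x" if "x \<in> space N" for x k
  proof -
    have "(\<Inter>k. T k x \<inter> UNIV) \<noteq> {}" using T that by (intro nested) auto
    then have "\<exists>a. \<forall>k. a \<in> T k x" by auto
    then have "\<forall>k. \<phi> x \<in> T k x" unfolding \<phi>_def by (rule someI_ex)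
    then show ?thesis by simp
  qed
  have uniq: "a = \<phi> x" if x: "x \<in> space N" and a: "\<And>k. a \<in> T k x" for x a
  proof (rule ccontr)
    assume "a \<noteq> \<phi> x"
    then obtain k where k: "dist a (d k) < dist a (\<phi> x) / 2" using d[of "dist a (\<phi> x) / 2" a] by auto
    have "dist (d k) (\<phi> x) \<le> dist (d k) a"
      using phi[OF x, of "Suc k"] a[of k] by (simp add: TS)
    with k dist_triangle[of a "\<phi> x" "d k"] show False by (simp add: dist_commute)
  qed
  have "\<phi> -` B \<inter> space N \<in> sets N" if B: "closed B" for B
  proof -
    have "\<phi> -` B \<inter> space N = (\<Inter>k. {x \<in> space N. T k x \<inter> B \<noteq> {}})"
    proof (intro equalityI subsetI)
      fix x assume "x \<in> (\<Inter>k. {x \<in> space N. T k x \<inter> B \<noteq> {}})"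
      then have x: "x \<in> space N" and h: "\<And>k. T k x \<inter> B \<noteq> {}" by auto
      obtain a where a: "\<And>k. a \<in> T k x" "a \<in> B" using nested[OF x B h] by blast
      then show "x \<in> \<phi> -` B \<inter> space N" using uniq[OF x a(1)] x by auto
    qed (auto intro: phi)
    also have "\<dots> \<in> sets N" using T B by (intro sets.countable_INT') auto
    finally show ?thesis .
  qed
  then have "\<phi> \<in> borel_measurable N"
    unfolding borel_eq_closed by (intro measurable_measure_of) auto
  then show ?thesis using phi[of _ 0] that by (simp add: T0)
qed

text \<open>
  The set of minimisers at \<open>x\<close> meets a closed set \<open>B\<close> if and only if the minimum over \<open>A \<inter> B\<close> is not larger than
  the minimum over \<open>A\<close>. Both minima are lower semicontinuous in \<open>x\<close>, hence measurable, so the selection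
  theorem for compact sets applies.
\<close>

lemma lsc_minimiser_selection:
  fixes F :: "'b::metric_space \<times> 'c::polish_space \<Rightarrow> ennreal"
  assumes F: "lsc_on (X \<times> A) F" and comp: "action_compact X A F"
    and fin: "\<And>x. x \<in> X \<Longrightarrow> (INF a\<in>A. F (x, a)) < top"
  obtains \<phi> where "\<phi> \<in> restrict_space borel X \<rightarrow>\<^sub>M restrict_space borel A"
    "\<And>x. x \<in> X \<Longrightarrow> F (x, \<phi> x) = (INF a\<in>A. F (x, a))"
proof -
  let ?N = "restrict_space borel X"
  let ?m = "\<lambda>x. INF a\<in>A. F (x, a)"
  define S where "S x = {a \<in> A. F (x, a) \<le> ?m x}" for x
  have spN: "space ?N = X" by (simp add: space_restrict_space)
  have INF_B: "lsc_on X (\<lambda>x. INF a\<in>A \<inter> B. F (x, a))" if "closed B" for B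
    by (intro lsc_on_partial_INF lsc_on_subset[OF F] action_compact_closed[OF comp that]) auto
  have hit_iff: "S x \<inter> B \<noteq> {} \<longleftrightarrow> (INF a\<in>A \<inter> B. F (x, a)) \<le> ?m x" if x: "x \<in> X" and B: "closed B" for x B
  proof
    assume "S x \<inter> B \<noteq> {}"
    then obtain a where "a \<in> A \<inter> B" "F (x, a) \<le> ?m x" by (auto simp: S_def)
    then show "(INF a\<in>A \<inter> B. F (x, a)) \<le> ?m x" by (rule INF_lower2)
  next
    assume le: "(INF a\<in>A \<inter> B. F (x, a)) \<le> ?m x"
    obtain a where "a \<in> A \<inter> B" "F (x, a) = (INF a\<in>A \<inter> B. F (x, a))"
    proof (rule lsc_minimum_attained[of X "A \<inter> B" F x])
      show "lsc_on (X \<times> (A \<inter> B)) F" by (rule lsc_on_subset[OF F]) auto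
      show "(INF a\<in>A \<inter> B. F (x, a)) < top" using le fin[OF x] by simp
    qed (use x action_compact_closed[OF comp B] in auto)
    with le show "S x \<inter> B \<noteq> {}" by (auto simp: S_def)
  qed
  have compS: "compact (S x)" if x: "x \<in> X" for x
    unfolding compact_def
  proof (intro allI impI)
    fix a :: "nat \<Rightarrow> 'c" assume a: "\<forall>n. a n \<in> S x"
    then obtain r b where r: "strict_mono r" "b \<in> A" "(a \<circ> r) \<longlonglongrightarrow> b"
      using action_compactD[OF comp x, of "\<lambda>_. x" a "?m x"] fin[OF x] x by (auto simp: S_def)
    have "(\<lambda>n. (x, a (r n))) \<longlonglongrightarrow> (x, b)"
      using r(3) by (intro tendsto_Pair) (simp_all add: comp_def)
    then have "F (x, b) \<le> liminf (\<lambda>n. F (x, a (r n)))"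
      using x a r by (intro lsc_onD[OF F]) (auto simp: S_def)
    also have "\<dots> \<le> ?m x"
      using a by (intro Liminf_le always_eventually allI) (simp_all add: S_def)
    finally show "\<exists>l\<in>S x. \<exists>r. strict_mono r \<and> (a \<circ> r) \<longlonglongrightarrow> l"
      using r by (auto simp: S_def)
  qed
  have neS: "S x \<noteq> {}" if x: "x \<in> X" for x
    using hit_iff[OF x, of UNIV] by simp
  have hitS: "{x \<in> space ?N. S x \<inter> B \<noteq> {}} \<in> sets ?N" if B: "closed B" for B
  proof -
    have [measurable]: "?m \<in> borel_measurable ?N" "(\<lambda>x. INF a\<in>A \<inter> B. F (x, a)) \<in> borel_measurable ?N"
      using INF_B[of UNIV] INF_B[OF B] by (simp_all add: borel_measurable_lsc_on)
    have "{x \<in> space ?N. S x \<inter> B \<noteq> {}} = {x \<in> space ?N. (INF a\<in>A \<inter> B. F (x, a)) \<le> ?m x}"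
      using hit_iff[OF _ B] by (auto simp: spN)
    also have "\<dots> \<in> sets ?N" by measurable
    finally show ?thesis .
  qed
  obtain \<phi> where phi: "\<phi> \<in> borel_measurable ?N" "\<And>x. x \<in> space ?N \<Longrightarrow> \<phi> x \<in> S x"
    by (rule compact_valued_measurable_selection[of ?N S]) (use compS neS hitS in \<open>auto simp: spN\<close>)
  show ?thesis
  proof (rule that)
    show "\<phi> \<in> ?N \<rightarrow>\<^sub>M restrict_space borel A"
      using phi by (intro measurable_restrict_space2) (auto simp: spN S_def)
    show "F (x, \<phi> x) = ?m x" if "x \<in> X" for x
      using phi(2)[of x] that by (intro antisym) (auto simp: spN S_def intro: INF_lower)
  qed
qed

section \<open>Equicontinuous sequences\<close>

lemma countable_dense_subset:
  fixes X :: "'b::second_countable_topology set"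
  obtains D where "countable D" "D \<subseteq> X"
    "\<And>G. openin (top_of_set X) G \<Longrightarrow> G \<noteq> {} \<Longrightarrow> \<exists>d\<in>D. d \<in> G"
proof -
  obtain \<B> :: "'b set set" where B: "countable \<B>" "topological_basis \<B>"
    using ex_countable_basis by blast
  have "\<forall>b. \<exists>x. b \<inter> X \<noteq> {} \<longrightarrow> x \<in> b \<inter> X" by blast
  then obtain p where p: "\<And>b. b \<inter> X \<noteq> {} \<Longrightarrow> p b \<in> b \<inter> X" by metis
  define D where "D = p ` {b \<in> \<B>. b \<inter> X \<noteq> {}}"
  show thesis
  proof
    show "countable D" unfolding D_def
      by (intro countable_image countable_subset[OF _ B(1)]) simp
    show "D \<subseteq> X" unfolding D_def using p by blast
    fix G assume G: "openin (top_of_set X) G" "G \<noteq> {}"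
    obtain U where U: "open U" "G = X \<inter> U" using G(1) by (auto simp: openin_open)
    obtain x where x: "x \<in> X" "x \<in> U" using G(2) U(2) by blast
    obtain b where b: "b \<in> \<B>" "x \<in> b" "b \<subseteq> U"
      by (rule topological_basisE[OF B(2) U(1) x(2)]) (rule that)
    have "b \<inter> X \<noteq> {}" using b(2) x(1) by blast
    then have "p b \<in> D" "p b \<in> G"
      using b(1,3) p[of b] unfolding U(2) D_def by blast+
    then show "\<exists>d\<in>D. d \<in> G" by blast
  qed
qed

text \<open>
  The pointwise part of the Arzela-Ascoli theorem: a diagonal subsequence converges on a countable dense
  subset, and by equicontinuity it is a Cauchy sequence at every other point too.
\<close>

lemma equicontinuous_subsequence:
  fixes f :: "nat \<Rightarrow> 'b::{metric_space, second_countable_topology} \<Rightarrow> real"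
  assumes equi: "\<And>x e. x \<in> X \<Longrightarrow> 0 < e \<Longrightarrow>
      \<exists>G. openin (top_of_set X) G \<and> x \<in> G \<and> (\<forall>y\<in>G. \<forall>n. \<bar>f n y - f n x\<bar> < e)"
    and bound: "\<And>x n. x \<in> X \<Longrightarrow> \<bar>f n x\<bar> \<le> B x"
  obtains r l where "strict_mono r" "\<And>x. x \<in> X \<Longrightarrow> (\<lambda>k. f (r k) x) \<longlonglongrightarrow> l x"
proof -
  obtain D where D: "countable D" "D \<subseteq> X"
    "\<And>G. openin (top_of_set X) G \<Longrightarrow> G \<noteq> {} \<Longrightarrow> \<exists>d\<in>D. d \<in> G"
    by (rule countable_dense_subset[of X]) (rule that)
  obtain r where r: "strict_mono r" "\<And>d. d \<in> D \<Longrightarrow> convergent (\<lambda>k. f (r k) d)"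
  proof (cases "D = {}")
    case True
    then show thesis using that[of id] by (auto simp: strict_mono_def)
  next
    case False
    define d where "d = from_nat_into D"
    have dD: "d n \<in> D" for n unfolding d_def by (rule from_nat_into[OF False])
    interpret subseqs "\<lambda>n s. convergent (\<lambda>k. f (s k) (d n))"
    proof
      fix n and s :: "nat \<Rightarrow> nat"
      have "bounded (range (\<lambda>k. f (s k) (d n)))"
        using bound dD D(2) by (intro boundedI[where B="B (d n)"]) auto
      from bounded_imp_convergent_subsequence[OF this]
      obtain l r' where "strict_mono r'" "((\<lambda>k. f (s k) (d n)) \<circ> r') \<longlonglongrightarrow> l" by blast
      then show "\<exists>r'. strict_mono r' \<and> convergent (\<lambda>k. f ((s \<circ> r') k) (d n))"
        by (auto simp: convergent_def comp_def)
    qed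
    have "convergent (\<lambda>k. f (diagseq k) (d n))" for n
    proof -
      have "convergent (\<lambda>k. f ((diagseq \<circ> (+) (Suc n)) k) (d n))"
      proof (rule diagseq_holds)
        fix r s :: "nat \<Rightarrow> nat" and n
        assume "strict_mono r" "convergent (\<lambda>k. f (s k) (d n))"
        then show "convergent (\<lambda>k. f ((s \<circ> r) k) (d n))"
          using LIMSEQ_subseq_LIMSEQ[of "\<lambda>k. f (s k) (d n)" _ r] by (auto simp: convergent_def comp_def)
      qed
      then obtain l where "(\<lambda>k. f (diagseq (k + Suc n)) (d n)) \<longlonglongrightarrow> l"
        by (auto simp: convergent_def add.commute)
      then have "(\<lambda>k. f (diagseq k) (d n)) \<longlonglongrightarrow> l" by (rule LIMSEQ_offset)
      then show ?thesis by (auto simp: convergent_def)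
    qed
    moreover have "\<exists>n. d n = x" if "x \<in> D" for x
      unfolding d_def using from_nat_into_surj[OF D(1) that] .
    ultimately have "convergent (\<lambda>k. f (diagseq k) x)" if "x \<in> D" for x using that by metis
    with subseq_diagseq show thesis by (rule that)
  qed
  have "convergent (\<lambda>k. f (r k) x)" if x: "x \<in> X" for x
  proof (rule Cauchy_convergent, rule metric_CauchyI)
    fix e :: real assume e: "0 < e"
    obtain G where G: "openin (top_of_set X) G" "x \<in> G" "\<And>y n. y \<in> G \<Longrightarrow> \<bar>f n y - f n x\<bar> < e / 3"
      using equi[OF x, of "e / 3"] e by auto
    then obtain y where y: "y \<in> D" "y \<in> G" using D(3)[of G] by auto
    have "Cauchy (\<lambda>k. f (r k) y)" using r(2)[OF y(1)] by (rule convergent_Cauchy)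
    then obtain N where N: "\<And>m n. N \<le> m \<Longrightarrow> N \<le> n \<Longrightarrow> \<bar>f (r m) y - f (r n) y\<bar> < e / 3"
      using metric_CauchyD[of "\<lambda>k. f (r k) y" "e / 3"] e by (auto simp: dist_real_def)
    have "dist (f (r m) x) (f (r n) x) < e" if "N \<le> m" "N \<le> n" for m n
      using N[OF that] G(3)[OF y(2), of "r m"] G(3)[OF y(2), of "r n"]
      unfolding dist_real_def by linarith
    then show "\<exists>N. \<forall>m\<ge>N. \<forall>n\<ge>N. dist (f (r m) x) (f (r n) x) < e" by blast
  qed
  then have "(\<lambda>k. f (r k) x) \<longlonglongrightarrow> lim (\<lambda>k. f (r k) x)" if "x \<in> X" for x
    using that by (simp add: convergent_LIMSEQ_iff)
  with r(1) show thesis by (rule that)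
qed

text \<open>
  For an equicontinuous sequence the limit at \<open>x\<close> does not change if the argument also moves to \<open>x\<close>. This
  identifies the joint lower limit in \<open>avg_relative_value\<close> with the pointwise limit.
\<close>

lemma equicontinuous_joint_limit:
  fixes f :: "nat \<Rightarrow> 'b::metric_space \<Rightarrow> real"
  assumes equi: "\<And>e. 0 < e \<Longrightarrow>
      \<exists>G. openin (top_of_set X) G \<and> x \<in> G \<and> (\<forall>y\<in>G. \<forall>n. \<bar>f n y - f n x\<bar> < e)"
    and lim: "(\<lambda>n. f n x) \<longlonglongrightarrow> l"
  shows "((\<lambda>(n, y). f n y) \<longlongrightarrow> l) (sequentially \<times>\<^sub>F inf (nhds x) (principal X))"
proof (rule tendstoI)
  fix e :: real assume e: "0 < e"
  obtain G where G: "openin (top_of_set X) G" "x \<in> G" "\<And>y n. y \<in> G \<Longrightarrow> \<bar>f n y - f n x\<bar> < e / 2"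
    using equi[of "e / 2"] e by auto
  obtain U where U: "open U" "G = X \<inter> U" using G(1) by (auto simp: openin_open)
  have "\<forall>\<^sub>F y in nhds x. y \<in> U" using U G(2) by (auto simp: eventually_nhds)
  then have "\<forall>\<^sub>F y in inf (nhds x) (principal X). y \<in> G"
    unfolding eventually_inf_principal by eventually_elim (use U in auto)
  moreover have "\<forall>\<^sub>F n in sequentially. dist (f n x) l < e / 2"
    using tendstoD[OF lim, of "e / 2"] e by simp
  ultimately have "\<forall>\<^sub>F p in sequentially \<times>\<^sub>F inf (nhds x) (principal X).
      dist (f (fst p) x) l < e / 2 \<and> snd p \<in> G"
    by (intro eventually_prodI)
  then show "\<forall>\<^sub>F p in sequentially \<times>\<^sub>F inf (nhds x) (principal X). dist (case p of (n, y) \<Rightarrow> f n y) l < e"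
  proof eventually_elim
    case (elim p)
    then have "\<bar>f (fst p) x - l\<bar> < e / 2" "\<bar>f (fst p) (snd p) - f (fst p) x\<bar> < e / 2"
      using G(3)[of "snd p" "fst p"] by (simp_all add: dist_real_def)
    then have "\<bar>f (fst p) (snd p) - l\<bar> < e" by linarith
    then show ?case by (simp add: dist_real_def case_prod_unfold)
  qed
qed

lemma equicontinuous_limit_continuous:
  fixes f :: "nat \<Rightarrow> 'b::metric_space \<Rightarrow> real"
  assumes equi: "\<And>x e. x \<in> X \<Longrightarrow> 0 < e \<Longrightarrow>
      \<exists>G. openin (top_of_set X) G \<and> x \<in> G \<and> (\<forall>y\<in>G. \<forall>n. \<bar>f n y - f n x\<bar> < e)"
    and lim: "\<And>x. x \<in> X \<Longrightarrow> (\<lambda>n. f n x) \<longlonglongrightarrow> l x"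
  shows "continuous_on X l"
  unfolding continuous_on_iff
proof (intro ballI allI impI)
  fix x and e :: real assume x: "x \<in> X" and e: "0 < e"
  obtain G where G: "openin (top_of_set X) G" "x \<in> G" "\<And>y n. y \<in> G \<Longrightarrow> \<bar>f n y - f n x\<bar> < e / 2"
    using equi[OF x, of "e / 2"] e by auto
  obtain d where d: "0 < d" "ball x d \<inter> X \<subseteq> G"
    using G(1,2) unfolding openin_contains_ball by blast
  have "dist (l y) (l x) < e" if "y \<in> X" "dist y x < d" for y
  proof -
    have "y \<in> G" using that d by (auto simp: dist_commute)
    have "(\<lambda>n. \<bar>f n y - f n x\<bar>) \<longlonglongrightarrow> \<bar>l y - l x\<bar>"
      by (intro tendsto_intros lim that x)
    moreover have "\<exists>N. \<forall>n\<ge>N. \<bar>f n y - f n x\<bar> \<le> e / 2"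
      using G(3)[OF \<open>y \<in> G\<close>] by (auto intro: less_imp_le)
    ultimately have "\<bar>l y - l x\<bar> \<le> e / 2" by (rule LIMSEQ_le_const2)
    then show ?thesis using e by (simp add: dist_real_def)
  qed
  with d(1) show "\<exists>d>0. \<forall>y\<in>X. dist y x < d \<longrightarrow> dist (l y) (l x) < e" by blast
qed

text \<open>
  Near \<open>x\<close> all the functions, hence also the infimum of any tail, drop by at most \<open>e\<close>. The tail infima
  increase to the pointwise limit, so they are a lower semicontinuous minorant that can be followed along moving
  actions.
\<close>

lemma equicontinuous_lsc_tail_INF:
  fixes f :: "nat \<Rightarrow> 'b::metric_space \<Rightarrow> real"
  assumes equi: "\<And>x e. x \<in> X \<Longrightarrow> 0 < e \<Longrightarrow>
      \<exists>G. openin (top_of_set X) G \<and> x \<in> G \<and> (\<forall>y\<in>G. \<forall>n. \<bar>f n y - f n x\<bar> < e)"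
    and nonneg: "\<And>n x. 0 \<le> f n x"
  shows "lsc_on X (\<lambda>x. INF n\<in>{N..}. ennreal (f n x))"
  unfolding lsc_on_def
proof (intro ballI allI impI)
  fix x s assume x: "x \<in> X" and s: "\<forall>n. s n \<in> X" "s \<longlonglongrightarrow> x"
  let ?h = "\<lambda>x. INF n\<in>{N..}. ennreal (f n x)"
  show "?h x \<le> liminf (\<lambda>k. ?h (s k))"
  proof (rule ennreal_le_epsilon)
    fix e :: real assume e: "0 < e"
    obtain G where G: "openin (top_of_set X) G" "x \<in> G" "\<And>y n. y \<in> G \<Longrightarrow> \<bar>f n y - f n x\<bar> < e"
      using equi[OF x e] by auto
    obtain U where U: "open U" "G = X \<inter> U" using G(1) by (auto simp: openin_open)
    have "\<forall>\<^sub>F k in sequentially. s k \<in> U"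
      using s(2) U G(2) by (auto simp: tendsto_def)
    then have "\<forall>\<^sub>F k in sequentially. ?h x - ennreal e \<le> ?h (s k)"
    proof eventually_elim
      case (elim k)
      then have "s k \<in> G" using U s by auto
      show ?case
      proof (rule INF_greatest)
        fix n assume n: "n \<in> {N..}"
        have "?h x \<le> ennreal (f n x)" using n by (rule INF_lower)
        also have "\<dots> \<le> ennreal (f n (s k) + e)"
          using G(3)[OF \<open>s k \<in> G\<close>, of n] by (intro ennreal_leI) (simp add: abs_less_iff)
        also have "\<dots> = ennreal (f n (s k)) + ennreal e"
          using e by (intro ennreal_plus nonneg) simp
        finally show "?h x - ennreal e \<le> ennreal (f n (s k))"
          by (simp add: ennreal_minus_le_iff add.commute)
      qed
    qed
    then have "?h x - ennreal e \<le> liminf (\<lambda>k. ?h (s k))" by (rule Liminf_bounded)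
    then show "?h x \<le> liminf (\<lambda>k. ?h (s k)) + ennreal e"
      by (simp add: ennreal_minus_le_iff add.commute)
  qed
qed

section \<open>Discounted sums\<close>

lemma discounted_sum_mono:
  fixes e :: "nat \<Rightarrow> ennreal"
  assumes "0 \<le> \<beta>" "\<beta> \<le> \<alpha>"
  shows "(\<Sum>k. ennreal (\<beta> ^ k) * e k) \<le> (\<Sum>k. ennreal (\<alpha> ^ k) * e k)"
  using assms by (intro suminf_le mult_right_mono ennreal_leI power_mono) auto

lemma discounted_sum_Suc:
  fixes e :: "nat \<Rightarrow> ennreal"
  assumes "0 \<le> \<alpha>"
  shows "(\<Sum>k. ennreal (\<alpha> ^ k) * e (s + k)) = e s + ennreal \<alpha> * (\<Sum>k. ennreal (\<alpha> ^ k) * e (Suc s + k))"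
proof -
  have "(\<Sum>k. ennreal (\<alpha> ^ k) * e (s + k)) =
      e s + (\<Sum>k. ennreal (\<alpha> ^ Suc k) * e (s + Suc k))"
    by (subst suminf_offset[where i=1]) (simp_all add: add.commute)
  also have "(\<Sum>k. ennreal (\<alpha> ^ Suc k) * e (s + Suc k)) = (\<Sum>k. ennreal \<alpha> * (ennreal (\<alpha> ^ k) * e (Suc s + k)))"
    using assms by (simp add: ennreal_mult mult.assoc)
  finally show ?thesis by simp
qed

lemma suminf_ennreal_power:
  assumes "0 \<le> \<alpha>" "\<alpha> < 1"
  shows "(\<Sum>k. ennreal (\<alpha> ^ k)) = ennreal (1 / (1 - \<alpha>))"
  using assms by (subst suminf_ennreal2) (auto simp: suminf_geometric)

text \<open>
  This is the reason why normalised minimal discounted values increase with the discount factor. Let \<open>a s\<close> and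
  \<open>b s\<close> be the \<open>\<alpha>\<close>- and \<open>\<beta>\<close>-discounted values of the tail that starts at \<open>s\<close>. From \<open>a s = e s + \<alpha> * a (s + 1)\<close> and
  \<open>b s = e s + \<beta> * b (s + 1)\<close> one gets \<open>a s - b s = \<alpha> (a (s + 1) - b (s + 1)) + (\<alpha> - \<beta>) b (s + 1)\<close>, where the last term is
  at least \<open>(\<alpha> - \<beta>) m\<close>; iterating yields \<open>a 0 \<ge> m + (\<alpha> - \<beta>) m / (1 - \<alpha>)\<close>. The induction is phrased without
  subtraction because the values may be infinite.
\<close>

lemma discounted_sum_lower_bound:
  fixes e :: "nat \<Rightarrow> ennreal"
  assumes \<beta>: "0 \<le> \<beta>" "\<beta> \<le> \<alpha>" "\<alpha> < 1"
    and m: "\<And>s. m \<le> (\<Sum>k. ennreal (\<beta> ^ k) * e (s + k))"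
  shows "ennreal (1 - \<beta>) * m \<le> ennreal (1 - \<alpha>) * (\<Sum>k. ennreal (\<alpha> ^ k) * e k)"
proof -
  let ?a = "\<lambda>s. \<Sum>k. ennreal (\<alpha> ^ k) * e (s + k)" and ?b = "\<lambda>s. \<Sum>k. ennreal (\<beta> ^ k) * e (s + k)"
  have \<alpha>: "0 \<le> \<alpha>" using \<beta> by simp
  have \<alpha>\<beta>: "ennreal \<alpha> = ennreal \<beta> + ennreal (\<alpha> - \<beta>)"
    using \<beta> by (subst ennreal_plus[symmetric]) auto
  have step: "?b s + ennreal (\<alpha> - \<beta>) * m * (\<Sum>k<n. ennreal (\<alpha> ^ k)) \<le> ?a s" for n s
  proof (induction n arbitrary: s)
    case 0 show ?case using discounted_sum_mono[of \<beta> \<alpha> "\<lambda>k. e (s + k)"] \<beta> by simp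
  next
    case (Suc n)
    let ?G = "ennreal (\<alpha> - \<beta>) * m * (\<Sum>k<n. ennreal (\<alpha> ^ k))"
    have geo: "(\<Sum>k<Suc n. ennreal (\<alpha> ^ k)) = 1 + ennreal \<alpha> * (\<Sum>k<n. ennreal (\<alpha> ^ k))"
      using \<alpha> by (subst sum.lessThan_Suc_shift) (simp add: sum_distrib_left ennreal_mult del: sum_ennreal)
    have "?b s + ennreal (\<alpha> - \<beta>) * m * (\<Sum>k<Suc n. ennreal (\<alpha> ^ k)) =
        e s + ennreal \<beta> * ?b (Suc s) + (ennreal (\<alpha> - \<beta>) * m + ennreal \<alpha> * ?G)"
      unfolding geo using \<beta> by (subst discounted_sum_Suc) (simp_all add: algebra_simps)
    also have "\<dots> \<le> e s + ennreal \<beta> * ?b (Suc s) + (ennreal (\<alpha> - \<beta>) * ?b (Suc s) + ennreal \<alpha> * ?G)"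
      using m[of "Suc s"] by (intro add_mono mult_left_mono order_refl) auto
    also have "\<dots> = e s + ennreal \<alpha> * (?b (Suc s) + ?G)"
      unfolding \<alpha>\<beta> by (simp add: algebra_simps)
    also have "\<dots> \<le> e s + ennreal \<alpha> * ?a (Suc s)"
      by (intro add_mono mult_left_mono order_refl Suc) auto
    also have "\<dots> = ?a s" using discounted_sum_Suc[OF \<alpha>, of e s] by simp
    finally show ?case .
  qed
  have "m + ennreal (\<alpha> - \<beta>) * m * (\<Sum>k<n. ennreal (\<alpha> ^ k)) \<le> ?a 0" for n
    using step[of 0 n] m[of 0] by (auto intro: order_trans[rotated])
  then have "(SUP n. m + ennreal (\<alpha> - \<beta>) * m * (\<Sum>k<n. ennreal (\<alpha> ^ k))) \<le> ?a 0"
    by (intro SUP_least)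
  then have "m + ennreal (\<alpha> - \<beta>) * m * (\<Sum>k. ennreal (\<alpha> ^ k)) \<le> ?a 0"
    by (simp add: suminf_eq_SUP SUP_mult_left_ennreal ennreal_SUP_add_right)
  then have "ennreal (1 - \<alpha>) * (m + ennreal (\<alpha> - \<beta>) * m * ennreal (1 / (1 - \<alpha>))) \<le> ennreal (1 - \<alpha>) * ?a 0"
    unfolding suminf_ennreal_power[OF \<alpha> \<beta>(3)] by (intro mult_left_mono) simp_all
  moreover have "ennreal (1 - \<alpha>) * (m + ennreal (\<alpha> - \<beta>) * m * ennreal (1 / (1 - \<alpha>))) = ennreal (1 - \<beta>) * m"
  proof -
    have "ennreal (1 - \<alpha>) * ennreal (1 / (1 - \<alpha>)) = 1"
      using \<beta> by (simp flip: ennreal_mult)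
    moreover have "ennreal (1 - \<alpha>) * (m + ennreal (\<alpha> - \<beta>) * m * ennreal (1 / (1 - \<alpha>))) =
        ennreal (1 - \<alpha>) * m + (ennreal (1 - \<alpha>) * ennreal (1 / (1 - \<alpha>))) * (ennreal (\<alpha> - \<beta>) * m)"
      by (simp only: distrib_left mult_ac)
    ultimately have "ennreal (1 - \<alpha>) * (m + ennreal (\<alpha> - \<beta>) * m * ennreal (1 / (1 - \<alpha>))) =
        ennreal (1 - \<alpha>) * m + ennreal (\<alpha> - \<beta>) * m"
      by simp
    also have "\<dots> = ennreal (1 - \<beta>) * m"
      using \<beta> by (simp add: distrib_right[symmetric] ennreal_plus[symmetric] del: ennreal_plus)
    finally show ?thesis .
  qed
  ultimately show ?thesis by simp
qed

text \<open>
  The Abelian half of the comparison between averages and discounted sums. The weights \<open>\<alpha> ^ t\<close> decrease, so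
  among all streams with partial sums bounded by \<open>C + L n\<close> the discounted sum is largest if \<open>C\<close> is
  paid at once and \<open>L\<close> in every period.
\<close>

lemma abel_sum_upper_bound:
  fixes e :: "nat \<Rightarrow> real"
  assumes e: "\<And>t. 0 \<le> e t" and C: "\<And>n. (\<Sum>t<n. e t) \<le> C + L * real n"
    and \<alpha>: "0 \<le> \<alpha>" "\<alpha> < 1" and L: "0 \<le> L"
  shows "(\<Sum>t<n. \<alpha> ^ t * e t) \<le> C + L / (1 - \<alpha>)"
proof -
  have ind: "\<alpha> ^ n * (C + L * real n - (\<Sum>t<n. e t)) + (\<Sum>t<n. \<alpha> ^ t * e t) \<le> C + L * (\<Sum>t<n. \<alpha> ^ t)" for n
  proof (induction n)
    case (Suc n)
    have "\<alpha> ^ Suc n * (C + L * real (Suc n) - (\<Sum>t<Suc n. e t)) \<le>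
        \<alpha> ^ n * (C + L * real (Suc n) - (\<Sum>t<Suc n. e t))"
      using \<alpha> C[of "Suc n"] by (intro mult_right_mono power_decreasing) auto
    with Suc show ?case by (simp add: algebra_simps)
  qed simp
  have "0 \<le> \<alpha> ^ n * (C + L * real n - (\<Sum>t<n. e t))" using C[of n] \<alpha> by simp
  with ind[of n] have "(\<Sum>t<n. \<alpha> ^ t * e t) \<le> C + L * (\<Sum>t<n. \<alpha> ^ t)" by simp
  also have "(\<Sum>t<n. \<alpha> ^ t) \<le> 1 / (1 - \<alpha>)"
    using \<alpha> sum_le_suminf[of "\<lambda>t. \<alpha> ^ t" "{..<n}"] by (simp add: suminf_geometric)
  then have "C + L * (\<Sum>t<n. \<alpha> ^ t) \<le> C + L * (1 / (1 - \<alpha>))"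
    using L by (intro add_left_mono mult_left_mono)
  finally show ?thesis by simp
qed

section \<open>Expectations of extended real functions\<close>

lemma eintegral_cong: "(\<And>z. z \<in> space N \<Longrightarrow> f z = g z) \<Longrightarrow> eintegral N f = eintegral N g"
  unfolding eintegral_def by (simp cong: nn_integral_cong)

text \<open>
  Subtracting a constant is compatible with the extended integral because on a probability space the negative
  part of \<open>g - r\<close> has an integral of at most \<open>r\<close>.
\<close>

lemma eintegral_minus_const:
  assumes N: "prob_space N" and g [measurable]: "g \<in> borel_measurable N" and r: "0 \<le> r"
  shows "eintegral N (\<lambda>z. enn2ereal (g z) - ereal r) = enn2ereal (\<integral>\<^sup>+ z. g z \<partial>N) - ereal r"
proof -
  interpret prob_space N by (rule N)
  have pos: "e2ennreal (enn2ereal (g z) - ereal r) = g z - ennreal r" for z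
    using r by (simp add: e2eenreal_enn2ereal_diff flip: enn2ereal_ennreal)
  have neg: "e2ennreal (- (enn2ereal (g z) - ereal r)) = ennreal r - g z" for z
  proof -
    have "- (enn2ereal (g z) - ereal r) = ereal r - enn2ereal (g z)"
      by (cases "enn2ereal (g z)") auto
    then show ?thesis using r by (simp add: e2eenreal_enn2ereal_diff flip: enn2ereal_ennreal)
  qed
  have pw: "(g z - ennreal r) + ennreal r = g z + (ennreal r - g z)" for z
  proof (cases "g z")
    case (real s)
    with r show ?thesis
      by (cases "s \<le> r") (auto simp: ennreal_minus ennreal_neg ennreal_plus[symmetric] simp del: ennreal_plus)
  qed simp
  let ?p = "\<integral>\<^sup>+ z. g z - ennreal r \<partial>N" and ?n = "\<integral>\<^sup>+ z. ennreal r - g z \<partial>N" and ?g = "\<integral>\<^sup>+ z. g z \<partial>N"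
  have "?p + ennreal r = (\<integral>\<^sup>+ z. (g z - ennreal r) + ennreal r \<partial>N)"
    by (subst nn_integral_add) (simp_all add: emeasure_space_1)
  also have "\<dots> = ?g + ?n" unfolding pw by (rule nn_integral_add) auto
  finally have eq: "?p + ennreal r = ?g + ?n" .
  have "?n \<le> (\<integral>\<^sup>+ z. ennreal r \<partial>N)" by (intro nn_integral_mono) simp
  also have "\<dots> = ennreal r" by (simp add: emeasure_space_1)
  finally have "?n \<noteq> top" by (auto simp: top_unique)
  with eq r have "enn2ereal ?p - enn2ereal ?n = enn2ereal ?g - ereal r"
    by (cases ?p; cases ?n; cases ?g)
       (auto simp: ennreal_plus[symmetric] simp del: ennreal_plus)
  then show ?thesis
    by (simp add: eintegral_def pos neg)
qed

lemma eintegral_enn2ereal: "eintegral N (\<lambda>z. enn2ereal (g z)) = enn2ereal (\<integral>\<^sup>+ z. g z \<partial>N)"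
proof -
  have "e2ennreal (- enn2ereal (g z)) = 0" for z by (rule e2ennreal_neg) simp
  then show ?thesis by (simp add: eintegral_def zero_ennreal.rep_eq)
qed

section \<open>The trajectory measure\<close>

lemma space_state_space [simp]: "space (state_space M) = states M"
  by (simp add: state_space_def space_restrict_space)

lemma space_action_space [simp]: "space (action_space M) = actions M"
  by (simp add: action_space_def space_restrict_space)

lemma space_sa_space: "space (sa_space M) = states M \<times> actions M"
  by (simp add: sa_space_def space_pair_measure)

lemma prob_algebra_space: "N \<in> space (prob_algebra K) \<Longrightarrow> space N = space K"
  by (auto simp: space_prob_algebra dest: sets_eq_imp_space_eq)

text \<open>
  The process controlled by one policy from one initial state. The kernels that define its law satisfy the
  conditions of the Ionescu Tulcea construction. Of the law only the distribution of each pair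
  \<open>(x\<^sub>t, a\<^sub>t)\<close> given the previous history enters the proof.
\<close>

locale controlled_process =
  fixes M :: "('x::polish_space, 'a::polish_space) mdp"
    and \<pi> :: "('x, 'a) policy" and x :: 'x
  assumes mdp: "is_mdp M" and policy: "\<pi> \<in> policies M" and start: "x \<in> states M"
begin

lemma trans_prob_measurable [measurable]:
  "trans_prob M \<in> sa_space M \<rightarrow>\<^sub>M prob_algebra (state_space M)"
  using mdp by (simp add: is_mdp_def)

lemma policy_measurable [measurable]:
  "\<pi> t \<in> (PiM {0..<t} (\<lambda>_. sa_space M) \<Otimes>\<^sub>M state_space M) \<rightarrow>\<^sub>M prob_algebra (action_space M)"
  using policy by (simp add: policies_def history_space_def)

lemma next_state_measurable [measurable]:
  "next_state M x t \<in> PiM {0..<t} (\<lambda>_. sa_space M) \<rightarrow>\<^sub>M prob_algebra (state_space M)"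
proof (cases t)
  case 0
  have "return (state_space M) x \<in> space (prob_algebra (state_space M))"
    using start by (auto simp: space_prob_algebra intro: prob_space_return)
  then show ?thesis by (simp add: next_state_def[abs_def] 0)
next
  case (Suc s)
  have "(\<lambda>h. trans_prob M (h s)) \<in> PiM {0..<Suc s} (\<lambda>_. sa_space M) \<rightarrow>\<^sub>M prob_algebra (state_space M)"
    by measurable
  then show ?thesis by (simp add: next_state_def[abs_def] Suc)
qed

lemma action_step_measurable [measurable]:
  "(\<lambda>(h, y). \<pi> t (h, y) \<bind> (\<lambda>a. return (sa_space M) (y, a)))
     \<in> (PiM {0..<t} (\<lambda>_. sa_space M) \<Otimes>\<^sub>M state_space M) \<rightarrow>\<^sub>M prob_algebra (sa_space M)"
proof -
  have p: "(\<lambda>(q, a). (snd q, a))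
      \<in> ((PiM {0..<t} (\<lambda>_. sa_space M) \<Otimes>\<^sub>M state_space M) \<Otimes>\<^sub>M action_space M) \<rightarrow>\<^sub>M sa_space M"
    unfolding sa_space_def by measurable
  have "(\<lambda>q. \<pi> t q \<bind> (\<lambda>a. return (sa_space M) (snd q, a)))
     \<in> (PiM {0..<t} (\<lambda>_. sa_space M) \<Otimes>\<^sub>M state_space M) \<rightarrow>\<^sub>M prob_algebra (sa_space M)"
    using measurable_compose[OF p measurable_return_prob_space]
    by (intro measurable_bind_prob_space2[where N="action_space M"] policy_measurable)
       (simp add: case_prod_unfold)
  then show ?thesis by (simp add: case_prod_unfold)
qed

lemma step_kernel_measurable:
  "step_kernel M \<pi> x t \<in> PiM {0..<t} (\<lambda>_. sa_space M) \<rightarrow>\<^sub>M prob_algebra (sa_space M)"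
  using measurable_bind_prob_space2[OF next_state_measurable action_step_measurable]
  by (simp add: step_kernel_def[abs_def])

sublocale IT: Ionescu_Tulcea "step_kernel M \<pi> x" "\<lambda>_. sa_space M"
proof (rule Ionescu_Tulcea.intro)
  show "step_kernel M \<pi> x i \<in> PiM {0..<i} (\<lambda>_. sa_space M) \<rightarrow>\<^sub>M subprob_algebra (sa_space M)" for i
    by (rule measurable_prob_algebraD[OF step_kernel_measurable])
  show "prob_space (step_kernel M \<pi> x i h)" if "h \<in> space (PiM {0..<i} (\<lambda>_. sa_space M))" for i h
    using measurable_space[OF step_kernel_measurable that] by (simp add: space_prob_algebra)
qed

abbreviation "P \<equiv> trajectory_measure M \<pi> x"
abbreviation "P_upto n \<equiv> IT.C 0 n (\<lambda>_. undefined)"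

lemma nn_integral_step_kernel:
  assumes h: "h \<in> space (PiM {0..<t} (\<lambda>_. sa_space M))"
    and [measurable]: "G \<in> borel_measurable (sa_space M)"
  shows "(\<integral>\<^sup>+ z. G z \<partial>step_kernel M \<pi> x t h) =
         (\<integral>\<^sup>+ y. \<integral>\<^sup>+ a. G (y, a) \<partial>\<pi> t (h, y) \<partial>next_state M x t h)"
proof -
  note [measurable] = h
  have N: "next_state M x t h \<in> space (prob_algebra (state_space M))"
    by (rule measurable_space[OF next_state_measurable h])
  then have sN: "sets (next_state M x t h) = sets (state_space M)"
    by (simp add: space_prob_algebra)
  have m: "(\<lambda>y. \<pi> t (h, y) \<bind> (\<lambda>a. return (sa_space M) (y, a)))
      \<in> state_space M \<rightarrow>\<^sub>M prob_algebra (sa_space M)"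
    using measurable_compose[OF measurable_Pair1'[OF h] action_step_measurable] by simp
  have "(\<integral>\<^sup>+ z. G z \<partial>step_kernel M \<pi> x t h) =
     (\<integral>\<^sup>+ y. \<integral>\<^sup>+ z. G z \<partial>(\<pi> t (h, y) \<bind> (\<lambda>a. return (sa_space M) (y, a))) \<partial>next_state M x t h)"
    unfolding step_kernel_def
    by (rule nn_integral_bind[where B="sa_space M"])
       (use m in \<open>auto simp: measurable_cong_sets[OF sN refl] intro: measurable_prob_algebraD\<close>)
  also have "\<dots> = (\<integral>\<^sup>+ y. \<integral>\<^sup>+ a. G (y, a) \<partial>\<pi> t (h, y) \<partial>next_state M x t h)"
  proof (intro nn_integral_cong)
    fix y assume "y \<in> space (next_state M x t h)"
    then have y: "y \<in> states M" using N by (simp add: prob_algebra_space)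
    have Q: "\<pi> t (h, y) \<in> space (prob_algebra (action_space M))"
      using h y by (intro measurable_space[OF policy_measurable]) (simp add: space_pair_measure)
    then have sQ: "sets (\<pi> t (h, y)) = sets (action_space M)"
      by (simp add: space_prob_algebra)
    have [measurable]: "y \<in> space (state_space M)" using y by simp
    have p: "(\<lambda>a. (y, a)) \<in> action_space M \<rightarrow>\<^sub>M sa_space M"
      unfolding sa_space_def by measurable
    have "(\<integral>\<^sup>+ z. G z \<partial>(\<pi> t (h, y) \<bind> (\<lambda>a. return (sa_space M) (y, a)))) =
        (\<integral>\<^sup>+ a. \<integral>\<^sup>+ z. G z \<partial>return (sa_space M) (y, a) \<partial>\<pi> t (h, y))"
      using measurable_compose[OF p return_measurable]
      by (intro nn_integral_bind[where B="sa_space M"]) (simp_all add: measurable_cong_sets[OF sQ refl])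
    also have "\<dots> = (\<integral>\<^sup>+ a. G (y, a) \<partial>\<pi> t (h, y))"
      using y by (intro nn_integral_cong nn_integral_return)
        (auto simp: space_sa_space prob_algebra_space[OF Q])
    finally show "(\<integral>\<^sup>+ z. G z \<partial>(\<pi> t (h, y) \<bind> (\<lambda>a. return (sa_space M) (y, a)))) =
        (\<integral>\<^sup>+ a. G (y, a) \<partial>\<pi> t (h, y))" .
  qed
  finally show ?thesis .
qed

lemma P_eq: "P = IT.PF.lim"
  by (simp add: trajectory_measure_def)

lemma sets_P [measurable_cong]: "sets P = sets (PiM UNIV (\<lambda>_. sa_space M))"
  by (simp add: P_eq IT.PF.sets_lim)

lemma space_P: "space P = PiE UNIV (\<lambda>_. states M \<times> actions M)"
  using sets_eq_imp_space_eq[OF sets_P] by (simp add: space_PiM space_sa_space)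

lemma nn_integral_P_initial:
  assumes f [measurable]: "f \<in> borel_measurable (PiM {0..<n} (\<lambda>_. sa_space M))"
  shows "(\<integral>\<^sup>+ \<omega>. f (restrict \<omega> {0..<n}) \<partial>P) = (\<integral>\<^sup>+ h. f h \<partial>P_upto n)"
proof -
  have r: "(\<lambda>\<omega>. restrict \<omega> {0..<n}) \<in> PiM UNIV (\<lambda>_. sa_space M) \<rightarrow>\<^sub>M PiM {0..<n} (\<lambda>_. sa_space M)"
    by (rule measurable_restrict_subset) (rule subset_UNIV)
  have "(\<integral>\<^sup>+ \<omega>. f (restrict \<omega> {0..<n}) \<partial>P) =
      (\<integral>\<^sup>+ h. f h \<partial>distr IT.PF.lim (PiM {0..<n} (\<lambda>_. sa_space M)) (\<lambda>\<omega>. restrict \<omega> {0..<n}))"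
    unfolding P_eq
    by (intro nn_integral_distr[symmetric])
       (simp_all only: measurable_cong_sets[OF IT.PF.sets_lim refl] measurable_distr_eq1 r f)
  also have "\<dots> = (\<integral>\<^sup>+ h. f h \<partial>IT.CI {0..<n})"
    by (subst IT.distr_lim) simp_all
  also have "IT.CI {0..<n} = P_upto n"
  proof (rule measure_eqI)
    show "sets (IT.CI {0..<n}) = sets (P_upto n)"
      by (simp add: IT.CI_def IT.sets_C)
    fix A assume "A \<in> sets (IT.CI {0..<n})"
    then have A: "A \<in> sets (PiM {0..<n} (\<lambda>_. sa_space M))" by (simp add: IT.CI_def)
    show "emeasure (IT.CI {0..<n}) A = emeasure (P_upto n) A"
      using IT.emeasure_CI[OF subset_refl A] sets.sets_into_space[OF A]
      by (simp add: prod_emb_id space_PiM)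
  qed
  finally show ?thesis .
qed

lemma prob_space_P: "prob_space P"
proof
  interpret C0: prob_space "P_upto 0" by (rule IT.prob_space_C) simp
  show "emeasure P (space P) = 1"
    using nn_integral_P_initial[of "\<lambda>_. 1" 0] C0.emeasure_space_1 by simp
qed

lemma nn_integral_P_step:
  assumes [measurable]: "G \<in> borel_measurable (sa_space M)"
  shows "(\<integral>\<^sup>+ \<omega>. G (\<omega> t) \<partial>P) =
    (\<integral>\<^sup>+ h. \<integral>\<^sup>+ y. \<integral>\<^sup>+ a. G (y, a) \<partial>\<pi> t (h, y) \<partial>next_state M x t h \<partial>P_upto t)"
proof -
  have "(\<integral>\<^sup>+ \<omega>. G (\<omega> t) \<partial>P) = (\<integral>\<^sup>+ \<omega>. (\<lambda>h. G (h t)) (restrict \<omega> {0..<Suc t}) \<partial>P)"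
    by simp
  also have "\<dots> = (\<integral>\<^sup>+ h. G (h t) \<partial>P_upto (Suc t))"
    by (rule nn_integral_P_initial) simp
  also have "\<dots> = (\<integral>\<^sup>+ h. \<integral>\<^sup>+ h'. G (h' t) \<partial>IT.eP t h \<partial>P_upto t)"
    by (simp, subst nn_integral_bind[where B="PiM {0..<Suc t} (\<lambda>_. sa_space M)"])
       (auto simp: measurable_cong_sets[OF IT.sets_C refl])
  also have "\<dots> = (\<integral>\<^sup>+ h. \<integral>\<^sup>+ z. G z \<partial>step_kernel M \<pi> x t h \<partial>P_upto t)"
    by (intro nn_integral_cong) (simp add: IT.space_C IT.nn_integral_eP)
  also have "\<dots> = (\<integral>\<^sup>+ h. \<integral>\<^sup>+ y. \<integral>\<^sup>+ a. G (y, a) \<partial>\<pi> t (h, y) \<partial>next_state M x t h \<partial>P_upto t)"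
    by (intro nn_integral_cong nn_integral_step_kernel) (simp_all add: IT.space_C)
  finally show ?thesis .
qed

lemma nn_integral_P_state:
  assumes [measurable]: "g \<in> borel_measurable (state_space M)"
  shows "(\<integral>\<^sup>+ \<omega>. g (fst (\<omega> t)) \<partial>P) =
    (\<integral>\<^sup>+ h. \<integral>\<^sup>+ y. g y \<partial>next_state M x t h \<partial>P_upto t)"
proof -
  have "(\<integral>\<^sup>+ \<omega>. g (fst (\<omega> t)) \<partial>P) =
    (\<integral>\<^sup>+ h. \<integral>\<^sup>+ y. \<integral>\<^sup>+ a. g (fst (y, a)) \<partial>\<pi> t (h, y) \<partial>next_state M x t h \<partial>P_upto t)"
    by (rule nn_integral_P_step) (simp add: sa_space_def)
  also have "\<dots> = (\<integral>\<^sup>+ h. \<integral>\<^sup>+ y. g y \<partial>next_state M x t h \<partial>P_upto t)"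
  proof (intro nn_integral_cong)
    fix h y assume "h \<in> space (P_upto t)"
    then have h: "h \<in> space (PiM {0..<t} (\<lambda>_. sa_space M))" by (simp add: IT.space_C)
    assume "y \<in> space (next_state M x t h)"
    then have "y \<in> states M"
      using prob_algebra_space[OF measurable_space[OF next_state_measurable h]] by simp
    then have "\<pi> t (h, y) \<in> space (prob_algebra (action_space M))"
      using h by (intro measurable_space[OF policy_measurable]) (simp add: space_pair_measure)
    then interpret prob_space "\<pi> t (h, y)" by (simp add: space_prob_algebra)
    show "(\<integral>\<^sup>+ a. g (fst (y, a)) \<partial>\<pi> t (h, y)) = g y"
      by (simp add: emeasure_space_1)
  qed
  finally show ?thesis .
qed

lemma nn_integral_P_initial_state:
  assumes "g \<in> borel_measurable (state_space M)"
  shows "(\<integral>\<^sup>+ \<omega>. g (fst (\<omega> 0)) \<partial>P) = g x"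
proof -
  interpret C0: prob_space "P_upto 0" by (rule IT.prob_space_C) simp
  have "(\<integral>\<^sup>+ \<omega>. g (fst (\<omega> 0)) \<partial>P) = (\<integral>\<^sup>+ h. g x \<partial>P_upto 0)"
    using assms start by (subst nn_integral_P_state) (auto simp: next_state_def nn_integral_return)
  then show ?thesis using C0.emeasure_space_1 by simp
qed

lemma nn_integral_trans_measurable:
  assumes [measurable]: "g \<in> borel_measurable (state_space M)"
  shows "(\<lambda>z. \<integral>\<^sup>+ y. g y \<partial>trans_prob M z) \<in> borel_measurable (sa_space M)"
  by (intro nn_integral_measurable_subprob_algebra2[where N="state_space M"] measurable_prob_algebraD) measurable

text \<open>
  The Markov property in the only form needed: given the past, the next state has law \<open>q(\<cdot> | x\<^sub>t, a\<^sub>t)\<close>,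
  whatever the policy.
\<close>

lemma nn_integral_P_next_state:
  assumes g [measurable]: "g \<in> borel_measurable (state_space M)"
  shows "(\<integral>\<^sup>+ \<omega>. g (fst (\<omega> (Suc t))) \<partial>P) = (\<integral>\<^sup>+ \<omega>. \<integral>\<^sup>+ y. g y \<partial>trans_prob M (\<omega> t) \<partial>P)"
proof -
  note [measurable] = nn_integral_trans_measurable[OF g]
  have "(\<integral>\<^sup>+ \<omega>. g (fst (\<omega> (Suc t))) \<partial>P) =
      (\<integral>\<^sup>+ h. (\<lambda>h. \<integral>\<^sup>+ y. g y \<partial>trans_prob M (h t)) h \<partial>P_upto (Suc t))"
    by (subst nn_integral_P_state) (simp_all add: next_state_def)
  also have "\<dots> = (\<integral>\<^sup>+ \<omega>. (\<lambda>h. \<integral>\<^sup>+ y. g y \<partial>trans_prob M (h t)) (restrict \<omega> {0..<Suc t}) \<partial>P)"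
    by (rule nn_integral_P_initial[symmetric]) measurable
  finally show ?thesis by simp
qed

lemma nn_integral_P_stationary:
  assumes pi: "\<pi> = stationary_policy M \<phi>" and phi: "\<phi> \<in> stationary_maps M"
    and G [measurable]: "G \<in> borel_measurable (sa_space M)"
  shows "(\<integral>\<^sup>+ \<omega>. G (\<omega> t) \<partial>P) = (\<integral>\<^sup>+ \<omega>. G (fst (\<omega> t), \<phi> (fst (\<omega> t))) \<partial>P)"
proof -
  have phi' [measurable]: "\<phi> \<in> state_space M \<rightarrow>\<^sub>M action_space M"
    using phi by (simp add: stationary_maps_def)
  have G' [measurable]: "(\<lambda>y. G (y, \<phi> y)) \<in> borel_measurable (state_space M)"
    using G unfolding sa_space_def by measurable
  have "(\<integral>\<^sup>+ \<omega>. G (\<omega> t) \<partial>P) =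
      (\<integral>\<^sup>+ h. \<integral>\<^sup>+ y. \<integral>\<^sup>+ a. G (y, a) \<partial>\<pi> t (h, y) \<partial>next_state M x t h \<partial>P_upto t)"
    by (rule nn_integral_P_step) simp
  also have "\<dots> = (\<integral>\<^sup>+ h. \<integral>\<^sup>+ y. G (y, \<phi> y) \<partial>next_state M x t h \<partial>P_upto t)"
  proof (intro nn_integral_cong)
    fix h y assume "h \<in> space (P_upto t)"
    then have h: "h \<in> space (PiM {0..<t} (\<lambda>_. sa_space M))" by (simp add: IT.space_C)
    assume "y \<in> space (next_state M x t h)"
    then have y [measurable]: "y \<in> space (state_space M)"
      using prob_algebra_space[OF measurable_space[OF next_state_measurable h]] by simp
    have "(\<lambda>a. G (y, a)) \<in> borel_measurable (action_space M)"
      using G unfolding sa_space_def by measurable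
    then show "(\<integral>\<^sup>+ a. G (y, a) \<partial>\<pi> t (h, y)) = G (y, \<phi> y)"
      using measurable_space[OF phi' y] by (simp add: pi stationary_policy_def nn_integral_return)
  qed
  also have "\<dots> = (\<integral>\<^sup>+ \<omega>. G (fst (\<omega> t), \<phi> (fst (\<omega> t))) \<partial>P)"
    by (subst nn_integral_P_state[symmetric]) auto
  finally show ?thesis .
qed

end

lemma stationary_policy_in_policies:
  assumes "is_mdp M" and phi: "\<phi> \<in> stationary_maps M"
  shows "stationary_policy M \<phi> \<in> policies M"
proof -
  have [measurable]: "\<phi> \<in> state_space M \<rightarrow>\<^sub>M action_space M"
    using phi by (simp add: stationary_maps_def)
  have "(\<lambda>p. return (action_space M) (\<phi> (snd p))) \<in> history_space M t \<rightarrow>\<^sub>M prob_algebra (action_space M)" for t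
    unfolding history_space_def by measurable
  then show ?thesis
    by (simp add: policies_def stationary_policy_def case_prod_unfold)
qed

section \<open>Value iteration\<close>

text \<open>The constant \<open>R\<close> is nonnegative so that the constants \<open>R / (1 - \<alpha>)\<close> are admissible in \<open>eintegral_minus_const\<close>.\<close>

locale bounded_below_mdp =
  fixes M :: "('x::polish_space, 'a::polish_space) mdp" and R :: real
  assumes mdp: "is_mdp M" and R_nonneg: "0 \<le> R"
    and cost_ge: "\<And>z. z \<in> states M \<times> actions M \<Longrightarrow> - ereal R \<le> cost M z"
    and cost_K_inf_compact: "K_inf_compact (states M) (actions M) (cost M)"
    and weakly_continuous: "weakly_continuous_kernel M"
begin

abbreviation "X \<equiv> states M"
abbreviation "A \<equiv> actions M"

definition shifted_cost :: "'x \<times> 'a \<Rightarrow> ennreal" where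
  "shifted_cost z = e2ennreal (cost M z + ereal R)"

lemma cost_eq: "z \<in> X \<times> A \<Longrightarrow> cost M z = enn2ereal (shifted_cost z) - ereal R"
  using cost_ge[of z] unfolding shifted_cost_def
  by (cases "cost M z") (auto simp: enn2ereal_e2ennreal)

text \<open>
  The states of a convergent sequence form, together with their limit, a compact set \<open>K\<close>, and
  K-inf-compactness applies to \<open>K \<times> A\<close>. Both the compactness in the action and the lower
  semicontinuity of the cost follow from this.
\<close>

lemma shifted_cost_compact:
  assumes s: "\<And>n::nat. s n \<in> X" "s \<longlonglongrightarrow> x" "x \<in> X" and a: "\<And>n. a n \<in> A"
    and l: "l < top" "\<And>n. shifted_cost (s n, a n) \<le> l"
  obtains r b where "strict_mono r" "b \<in> A" "(a \<circ> r) \<longlonglongrightarrow> b" "shifted_cost (x, b) \<le> l"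
proof -
  define K where "K = insert x (range s)"
  obtain l' where l': "l = ennreal l'" "0 \<le> l'" using l(1) by (cases l) auto
  let ?S = "{u \<in> K \<times> A. cost M u \<le> ereal (l' - R)}"
  have "compact K" unfolding K_def 
    using compactin_sequence_with_limit[of euclidean s x "range s"] s(2)
    by (simp add: compactin_euclidean_iff)
  moreover have "K \<noteq> {}" "K \<subseteq> X" using s(1,3) by (auto simp: K_def)
  ultimately have "compact ?S"
    using cost_K_inf_compact unfolding K_inf_compact_def inf_compact_on_def by simp
  have le_iff: "cost M u \<le> ereal (l' - R) \<longleftrightarrow> shifted_cost u \<le> l" if "u \<in> X \<times> A" for u
    unfolding cost_eq[OF that] l' using l'(2) by (cases "shifted_cost u") (auto simp: top_unique)
  have in_S: "\<forall>n. (s n, a n) \<in> ?S"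
    using le_iff s(1) a l(2) by (simp add: K_def)
  obtain p r where p: "p \<in> ?S" "strict_mono r" "((\<lambda>n. (s n, a n)) \<circ> r) \<longlonglongrightarrow> p"
    by (rule seq_compactE[OF compact_imp_seq_compact[OF \<open>compact ?S\<close>] in_S]) (rule that)
  have sr: "(s \<circ> r) \<longlonglongrightarrow> fst p" and ar: "(a \<circ> r) \<longlonglongrightarrow> snd p"
    using tendsto_fst[OF p(3)] tendsto_snd[OF p(3)] by (simp_all add: comp_def)
  have "fst p = x"
    by (rule LIMSEQ_unique[OF sr LIMSEQ_subseq_LIMSEQ[OF s(2) p(2)]])
  then have px: "p = (x, snd p)" by (cases p) simp
  moreover have "snd p \<in> A" using p(1) by auto
  moreover have "shifted_cost p \<le> l" using le_iff[of p] p(1) \<open>K \<subseteq> X\<close> by auto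
  ultimately show ?thesis using that[OF p(2) _ ar] by simp
qed

lemma action_compact_shifted_cost: "action_compact X A shifted_cost"
  unfolding action_compact_def
proof (intro ballI allI impI)
  fix x s a l
  assume *: "x \<in> X" "\<forall>n. s n \<in> X" "s \<longlonglongrightarrow> x" "\<forall>n. a n \<in> A" "l < top" "\<forall>n::nat. shifted_cost (s n, a n) \<le> l"
  obtain r b where "strict_mono r" "b \<in> A" "(a \<circ> r) \<longlonglongrightarrow> b"
    by (rule shifted_cost_compact[of s x a l]) (use * in auto)
  then show "\<exists>r b. strict_mono r \<and> b \<in> A \<and> (a \<circ> r) \<longlonglongrightarrow> b" by blast
qed

lemma lsc_on_shifted_cost: "lsc_on (X \<times> A) shifted_cost"
  unfolding lsc_on_def
proof (intro ballI allI impI)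
  fix z s assume z: "z \<in> X \<times> A" and s: "\<forall>n. s n \<in> X \<times> A" "s \<longlonglongrightarrow> z"
  show "shifted_cost z \<le> liminf (\<lambda>n. shifted_cost (s n))"
  proof (rule ccontr)
    assume "\<not> ?thesis"
    then have less: "liminf (\<lambda>n. shifted_cost (s n)) < shifted_cost z" by simp
    obtain l where l: "liminf (\<lambda>n. shifted_cost (s n)) < l" "l < shifted_cost z"
      using dense[OF less] by blast
    obtain r :: "nat \<Rightarrow> nat" where r: "strict_mono r" "\<And>n. shifted_cost (s (r n)) < l"
      by (rule liminf_lessE[OF l(1)]) (rule that)
    have sr: "(\<lambda>n. s (r n)) \<longlonglongrightarrow> z"
      using LIMSEQ_subseq_LIMSEQ[OF s(2) r(1)] by (simp add: comp_def)
    obtain r' b where b: "strict_mono r'" "b \<in> A" "((\<lambda>n. snd (s (r n))) \<circ> r') \<longlonglongrightarrow> b"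
      "shifted_cost (fst z, b) \<le> l"
    proof (rule shifted_cost_compact[of "\<lambda>n. fst (s (r n))" "fst z" "\<lambda>n. snd (s (r n))" l])
      show "fst (s (r n)) \<in> X" "snd (s (r n)) \<in> A" for n using s(1)[rule_format, of "r n"] by auto
      show "l < top" using l(2) by (rule order.strict_trans2) simp
    qed (use z tendsto_fst[OF sr] r(2) in \<open>auto intro: less_imp_le\<close>)
    have "((\<lambda>n. snd (s (r n))) \<circ> r') \<longlonglongrightarrow> snd z"
      using LIMSEQ_subseq_LIMSEQ[OF tendsto_snd[OF sr] b(1)] .
    then have "b = snd z" by (rule LIMSEQ_unique[OF b(3)])
    with b(4) l(2) show False by simp
  qed
qed

lemma trans_prob_kernel:
  assumes "z \<in> X \<times> A"
  shows "prob_space (trans_prob M z)" "sets (trans_prob M z) = sets (state_space M)"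
    "space (trans_prob M z) = X"
proof -
  have "trans_prob M z \<in> space (prob_algebra (state_space M))"
    using mdp assms unfolding is_mdp_def by (auto intro: measurable_space simp: space_sa_space)
  then show "prob_space (trans_prob M z)" "sets (trans_prob M z) = sets (state_space M)"
    by (simp_all add: space_prob_algebra)
  then show "space (trans_prob M z) = X"
    using sets_eq_imp_space_eq[of "trans_prob M z" "state_space M"] by simp
qed

lemma lsc_on_trans_integral:
  assumes "lsc_on X V" shows "lsc_on (X \<times> A) (\<lambda>z. \<integral>\<^sup>+ y. V y \<partial>trans_prob M z)"
  using weakly_continuous assms trans_prob_kernel
  by (intro lsc_on_nn_integral_kernel[where S=X]) (auto simp: weakly_continuous_kernel_def state_space_def)

lemma measurable_state: "lsc_on X V \<Longrightarrow> V \<in> borel_measurable (state_space M)"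
  unfolding state_space_def by (rule borel_measurable_lsc_on)

text \<open>
  On a product of second countable spaces the Borel sets of the product are generated by the measurable rectangles,
  so Borel functions on \<open>X \<times> A\<close> are measurable for the product structure.
\<close>

lemma measurable_state_action:
  assumes "lsc_on (X \<times> A) F" shows "F \<in> borel_measurable (sa_space M)"
proof -
  have "(\<lambda>z. (fst z, snd z)) \<in> sa_space M \<rightarrow>\<^sub>M (borel \<Otimes>\<^sub>M borel :: ('x \<times> 'a) measure)"
    unfolding sa_space_def state_space_def action_space_def
    by (intro measurable_Pair measurable_compose[OF measurable_fst] measurable_compose[OF measurable_snd]
        measurable_restrict_space1) auto
  then have "(\<lambda>z. z) \<in> sa_space M \<rightarrow>\<^sub>M borel" by (simp add: borel_prod)
  then have "(\<lambda>z. z) \<in> sa_space M \<rightarrow>\<^sub>M restrict_space borel (X \<times> A)"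
    by (intro measurable_restrict_space2) (auto simp: space_sa_space)
  from measurable_compose[OF this borel_measurable_lsc_on[OF assms]] show ?thesis .
qed

lemma shifted_cost_measurable [measurable]: "shifted_cost \<in> borel_measurable (sa_space M)"
  by (rule measurable_state_action[OF lsc_on_shifted_cost])

text \<open>
  The cost of one step followed by the terminal cost \<open>V\<close>. The case \<open>\<alpha> = 1\<close> is the right-hand side of the
  average-cost optimality equation, up to the shift by \<open>R\<close>.
\<close>

definition bellman_value :: "real \<Rightarrow> ('x \<Rightarrow> ennreal) \<Rightarrow> 'x \<times> 'a \<Rightarrow> ennreal" where
  "bellman_value \<alpha> V z = shifted_cost z + ennreal \<alpha> * (\<integral>\<^sup>+ y. V y \<partial>trans_prob M z)"

lemma lsc_on_bellman_value: "lsc_on X V \<Longrightarrow> lsc_on (X \<times> A) (bellman_value \<alpha> V)"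
  unfolding bellman_value_def[abs_def]
  by (intro lsc_on_add lsc_on_shifted_cost lsc_on_cmult lsc_on_trans_integral)

lemma action_compact_bellman_value: "action_compact X A (bellman_value \<alpha> V)"
  by (rule action_compact_mono[OF action_compact_shifted_cost]) (simp add: bellman_value_def)

lemma bellman_value_mono:
  assumes "z \<in> X \<times> A" "0 \<le> \<alpha>" "\<alpha> \<le> \<beta>" "\<And>y. y \<in> X \<Longrightarrow> V y \<le> W y"
  shows "bellman_value \<alpha> V z \<le> bellman_value \<beta> W z"
  unfolding bellman_value_def using assms trans_prob_kernel(3)[OF assms(1)]
  by (intro add_left_mono mult_mono ennreal_leI nn_integral_mono) auto

lemma bellman_INF_mono:
  assumes "x \<in> X" "0 \<le> \<alpha>" "\<And>y. y \<in> X \<Longrightarrow> V y \<le> W y"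
  shows "(INF a\<in>A. bellman_value \<alpha> V (x, a)) \<le> (INF a\<in>A. bellman_value \<alpha> W (x, a))"
  using assms by (intro INF_superset_mono[OF subset_refl] bellman_value_mono) auto

text \<open>
  The discount factor varies with \<open>n\<close> as well: value iteration uses a constant sequence, the passage to the average
  cost a sequence increasing to 1.
\<close>

lemma bellman_value_SUP:
  assumes z: "z \<in> X \<times> A" and V: "\<And>n. lsc_on X (V n)" and \<alpha>: "incseq \<alpha>" "\<And>n. 0 \<le> \<alpha> n" "\<alpha> \<longlonglongrightarrow> a"
    and mono: "\<And>m n y. y \<in> X \<Longrightarrow> m \<le> n \<Longrightarrow> V m y \<le> V n y"
  shows "bellman_value a (\<lambda>y. SUP n. V n y) z = (SUP n. bellman_value (\<alpha> n) (V n) z)"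
proof -
  let ?I = "\<lambda>n. \<integral>\<^sup>+ y. V n y \<partial>trans_prob M z"
  note tk = trans_prob_kernel[OF z]
  have meas: "V n \<in> borel_measurable (trans_prob M z)" for n
    using measurable_state[OF V] by (simp add: measurable_cong_sets[OF tk(2) refl])
  have I: "(\<integral>\<^sup>+ y. (SUP n. V n y) \<partial>trans_prob M z) = (SUP n. ?I n)"
    by (rule nn_integral_monotone_convergence_SUP_AE) (auto intro!: AE_I2 mono meas simp: tk)
  have incI: "incseq ?I" by (intro incseq_SucI nn_integral_mono mono) (auto simp: tk)
  have inc\<alpha>: "incseq (\<lambda>n. ennreal (\<alpha> n))" using \<alpha>(1) by (auto simp: incseq_def intro: ennreal_leI)
  have "(\<lambda>n. ennreal (\<alpha> n)) \<longlonglongrightarrow> ennreal a" using \<alpha>(3) by (rule tendsto_ennrealI)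
  then have a: "ennreal a = (SUP n. ennreal (\<alpha> n))" by (rule LIMSEQ_unique[OF _ LIMSEQ_SUP[OF inc\<alpha>]])
  have "ennreal a * (SUP n. ?I n) = (SUP n. ennreal (\<alpha> n) * ?I n)"
  proof (rule antisym)
    show "ennreal a * (SUP n. ?I n) \<le> (SUP n. ennreal (\<alpha> n) * ?I n)"
      unfolding a SUP_mult_left_ennreal SUP_mult_right_ennreal
    proof (intro SUP_least)
      fix m n :: nat
      have "ennreal (\<alpha> n) * ?I m \<le> ennreal (\<alpha> (max m n)) * ?I (max m n)"
        using inc\<alpha> incI by (intro mult_mono) (auto simp: incseq_def)
      also have "\<dots> \<le> (SUP n. ennreal (\<alpha> n) * ?I n)" by (rule SUP_upper) simp
      finally show "ennreal (\<alpha> n) * ?I m \<le> (SUP n. ennreal (\<alpha> n) * ?I n)" .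
    qed
    show "(SUP n. ennreal (\<alpha> n) * ?I n) \<le> ennreal a * (SUP n. ?I n)"
      unfolding a by (intro SUP_least mult_mono SUP_upper) auto
  qed
  then show ?thesis
    unfolding bellman_value_def I by (simp add: ennreal_SUP_add_right)
qed

primrec value_iteration :: "real \<Rightarrow> nat \<Rightarrow> 'x \<Rightarrow> ennreal" where
  "value_iteration \<alpha> 0 = (\<lambda>x. 0)"
| "value_iteration \<alpha> (Suc n) = (\<lambda>x. INF a\<in>A. bellman_value \<alpha> (value_iteration \<alpha> n) (x, a))"

definition optimal_value :: "real \<Rightarrow> 'x \<Rightarrow> ennreal" where
  "optimal_value \<alpha> x = (SUP n. value_iteration \<alpha> n x)"

lemma lsc_on_value_iteration: "lsc_on X (value_iteration \<alpha> n)"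
proof (induction n)
  case 0 then show ?case by (simp add: lsc_on_def)
next
  case (Suc n) then show ?case
    by (simp add: lsc_on_partial_INF lsc_on_bellman_value action_compact_bellman_value)
qed

lemma lsc_on_optimal_value: "lsc_on X (optimal_value \<alpha>)"
  unfolding optimal_value_def[abs_def] by (intro lsc_on_SUP lsc_on_value_iteration)

lemma value_iteration_mono:
  assumes "0 \<le> \<alpha>" "x \<in> X" "m \<le> n"
  shows "value_iteration \<alpha> m x \<le> value_iteration \<alpha> n x"
proof -
  have "\<forall>x\<in>X. value_iteration \<alpha> n x \<le> value_iteration \<alpha> (Suc n) x" for n
  proof (induction n)
    case (Suc n)
    show ?case
    proof
      fix x assume x: "x \<in> X"
      have T: "value_iteration \<alpha> (Suc k) x = (INF a\<in>A. bellman_value \<alpha> (value_iteration \<alpha> k) (x, a))" for k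
        by simp
      show "value_iteration \<alpha> (Suc n) x \<le> value_iteration \<alpha> (Suc (Suc n)) x"
        unfolding T[of n] T[of "Suc n"] by (rule bellman_INF_mono[OF x assms(1)]) (rule Suc[rule_format])
    qed
  qed simp
  then have "value_iteration \<alpha> k x \<le> value_iteration \<alpha> (Suc k) x" for k using assms(2) by blast
  then show ?thesis by (rule lift_Suc_mono_le[OF _ assms(3)])
qed

lemma bellman_value_optimal_value:
  assumes "0 \<le> \<alpha>" "z \<in> X \<times> A"
  shows "bellman_value \<alpha> (optimal_value \<alpha>) z = (SUP n. bellman_value \<alpha> (value_iteration \<alpha> n) z)"
  unfolding optimal_value_def[abs_def]
proof (rule bellman_value_SUP[where \<alpha>="\<lambda>_. \<alpha>"])
  show "value_iteration \<alpha> m y \<le> value_iteration \<alpha> n y" if "y \<in> X" "m \<le> n" for m n y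
    using assms(1) that by (rule value_iteration_mono)
qed (simp_all add: assms lsc_on_value_iteration incseq_def)

text \<open>
  Only the inequality \<open>\<ge>\<close> is not immediate from monotonicity; it is the interchange of the minimum over actions
  with the increasing limit of value iteration.
\<close>

lemma optimality_equation:
  assumes \<alpha>: "0 \<le> \<alpha>" and x: "x \<in> X"
  shows "optimal_value \<alpha> x = (INF a\<in>A. bellman_value \<alpha> (optimal_value \<alpha>) (x, a))"
proof (rule antisym)
  show "optimal_value \<alpha> x \<le> (INF a\<in>A. bellman_value \<alpha> (optimal_value \<alpha>) (x, a))"
    unfolding optimal_value_def[of \<alpha> x]
  proof (rule SUP_least)
    fix n
    show "value_iteration \<alpha> n x \<le> (INF a\<in>A. bellman_value \<alpha> (optimal_value \<alpha>) (x, a))"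
    proof (cases n)
      case (Suc m)
      show ?thesis unfolding Suc value_iteration.simps using x \<alpha>
        by (intro bellman_INF_mono) (auto simp: optimal_value_def intro: SUP_upper2)
    qed simp
  qed
  show "(INF a\<in>A. bellman_value \<alpha> (optimal_value \<alpha>) (x, a)) \<le> optimal_value \<alpha> x"
  proof (cases "optimal_value \<alpha> x = top")
    case False
    obtain a where a: "a \<in> A" "\<And>n. bellman_value \<alpha> (value_iteration \<alpha> n) (x, a) \<le> optimal_value \<alpha> x"
    proof (rule increasing_lsc_minimiser[of X A "\<lambda>n. bellman_value \<alpha> (value_iteration \<alpha> n)" x "optimal_value \<alpha> x"])
      show "(INF a\<in>A. bellman_value \<alpha> (value_iteration \<alpha> n) (x, a)) \<le> optimal_value \<alpha> x" for n
      proof -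
        have "(INF a\<in>A. bellman_value \<alpha> (value_iteration \<alpha> n) (x, a)) = value_iteration \<alpha> (Suc n) x" by simp
        also have "\<dots> \<le> optimal_value \<alpha> x" unfolding optimal_value_def by (rule SUP_upper) simp
        finally show ?thesis .
      qed
      show "bellman_value \<alpha> (value_iteration \<alpha> m) (x, a) \<le> bellman_value \<alpha> (value_iteration \<alpha> n) (x, a)"
        if "a \<in> A" "m \<le> n" for m n a
        using that x \<alpha> by (intro bellman_value_mono value_iteration_mono) auto
    qed (use False x in \<open>auto simp: lsc_on_bellman_value lsc_on_value_iteration action_compact_bellman_value
          less_top\<close>)
    have "bellman_value \<alpha> (optimal_value \<alpha>) (x, a) \<le> optimal_value \<alpha> x"
      using a x \<alpha> by (subst bellman_value_optimal_value) (auto intro: SUP_least)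
    with a(1) show ?thesis by (rule INF_lower2)
  qed simp
qed

end

section \<open>Costs of policies\<close>

lemma ereal_mult_minus_const:
  assumes "0 \<le> p"
  shows "ereal p * (enn2ereal c - ereal r) = enn2ereal (ennreal p * c) - ereal (p * r)"
proof (cases c)
  case (real s)
  then show ?thesis using assms by (simp add: ennreal_mult[symmetric] algebra_simps)
next
  case top
  then show ?thesis using assms by (cases "p = 0") (simp_all add: ennreal_mult_top zero_ennreal.rep_eq)
qed

lemma ereal_plus_minus_const:
  "(enn2ereal a - ereal r) + (enn2ereal b - ereal s) = enn2ereal (a + b) - ereal (r + s)"
  by (cases a; cases b) (auto simp: ennreal_plus[symmetric] simp del: ennreal_plus)

context bounded_below_mdp
begin

definition expected_cost :: "('x, 'a) policy \<Rightarrow> 'x \<Rightarrow> nat \<Rightarrow> ennreal" where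
  "expected_cost \<pi> x t = (\<integral>\<^sup>+ \<omega>. shifted_cost (\<omega> t) \<partial>trajectory_measure M \<pi> x)"

lemma sum_cost_eq:
  assumes "0 \<le> \<alpha>" and \<omega>: "\<And>t. \<omega> t \<in> X \<times> A"
  shows "(\<Sum>t<n. ereal (\<alpha> ^ t) * cost M (\<omega> t)) =
    enn2ereal (\<Sum>t<n. ennreal (\<alpha> ^ t) * shifted_cost (\<omega> t)) - ereal (\<Sum>t<n. \<alpha> ^ t * R)"
proof (induction n)
  case 0 show ?case by (simp add: zero_ennreal.rep_eq)
next
  case (Suc n)
  then show ?case
    using assms(1) by (simp only: sum.lessThan_Suc cost_eq[OF \<omega>] ereal_mult_minus_const zero_le_power ereal_plus_minus_const)
qed

lemma suminf_cost_eq: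
  assumes \<alpha>: "0 \<le> \<alpha>" "\<alpha> < 1" and \<omega>: "\<And>t. \<omega> t \<in> X \<times> A"
  shows "(\<Sum>t. ereal (\<alpha> ^ t) * cost M (\<omega> t)) =
    enn2ereal (\<Sum>t. ennreal (\<alpha> ^ t) * shifted_cost (\<omega> t)) - ereal (R / (1 - \<alpha>))"
proof -
  have "(\<lambda>t. \<alpha> ^ t * R) sums (1 / (1 - \<alpha>) * R)"
    using \<alpha> by (intro sums_mult2 geometric_sums) auto
  then have "(\<lambda>n. \<Sum>t<n. \<alpha> ^ t * R) \<longlonglongrightarrow> R / (1 - \<alpha>)" by (simp add: sums_def)
  then have "(\<lambda>n. ereal (- (\<Sum>t<n. \<alpha> ^ t * R))) \<longlonglongrightarrow> ereal (- (R / (1 - \<alpha>)))"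
    by (intro tendsto_ereal tendsto_minus)
  moreover have "(\<lambda>n. enn2ereal (\<Sum>t<n. ennreal (\<alpha> ^ t) * shifted_cost (\<omega> t))) \<longlonglongrightarrow>
      enn2ereal (\<Sum>t. ennreal (\<alpha> ^ t) * shifted_cost (\<omega> t))"
    unfolding tendsto_enn2ereal_iff by (rule summable_LIMSEQ) simp
  ultimately have "(\<lambda>n. enn2ereal (\<Sum>t<n. ennreal (\<alpha> ^ t) * shifted_cost (\<omega> t)) + ereal (- (\<Sum>t<n. \<alpha> ^ t * R)))
      \<longlonglongrightarrow> enn2ereal (\<Sum>t. ennreal (\<alpha> ^ t) * shifted_cost (\<omega> t)) + ereal (- (R / (1 - \<alpha>)))"
    by (intro tendsto_add_ereal_general) auto
  then have "(\<lambda>t. ereal (\<alpha> ^ t) * cost M (\<omega> t)) sums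
      (enn2ereal (\<Sum>t. ennreal (\<alpha> ^ t) * shifted_cost (\<omega> t)) - ereal (R / (1 - \<alpha>)))"
    unfolding sums_def sum_cost_eq[OF \<alpha>(1) \<omega>] by (simp add: minus_ereal_def)
  then show ?thesis by (rule sums_unique[symmetric])
qed

context
  fixes \<pi> x assumes policy: "\<pi> \<in> policies M" and start: "x \<in> X"
begin

interpretation controlled_process M \<pi> x
  by unfold_locales (fact mdp policy start)+

lemma trajectory_in_space: "\<omega> \<in> space P \<Longrightarrow> \<omega> t \<in> X \<times> A"
  by (auto simp: space_P PiE_iff)

lemma shifted_cost_at_measurable [measurable]: "(\<lambda>\<omega>. shifted_cost (\<omega> t)) \<in> borel_measurable P"
  by measurable

lemma finite_horizon_cost_eq:
  "finite_horizon_cost M N 1 \<pi> x = enn2ereal (\<Sum>t<N. expected_cost \<pi> x t) - ereal (real N * R)"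
proof -
  have "finite_horizon_cost M N 1 \<pi> x =
      eintegral P (\<lambda>\<omega>. enn2ereal (\<Sum>t<N. shifted_cost (\<omega> t)) - ereal (real N * R))"
    unfolding finite_horizon_cost_def
    using sum_cost_eq[OF zero_le_one trajectory_in_space] by (intro eintegral_cong) simp
  also have "\<dots> = enn2ereal (\<integral>\<^sup>+ \<omega>. (\<Sum>t<N. shifted_cost (\<omega> t)) \<partial>P) - ereal (real N * R)"
    using R_nonneg by (intro eintegral_minus_const prob_space_P) auto
  also have "(\<integral>\<^sup>+ \<omega>. (\<Sum>t<N. shifted_cost (\<omega> t)) \<partial>P) = (\<Sum>t<N. expected_cost \<pi> x t)"
    unfolding expected_cost_def by (intro nn_integral_sum) simp
  finally show ?thesis .
qed

lemma discounted_cost_eq: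
  assumes \<alpha>: "0 \<le> \<alpha>" "\<alpha> < 1"
  shows "discounted_cost M \<alpha> \<pi> x =
    enn2ereal (\<Sum>t. ennreal (\<alpha> ^ t) * expected_cost \<pi> x t) - ereal (R / (1 - \<alpha>))"
proof -
  have "discounted_cost M \<alpha> \<pi> x =
      eintegral P (\<lambda>\<omega>. enn2ereal (\<Sum>t. ennreal (\<alpha> ^ t) * shifted_cost (\<omega> t)) - ereal (R / (1 - \<alpha>)))"
    unfolding discounted_cost_def by (intro eintegral_cong suminf_cost_eq[OF \<alpha> trajectory_in_space])
  also have "\<dots> = enn2ereal (\<integral>\<^sup>+ \<omega>. (\<Sum>t. ennreal (\<alpha> ^ t) * shifted_cost (\<omega> t)) \<partial>P) - ereal (R / (1 - \<alpha>))"
    using R_nonneg \<alpha> by (intro eintegral_minus_const prob_space_P) auto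
  also have "(\<integral>\<^sup>+ \<omega>. (\<Sum>t. ennreal (\<alpha> ^ t) * shifted_cost (\<omega> t)) \<partial>P) =
      (\<Sum>t. ennreal (\<alpha> ^ t) * expected_cost \<pi> x t)"
    unfolding expected_cost_def
    by (subst nn_integral_suminf) (simp_all add: nn_integral_cmult)
  finally show ?thesis .
qed

lemma nn_integral_bellman_value:
  assumes [measurable]: "V \<in> borel_measurable (state_space M)"
  shows "(\<integral>\<^sup>+ \<omega>. bellman_value \<alpha> V (\<omega> t) \<partial>P) =
    expected_cost \<pi> x t + ennreal \<alpha> * (\<integral>\<^sup>+ \<omega>. V (fst (\<omega> (Suc t))) \<partial>P)"
proof -
  note [measurable] = nn_integral_trans_measurable[OF assms]
  show ?thesis
    unfolding bellman_value_def expected_cost_def nn_integral_P_next_state[OF assms]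
    by (subst nn_integral_add) (simp_all add: nn_integral_cmult)
qed

text \<open>
  The \<open>n\<close>-th iterate is a lower bound for the cost of \<open>n\<close> further steps, started from any time \<open>s\<close>, because it is at
  most the Bellman value of whatever action the policy takes. Starting at an arbitrary time avoids
  the construction of shifted policies.
\<close>

lemma value_iteration_le_expected_cost:
  assumes "0 \<le> \<alpha>"
  shows "(\<integral>\<^sup>+ \<omega>. value_iteration \<alpha> n (fst (\<omega> s)) \<partial>P) \<le> (\<Sum>k<n. ennreal (\<alpha> ^ k) * expected_cost \<pi> x (s + k))"
proof (induction n arbitrary: s)
  case (Suc n)
  have "(\<integral>\<^sup>+ \<omega>. value_iteration \<alpha> (Suc n) (fst (\<omega> s)) \<partial>P) \<le>
      (\<integral>\<^sup>+ \<omega>. bellman_value \<alpha> (value_iteration \<alpha> n) (\<omega> s) \<partial>P)"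
  proof (rule nn_integral_mono)
    fix \<omega> assume "\<omega> \<in> space P"
    from trajectory_in_space[OF this, of s]
    have "snd (\<omega> s) \<in> A" "\<omega> s = (fst (\<omega> s), snd (\<omega> s))" by auto
    then show "value_iteration \<alpha> (Suc n) (fst (\<omega> s)) \<le> bellman_value \<alpha> (value_iteration \<alpha> n) (\<omega> s)"
      unfolding value_iteration.simps by (metis INF_lower)
  qed
  also have "\<dots> = expected_cost \<pi> x s + ennreal \<alpha> * (\<integral>\<^sup>+ \<omega>. value_iteration \<alpha> n (fst (\<omega> (Suc s))) \<partial>P)"
    by (intro nn_integral_bellman_value measurable_state lsc_on_value_iteration)
  also have "\<dots> \<le> expected_cost \<pi> x s +
      ennreal \<alpha> * (\<Sum>k<n. ennreal (\<alpha> ^ k) * expected_cost \<pi> x (Suc s + k))"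
    by (intro add_left_mono mult_left_mono Suc) simp
  also have "\<dots> = (\<Sum>k<Suc n. ennreal (\<alpha> ^ k) * expected_cost \<pi> x (s + k))"
    using assms by (subst sum.lessThan_Suc_shift) (simp add: sum_distrib_left ennreal_mult mult.assoc)
  finally show ?case .
qed simp

lemma optimal_value_le_discounted_tail:
  assumes "0 \<le> \<alpha>"
  shows "(\<integral>\<^sup>+ \<omega>. optimal_value \<alpha> (fst (\<omega> s)) \<partial>P) \<le> (\<Sum>k. ennreal (\<alpha> ^ k) * expected_cost \<pi> x (s + k))"
proof -
  have meas: "(\<lambda>\<omega>. value_iteration \<alpha> n (fst (\<omega> s))) \<in> borel_measurable P" for n
  proof -
    note [measurable] = measurable_state[OF lsc_on_value_iteration[of \<alpha> n]]
    have "fst \<in> sa_space M \<rightarrow>\<^sub>M state_space M" by (simp add: sa_space_def)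
    then show ?thesis by measurable
  qed
  have "(\<integral>\<^sup>+ \<omega>. optimal_value \<alpha> (fst (\<omega> s)) \<partial>P) = (SUP n. \<integral>\<^sup>+ \<omega>. value_iteration \<alpha> n (fst (\<omega> s)) \<partial>P)"
    unfolding optimal_value_def
  proof (rule nn_integral_monotone_convergence_SUP_AE)
    show "AE \<omega> in P. value_iteration \<alpha> n (fst (\<omega> s)) \<le> value_iteration \<alpha> (Suc n) (fst (\<omega> s))" for n
    proof (rule AE_I2)
      fix \<omega> assume "\<omega> \<in> space P"
      then have "fst (\<omega> s) \<in> X" using trajectory_in_space[of \<omega> s] by (simp add: mem_Times_iff)
      then show "value_iteration \<alpha> n (fst (\<omega> s)) \<le> value_iteration \<alpha> (Suc n) (fst (\<omega> s))"
        by (rule value_iteration_mono[OF assms]) simp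
    qed
  qed (rule meas)
  also have "\<dots> \<le> (\<Sum>k. ennreal (\<alpha> ^ k) * expected_cost \<pi> x (s + k))"
  proof (rule SUP_least)
    fix n
    show "(\<integral>\<^sup>+ \<omega>. value_iteration \<alpha> n (fst (\<omega> s)) \<partial>P) \<le> (\<Sum>k. ennreal (\<alpha> ^ k) * expected_cost \<pi> x (s + k))"
      using value_iteration_le_expected_cost[OF assms, of n s]
      by (rule order_trans) (rule sum_le_suminf, auto)
  qed
  finally show ?thesis .
qed

lemma optimal_value_le_discounted_cost:
  assumes "0 \<le> \<alpha>"
  shows "optimal_value \<alpha> x \<le> (\<Sum>k. ennreal (\<alpha> ^ k) * expected_cost \<pi> x k)"
  using optimal_value_le_discounted_tail[OF assms, of 0]
    nn_integral_P_initial_state[OF measurable_state[OF lsc_on_optimal_value[of \<alpha>]]] by simp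

text \<open>
  Every tail of the cost stream, discounted with \<open>\<beta>\<close>, costs at least the minimal \<open>\<beta>\<close>-discounted value. Hence
  \<open>discounted_sum_lower_bound\<close> applies to the expected costs.
\<close>

lemma min_optimal_value_le_discounted_cost:
  assumes \<beta>: "0 \<le> \<beta>" "\<beta> \<le> \<alpha>" "\<alpha> < 1"
  shows "ennreal (1 - \<beta>) * (INF y\<in>X. optimal_value \<beta> y) \<le>
    ennreal (1 - \<alpha>) * (\<Sum>k. ennreal (\<alpha> ^ k) * expected_cost \<pi> x k)"
proof (rule discounted_sum_lower_bound[OF \<beta>])
  fix s
  interpret P: prob_space P by (rule prob_space_P)
  have "(INF y\<in>X. optimal_value \<beta> y) = (\<integral>\<^sup>+ \<omega>. (INF y\<in>X. optimal_value \<beta> y) \<partial>P)"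
    by (simp add: P.emeasure_space_1)
  also have "\<dots> \<le> (\<integral>\<^sup>+ \<omega>. optimal_value \<beta> (fst (\<omega> s)) \<partial>P)"
  proof (rule nn_integral_mono)
    fix \<omega> assume "\<omega> \<in> space P"
    then have "fst (\<omega> s) \<in> X" using trajectory_in_space[of \<omega> s] by (simp add: mem_Times_iff)
    then show "(INF y\<in>X. optimal_value \<beta> y) \<le> optimal_value \<beta> (fst (\<omega> s))" by (rule INF_lower)
  qed
  also have "\<dots> \<le> (\<Sum>k. ennreal (\<beta> ^ k) * expected_cost \<pi> x (s + k))"
    by (rule optimal_value_le_discounted_tail[OF \<beta>(1)])
  finally show "(INF y\<in>X. optimal_value \<beta> y) \<le> (\<Sum>k. ennreal (\<beta> ^ k) * expected_cost \<pi> x (s + k))" .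
qed

text \<open>
  Telescoping the inequality \<open>bellman_value \<alpha> V (y, \<phi> y) \<le> g + V y\<close> along the trajectory. It is used with \<open>g = 0\<close> for the
  optimal policy at discount \<open>\<alpha>\<close> and with \<open>\<alpha> = 1\<close> for the average cost.
\<close>

lemma stationary_cost_upper_bound:
  assumes pi: "\<pi> = stationary_policy M \<phi>" and phi: "\<phi> \<in> stationary_maps M"
    and V [measurable]: "V \<in> borel_measurable (state_space M)" and \<alpha>: "0 \<le> \<alpha>" "\<alpha> \<le> 1"
    and le: "\<And>y. y \<in> X \<Longrightarrow> bellman_value \<alpha> V (y, \<phi> y) \<le> g + V y"
  shows "(\<Sum>k<n. ennreal (\<alpha> ^ k) * expected_cost \<pi> x k) \<le> of_nat n * g + V x"
proof -
  let ?e = "\<lambda>t. \<integral>\<^sup>+ \<omega>. V (fst (\<omega> t)) \<partial>P"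
  interpret P: prob_space P by (rule prob_space_P)
  have [measurable]: "fst \<in> sa_space M \<rightarrow>\<^sub>M state_space M" by (simp add: sa_space_def)
  have bm: "bellman_value \<alpha> V \<in> borel_measurable (sa_space M)"
    unfolding bellman_value_def[abs_def] using nn_integral_trans_measurable[OF V] by measurable
  have step: "expected_cost \<pi> x t + ennreal \<alpha> * ?e (Suc t) \<le> g + ?e t" for t
  proof -
    have "expected_cost \<pi> x t + ennreal \<alpha> * ?e (Suc t) = (\<integral>\<^sup>+ \<omega>. bellman_value \<alpha> V (\<omega> t) \<partial>P)"
      by (rule nn_integral_bellman_value[OF V, symmetric])
    also have "\<dots> = (\<integral>\<^sup>+ \<omega>. bellman_value \<alpha> V (fst (\<omega> t), \<phi> (fst (\<omega> t))) \<partial>P)"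
      by (rule nn_integral_P_stationary[OF pi phi bm])
    also have "\<dots> \<le> (\<integral>\<^sup>+ \<omega>. g + V (fst (\<omega> t)) \<partial>P)"
    proof (rule nn_integral_mono)
      fix \<omega> assume "\<omega> \<in> space P"
      then have "fst (\<omega> t) \<in> X" using trajectory_in_space[of \<omega> t] by (simp add: mem_Times_iff)
      then show "bellman_value \<alpha> V (fst (\<omega> t), \<phi> (fst (\<omega> t))) \<le> g + V (fst (\<omega> t))" by (rule le)
    qed
    also have "\<dots> = g + ?e t" by (subst nn_integral_add) (simp_all add: P.emeasure_space_1)
    finally show ?thesis .
  qed
  have "(\<Sum>k<n. ennreal (\<alpha> ^ k) * expected_cost \<pi> x k) + ennreal (\<alpha> ^ n) * ?e n \<le> of_nat n * g + ?e 0"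
  proof (induction n)
    case (Suc n)
    have "(\<Sum>k<Suc n. ennreal (\<alpha> ^ k) * expected_cost \<pi> x k) + ennreal (\<alpha> ^ Suc n) * ?e (Suc n) =
        (\<Sum>k<n. ennreal (\<alpha> ^ k) * expected_cost \<pi> x k) +
          ennreal (\<alpha> ^ n) * (expected_cost \<pi> x n + ennreal \<alpha> * ?e (Suc n))"
      using \<alpha> by (simp add: ennreal_mult algebra_simps)
    also have "\<dots> \<le> (\<Sum>k<n. ennreal (\<alpha> ^ k) * expected_cost \<pi> x k) + ennreal (\<alpha> ^ n) * (g + ?e n)"
      by (intro add_left_mono mult_left_mono step) simp
    also have "\<dots> = (\<Sum>k<n. ennreal (\<alpha> ^ k) * expected_cost \<pi> x k) + ennreal (\<alpha> ^ n) * ?e n + ennreal (\<alpha> ^ n) * g"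
      by (simp add: algebra_simps)
    also have "\<dots> \<le> (of_nat n * g + ?e 0) + 1 * g"
      using \<alpha> by (intro add_mono Suc mult_right_mono) (auto simp: power_le_one)
    also have "\<dots> = of_nat (Suc n) * g + ?e 0" by (simp add: algebra_simps)
    finally show ?case .
  qed simp
  moreover have "?e 0 = V x" by (rule nn_integral_P_initial_state[OF V])
  ultimately show ?thesis by (auto intro: order_trans[rotated])
qed

end

end

section \<open>Discounted relative values and the limit of the gains\<close>

context bounded_below_mdp
begin

lemma discounted_value_ge:
  assumes "0 \<le> \<alpha>" "\<alpha> < 1" "x \<in> X"
  shows "enn2ereal (optimal_value \<alpha> x) - ereal (R / (1 - \<alpha>)) \<le> discounted_value M \<alpha> x"
  unfolding discounted_value_def
proof (rule INF_greatest)
  fix \<pi> assume "\<pi> \<in> policies M"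
  then show "enn2ereal (optimal_value \<alpha> x) - ereal (R / (1 - \<alpha>)) \<le> discounted_cost M \<alpha> \<pi> x"
    using optimal_value_le_discounted_cost[of \<pi> x \<alpha>] assms
    by (subst discounted_cost_eq) (auto intro!: ereal_minus_mono simp: less_eq_ennreal.rep_eq)
qed

text \<open>
  Along the selected minimisers the optimality equation holds with equality, and the terminal term in
  the iterated equation is nonnegative; dropping it bounds the discounted cost by \<open>optimal_value\<close>.
\<close>

lemma optimal_stationary_policy:
  assumes \<alpha>: "0 \<le> \<alpha>" "\<alpha> < 1" and fin: "\<And>y. y \<in> X \<Longrightarrow> optimal_value \<alpha> y < top"
  obtains \<phi> where "\<phi> \<in> stationary_maps M"
    "\<And>x. x \<in> X \<Longrightarrow>
      (\<Sum>k. ennreal (\<alpha> ^ k) * expected_cost (stationary_policy M \<phi>) x k) \<le> optimal_value \<alpha> x"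
proof -
  obtain \<phi> where phi: "\<phi> \<in> restrict_space borel X \<rightarrow>\<^sub>M restrict_space borel A"
    and min: "\<And>x. x \<in> X \<Longrightarrow> bellman_value \<alpha> (optimal_value \<alpha>) (x, \<phi> x) =
      (INF a\<in>A. bellman_value \<alpha> (optimal_value \<alpha>) (x, a))"
  proof (rule lsc_minimiser_selection[of X A "bellman_value \<alpha> (optimal_value \<alpha>)"])
    show "lsc_on (X \<times> A) (bellman_value \<alpha> (optimal_value \<alpha>))"
      by (rule lsc_on_bellman_value[OF lsc_on_optimal_value])
    show "action_compact X A (bellman_value \<alpha> (optimal_value \<alpha>))"
      by (rule action_compact_bellman_value)
    show "(INF a\<in>A. bellman_value \<alpha> (optimal_value \<alpha>) (x, a)) < top" if "x \<in> X" for x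
      using fin[OF that] optimality_equation[OF \<alpha>(1) that] by simp
  qed (rule that)
  have sm: "\<phi> \<in> stationary_maps M"
    using phi by (simp add: stationary_maps_def state_space_def action_space_def)
  show thesis
  proof (rule that[OF sm])
    fix x assume x: "x \<in> X"
    have "(\<Sum>k<n. ennreal (\<alpha> ^ k) * expected_cost (stationary_policy M \<phi>) x k) \<le> of_nat n * 0 + optimal_value \<alpha> x" for n
    proof (rule stationary_cost_upper_bound[OF stationary_policy_in_policies[OF mdp sm] x refl sm])
      show "optimal_value \<alpha> \<in> borel_measurable (state_space M)"
        by (rule measurable_state[OF lsc_on_optimal_value])
      show "bellman_value \<alpha> (optimal_value \<alpha>) (y, \<phi> y) \<le> 0 + optimal_value \<alpha> y" if "y \<in> X" for y
        using min[OF that] optimality_equation[OF \<alpha>(1) that] by simp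
    qed (use \<alpha> in auto)
    then show "(\<Sum>k. ennreal (\<alpha> ^ k) * expected_cost (stationary_policy M \<phi>) x k) \<le> optimal_value \<alpha> x"
      unfolding suminf_eq_SUP by (intro SUP_least) simp
  qed
qed

end

locale average_cost_mdp = bounded_below_mdp M R
  for M :: "('x::polish_space, 'a::polish_space) mdp" and R :: real +
  assumes B: "assumption_B M"
begin

lemma states_nonempty: "X \<noteq> {}"
  using B by (auto simp: assumption_B_def top_ereal_def)

text \<open>
  The relative value is a difference, and \<open>\<infinity> - m = \<infinity>\<close> for every extended real \<open>m\<close>, even for \<open>m = \<infinity>\<close>; so a
  finite relative value forces a finite value.
\<close>

lemma discounted_value_finite:
  assumes "0 \<le> \<alpha>" "\<alpha> < 1" "x \<in> X"
  shows "discounted_value M \<alpha> x < \<infinity>"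
proof -
  have "disc_relative_value M \<alpha> x \<le> (SUP \<alpha>\<in>{0..<1}. disc_relative_value M \<alpha> x)"
    using assms by (intro SUP_upper) auto
  also have "\<dots> < \<infinity>" using B assms(3) by (auto simp: assumption_B_def)
  finally have "disc_relative_value M \<alpha> x < \<infinity>" .
  then show ?thesis unfolding disc_relative_value_def
    by (cases "discounted_value M \<alpha> x"; cases "min_discounted M \<alpha>") auto
qed

lemma optimal_value_finite:
  assumes "0 \<le> \<alpha>" "\<alpha> < 1" "x \<in> X"
  shows "optimal_value \<alpha> x < top"
  using discounted_value_ge[OF assms] discounted_value_finite[OF assms]
  by (cases "optimal_value \<alpha> x") auto

lemma discounted_value_eq:
  assumes \<alpha>: "0 \<le> \<alpha>" "\<alpha> < 1" and x: "x \<in> X"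
  shows "discounted_value M \<alpha> x = enn2ereal (optimal_value \<alpha> x) - ereal (R / (1 - \<alpha>))"
proof (rule antisym)
  obtain \<phi> where phi: "\<phi> \<in> stationary_maps M"
    "\<And>x. x \<in> X \<Longrightarrow>
      (\<Sum>k. ennreal (\<alpha> ^ k) * expected_cost (stationary_policy M \<phi>) x k) \<le> optimal_value \<alpha> x"
    by (rule optimal_stationary_policy[OF \<alpha> optimal_value_finite[OF \<alpha>]]) (assumption, rule that)
  have pol: "stationary_policy M \<phi> \<in> policies M" by (rule stationary_policy_in_policies[OF mdp phi(1)])
  have "discounted_value M \<alpha> x \<le> discounted_cost M \<alpha> (stationary_policy M \<phi>) x"
    unfolding discounted_value_def by (rule INF_lower[OF pol])
  also have "\<dots> \<le> enn2ereal (optimal_value \<alpha> x) - ereal (R / (1 - \<alpha>))"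
    unfolding discounted_cost_eq[OF pol x \<alpha>] using phi(2)[OF x]
    by (intro ereal_minus_mono) (auto simp: less_eq_ennreal.rep_eq)
  finally show "discounted_value M \<alpha> x \<le> enn2ereal (optimal_value \<alpha> x) - ereal (R / (1 - \<alpha>))" .
qed (rule discounted_value_ge[OF assms])

definition min_value :: "real \<Rightarrow> ennreal" where
  "min_value \<alpha> = (INF x\<in>X. optimal_value \<alpha> x)"

definition relative_value :: "real \<Rightarrow> 'x \<Rightarrow> ennreal" where
  "relative_value \<alpha> x = optimal_value \<alpha> x - min_value \<alpha>"

text \<open>The normalised minimal discounted value, whose limit for \<open>\<alpha> \<rightarrow> 1\<close> is the optimal average cost plus \<open>R\<close>.\<close>

definition gain :: "real \<Rightarrow> ennreal" where
  "gain \<alpha> = ennreal (1 - \<alpha>) * min_value \<alpha>"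

lemma min_value_le: "x \<in> X \<Longrightarrow> min_value \<alpha> \<le> optimal_value \<alpha> x"
  unfolding min_value_def by (rule INF_lower)

lemma min_value_finite:
  assumes "0 \<le> \<alpha>" "\<alpha> < 1" shows "min_value \<alpha> < top"
proof -
  obtain x where "x \<in> X" using states_nonempty by auto
  then show ?thesis using min_value_le optimal_value_finite[OF assms] by (metis order_le_less_trans)
qed

lemma optimal_value_eq:
  assumes "x \<in> X" shows "optimal_value \<alpha> x = min_value \<alpha> + relative_value \<alpha> x"
  unfolding relative_value_def by (rule add_diff_inverse_ennreal[OF min_value_le[OF assms], symmetric])

lemma relative_value_finite:
  assumes "0 \<le> \<alpha>" "\<alpha> < 1" "x \<in> X" shows "relative_value \<alpha> x < top"
  using optimal_value_finite[OF assms] unfolding optimal_value_eq[OF assms(3)] by simp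

lemma relative_value_measurable: "relative_value \<alpha> \<in> borel_measurable (state_space M)"
  using measurable_state[OF lsc_on_optimal_value[of \<alpha>]] unfolding relative_value_def[abs_def] by measurable

lemma min_discounted_eq:
  assumes \<alpha>: "0 \<le> \<alpha>" "\<alpha> < 1"
  shows "min_discounted M \<alpha> = enn2ereal (min_value \<alpha>) - ereal (R / (1 - \<alpha>))"
proof -
  have "min_discounted M \<alpha> = (INF x\<in>X. enn2ereal (optimal_value \<alpha> x) + ereal (- (R / (1 - \<alpha>))))"
    unfolding min_discounted_def using discounted_value_eq[OF \<alpha>]
    by (intro INF_cong refl) (simp add: minus_ereal_def)
  also have "\<dots> = (INF x\<in>X. enn2ereal (optimal_value \<alpha> x)) + ereal (- (R / (1 - \<alpha>)))"
    using states_nonempty by (intro INF_ereal_add_left) auto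
  also have "(INF x\<in>X. enn2ereal (optimal_value \<alpha> x)) = enn2ereal (min_value \<alpha>)"
    by (simp add: min_value_def Inf_ennreal.rep_eq image_comp comp_def)
  finally show ?thesis by (simp add: minus_ereal_def)
qed

lemma disc_relative_value_eq:
  assumes \<alpha>: "0 \<le> \<alpha>" "\<alpha> < 1" and x: "x \<in> X"
  shows "disc_relative_value M \<alpha> x = enn2ereal (relative_value \<alpha> x)"
proof -
  obtain m where m: "min_value \<alpha> = ennreal m" "0 \<le> m"
    using min_value_finite[OF \<alpha>] by (cases "min_value \<alpha>") auto
  obtain u where u: "relative_value \<alpha> x = ennreal u" "0 \<le> u"
    using relative_value_finite[OF assms] by (cases "relative_value \<alpha> x") auto
  show ?thesis
    unfolding disc_relative_value_def discounted_value_eq[OF assms] min_discounted_eq[OF \<alpha>] optimal_value_eq[OF x]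
    using m u by (simp add: ennreal_plus[symmetric] del: ennreal_plus)
qed

lemma scaled_min_discounted_eq:
  assumes \<alpha>: "0 \<le> \<alpha>" "\<alpha> < 1"
  shows "ereal (1 - \<alpha>) * min_discounted M \<alpha> = enn2ereal (gain \<alpha>) - ereal R"
  using \<alpha> ereal_mult_minus_const[of "1 - \<alpha>" "min_value \<alpha>" "R / (1 - \<alpha>)"]
  by (simp add: min_discounted_eq gain_def)

lemma gain_le_discounted_cost:
  assumes "0 \<le> \<beta>" "\<beta> \<le> \<alpha>" "\<alpha> < 1" "\<pi> \<in> policies M" "x \<in> X"
  shows "gain \<beta> \<le> ennreal (1 - \<alpha>) * (\<Sum>k. ennreal (\<alpha> ^ k) * expected_cost \<pi> x k)"
  unfolding gain_def min_value_def by (rule min_optimal_value_le_discounted_cost[OF assms(4,5,1-3)])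

lemma gain_mono:
  assumes "0 \<le> \<beta>" "\<beta> \<le> \<alpha>" "\<alpha> < 1"
  shows "gain \<beta> \<le> gain \<alpha>"
proof -
  have \<alpha>: "0 \<le> \<alpha>" "\<alpha> < 1" using assms by auto
  obtain \<phi> where phi: "\<phi> \<in> stationary_maps M"
    "\<And>x. x \<in> X \<Longrightarrow>
      (\<Sum>k. ennreal (\<alpha> ^ k) * expected_cost (stationary_policy M \<phi>) x k) \<le> optimal_value \<alpha> x"
    by (rule optimal_stationary_policy[OF \<alpha> optimal_value_finite[OF \<alpha>]]) (assumption, rule that)
  have "gain \<beta> \<le> ennreal (1 - \<alpha>) * optimal_value \<alpha> x" if x: "x \<in> X" for x
  proof -
    have "gain \<beta> \<le> ennreal (1 - \<alpha>) * (\<Sum>k. ennreal (\<alpha> ^ k) * expected_cost (stationary_policy M \<phi>) x k)"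
      by (intro gain_le_discounted_cost assms stationary_policy_in_policies mdp phi(1) x)
    also have "\<dots> \<le> ennreal (1 - \<alpha>) * optimal_value \<alpha> x"
      by (intro mult_left_mono phi(2) x) simp
    finally show ?thesis .
  qed
  then have "gain \<beta> / ennreal (1 - \<alpha>) \<le> min_value \<alpha>"
    unfolding min_value_def using \<alpha>
    by (intro INF_greatest divide_le_posI_ennreal) (auto simp: mult.commute)
  then have "ennreal (1 - \<alpha>) * (gain \<beta> / ennreal (1 - \<alpha>)) \<le> gain \<alpha>"
    unfolding gain_def[of \<alpha>] by (rule mult_left_mono) simp
  moreover have "ennreal (1 - \<alpha>) * (gain \<beta> / ennreal (1 - \<alpha>)) = gain \<beta>"
    unfolding ennreal_times_divide mult.commute[of "ennreal (1 - \<alpha>)"]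
    using \<alpha> by (intro mult_divide_eq_ennreal) auto
  ultimately show ?thesis by simp
qed

definition limit_gain :: ennreal where
  "limit_gain = (SUP \<alpha>\<in>{0..<1}. gain \<alpha>)"

lemma gain_le_limit_gain: "0 \<le> \<alpha> \<Longrightarrow> \<alpha> < 1 \<Longrightarrow> gain \<alpha> \<le> limit_gain"
  unfolding limit_gain_def by (rule SUP_upper) simp

lemma gain_tendsto: "(gain \<longlongrightarrow> limit_gain) (at_left 1)"
proof (rule order_tendstoI)
  fix l assume "l < limit_gain"
  then obtain \<beta> where b: "0 \<le> \<beta>" "\<beta> < 1" "l < gain \<beta>" by (auto simp: limit_gain_def less_SUP_iff)
  have "\<forall>\<^sub>F \<alpha> in at_left 1. \<alpha> \<in> {\<beta><..<1}"
    using eventually_at_left_real[OF b(2)] .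
  then show "\<forall>\<^sub>F \<alpha> in at_left 1. l < gain \<alpha>"
  proof eventually_elim
    case (elim \<alpha>)
    then show ?case using gain_mono[of \<beta> \<alpha>] b by (auto intro: less_le_trans)
  qed
next
  fix l assume l: "limit_gain < l"
  have "\<forall>\<^sub>F \<alpha> in at_left 1. \<alpha> \<in> {0<..<1::real}"
    by (rule eventually_at_left_real) simp
  then show "\<forall>\<^sub>F \<alpha> in at_left 1. gain \<alpha> < l"
  proof eventually_elim
    case (elim \<alpha>)
    then show ?case using gain_le_limit_gain[of \<alpha>] l by (auto intro: le_less_trans)
  qed
qed

text \<open>By monotonicity the lower limit that defines the constant is a limit, and a supremum.\<close>

lemma acoe_constant_eq: "acoe_constant M = enn2ereal limit_gain - ereal R"
proof -
  have "((\<lambda>\<alpha>. enn2ereal (gain \<alpha>) - ereal R) \<longlongrightarrow> enn2ereal limit_gain - ereal R) (at_left 1)"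
    using gain_tendsto by (intro tendsto_diff_ereal_general tendsto_const) auto
  moreover have "\<forall>\<^sub>F \<alpha> in at_left 1. enn2ereal (gain \<alpha>) - ereal R = ereal (1 - \<alpha>) * min_discounted M \<alpha>"
    using eventually_at_left_real[OF zero_less_one] by (rule eventually_mono) (auto simp: scaled_min_discounted_eq)
  ultimately have "((\<lambda>\<alpha>. ereal (1 - \<alpha>) * min_discounted M \<alpha>) \<longlongrightarrow> enn2ereal limit_gain - ereal R) (at_left 1)"
    by (rule Lim_transform_eventually)
  then show ?thesis
    unfolding acoe_constant_def by (intro lim_imp_Liminf) auto
qed

lemma gain_sequence_tendsto:
  assumes "\<And>n. \<alpha> n < 1" "\<alpha> \<longlonglongrightarrow> 1"
  shows "(\<lambda>n. gain (\<alpha> n)) \<longlonglongrightarrow> limit_gain"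
proof (rule filterlim_compose[OF gain_tendsto])
  show "filterlim \<alpha> (at_left 1) sequentially"
    using assms(2) by (auto simp: filterlim_at assms(1) less_imp_neq[OF assms(1)] intro!: always_eventually)
qed

text \<open>
  The expected costs have partial sums of at most \<open>(L + R) N\<close> for large \<open>N\<close>, so the Abelian bound gives
  \<open>gain \<alpha> \<le> (1 - \<alpha>) C + L + R\<close> for every \<open>\<alpha> \<ge> \<beta>\<close>. Since \<open>gain \<beta> \<le> gain \<alpha>\<close>, the term with \<open>C\<close> disappears as \<open>\<alpha>\<close> tends to 1.
  The first conclusion guarantees that \<open>ennreal (L + R)\<close> does not truncate.
\<close>

lemma gain_le_of_average_cost_less:
  assumes pol: "\<pi> \<in> policies M" and x: "x \<in> X" and L: "average_cost M \<pi> x < ereal L"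
    and \<beta>: "0 \<le> \<beta>" "\<beta> < 1"
  shows "0 \<le> L + R" "gain \<beta> \<le> ennreal (L + R)"
proof -
  let ?E = "expected_cost \<pi> x"
  have "\<forall>\<^sub>F N in sequentially. ereal (1 / real N) * finite_horizon_cost M N 1 \<pi> x < ereal L"
    using L unfolding average_cost_def by (rule Limsup_lessD)
  then obtain N0 where N0: "\<And>N. N0 \<le> N \<Longrightarrow> ereal (1 / real N) * finite_horizon_cost M N 1 \<pi> x < ereal L"
    unfolding eventually_sequentially by blast
  have S: "(\<Sum>t<N. ?E t) < top \<and> enn2real (\<Sum>t<N. ?E t) \<le> (L + R) * real N" if N: "N0 \<le> N" "0 < N" for N
  proof -
    have *: "ereal (1 / real N) * (enn2ereal (\<Sum>t<N. ?E t) - ereal (real N * R)) < ereal L"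
      using N0[OF N(1)] unfolding finite_horizon_cost_eq[OF pol x] .
    then show ?thesis
    proof (cases "\<Sum>t<N. ?E t")
      case (real s)
      then have "(s - real N * R) / real N < L"
        using * by simp
      then show ?thesis using N(2) real by (simp add: pos_divide_less_eq algebra_simps)
    qed (use N(2) in simp)
  qed
  define e where "e t = enn2real (?E t)" for t
  have E: "?E t = ennreal (e t)" for t
  proof -
    have "?E t \<le> (\<Sum>t<Suc (max N0 t). ?E t)" by (rule member_le_sum) auto
    also have "\<dots> < top" using S[of "Suc (max N0 t)"] by simp
    finally show ?thesis by (simp add: e_def)
  qed
  have e0: "0 \<le> e t" for t by (simp add: e_def)
  have sumE: "(\<Sum>t<N. ?E t) = ennreal (\<Sum>t<N. e t)" for N by (simp add: E e0)
  have S': "(\<Sum>t<N. e t) \<le> (L + R) * real N" if N: "N0 \<le> N" "0 < N" for N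
    using S[OF N] e0 by (simp add: sumE sum_nonneg)
  have LR: "0 \<le> L + R"
  proof -
    have "0 \<le> (\<Sum>t<Suc N0. e t)" using e0 by (intro sum_nonneg) auto
    also have "\<dots> \<le> (L + R) * real (Suc N0)" by (rule S') simp_all
    finally have "0 \<le> (L + R) * real (Suc N0)" .
    then show ?thesis by (simp add: zero_le_mult_iff del: of_nat_Suc)
  qed
  then show "0 \<le> L + R" .
  define C where "C = (\<Sum>t<Suc N0. e t)"
  have C0: "0 \<le> C" unfolding C_def using e0 by (intro sum_nonneg) auto
  have C: "(\<Sum>t<n. e t) \<le> C + (L + R) * real n" for n
  proof (cases "Suc N0 \<le> n")
    case True then show ?thesis using S'[of n] C0 by simp
  next
    case False
    then have "(\<Sum>t<n. e t) \<le> C" unfolding C_def using e0 by (intro sum_mono2) auto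
    then show ?thesis using LR by (simp add: add_increasing2)
  qed
  have bound: "gain \<beta> \<le> ennreal ((1 - \<alpha>) * C + (L + R))" if \<alpha>: "\<beta> \<le> \<alpha>" "\<alpha> < 1" for \<alpha>
  proof -
    have \<alpha>0: "0 \<le> \<alpha>" using \<alpha> \<beta> by simp
    have "(\<Sum>k. ennreal (\<alpha> ^ k) * ?E k) \<le> ennreal (C + (L + R) / (1 - \<alpha>))"
      unfolding suminf_eq_SUP
    proof (rule SUP_least)
      fix n
      have "(\<Sum>k<n. ennreal (\<alpha> ^ k) * ?E k) = ennreal (\<Sum>k<n. \<alpha> ^ k * e k)"
        using \<alpha>0 e0 by (simp add: E ennreal_mult[symmetric])
      also have "\<dots> \<le> ennreal (C + (L + R) / (1 - \<alpha>))"
        by (intro ennreal_leI abel_sum_upper_bound e0 C \<alpha>0 \<alpha> LR)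
      finally show "(\<Sum>k<n. ennreal (\<alpha> ^ k) * ?E k) \<le> ennreal (C + (L + R) / (1 - \<alpha>))" .
    qed
    then have "ennreal (1 - \<alpha>) * (\<Sum>k. ennreal (\<alpha> ^ k) * ?E k) \<le> ennreal (1 - \<alpha>) * ennreal (C + (L + R) / (1 - \<alpha>))"
      by (rule mult_left_mono) simp
    also have "\<dots> = ennreal ((1 - \<alpha>) * C + (L + R))"
    proof -
      have "(1 - \<alpha>) * (C + (L + R) / (1 - \<alpha>)) = (1 - \<alpha>) * C + (L + R)"
        using \<alpha> by (subst distrib_left) simp
      then show ?thesis using \<alpha> LR C0 by (subst ennreal_mult[symmetric]) simp_all
    qed
    finally show ?thesis using gain_le_discounted_cost[OF \<beta>(1) \<alpha> pol x] by simp
  qed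
  obtain g where g: "gain \<beta> = ennreal g" "0 \<le> g"
    using bound[of \<beta>] \<beta> by (cases "gain \<beta>") (auto simp: top_unique)
  have "g \<le> L + R"
  proof (rule field_le_epsilon)
    fix \<epsilon> :: real assume \<epsilon>: "0 < \<epsilon>"
    \<comment> \<open>A discount factor in \<open>[\<beta>, 1)\<close> with \<open>(1 - \<alpha>) C \<le> \<epsilon>\<close>; dividing by \<open>C + 1\<close> covers \<open>C = 0\<close>.\<close>
    let ?\<alpha> = "max \<beta> (1 - \<epsilon> / (C + 1))"
    have "?\<alpha> < 1" using \<beta> \<epsilon> C0 by simp
    then have "ennreal g \<le> ennreal ((1 - ?\<alpha>) * C + (L + R))"
      unfolding g(1)[symmetric] by (intro bound) simp_all
    moreover have "0 \<le> (1 - ?\<alpha>) * C + (L + R)"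
      using \<open>?\<alpha> < 1\<close> by (intro add_nonneg_nonneg[OF _ LR] mult_nonneg_nonneg C0) simp
    ultimately have "g \<le> (1 - ?\<alpha>) * C + (L + R)"
      by (simp only: ennreal_le_iff)
    moreover have "(1 - ?\<alpha>) * C \<le> \<epsilon> / (C + 1) * (C + 1)"
      using \<epsilon> C0 \<open>?\<alpha> < 1\<close> by (intro mult_mono) auto
    ultimately show "g \<le> L + R + \<epsilon>" using C0 by simp
  qed
  then show "gain \<beta> \<le> ennreal (L + R)" using g by (simp add: ennreal_leI)
qed

lemma acoe_constant_le_average_cost:
  assumes pol: "\<pi> \<in> policies M" and x: "x \<in> X"
  shows "acoe_constant M \<le> average_cost M \<pi> x"
proof (rule ccontr)
  assume "\<not> ?thesis"
  then have "average_cost M \<pi> x < acoe_constant M" by simp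
  then obtain L where L: "average_cost M \<pi> x < ereal L" "ereal L < acoe_constant M"
    using ereal_dense2 by blast
  note bound = gain_le_of_average_cost_less[OF pol x L(1)]
  have "limit_gain \<le> ennreal (L + R)"
    unfolding limit_gain_def by (intro SUP_least bound(2)) auto
  then have "enn2ereal limit_gain \<le> ereal (L + R)"
    using bound(1)[of 0] by (simp add: less_eq_ennreal.rep_eq)
  then have "acoe_constant M \<le> ereal L"
    unfolding acoe_constant_eq by (cases "enn2ereal limit_gain") auto
  with L(2) show False by simp
qed

lemma limit_gain_finite: "limit_gain < top"
proof -
  obtain x where x: "x \<in> X" "average_value M x < \<infinity>"
    using B unfolding assumption_B_def INF_less_iff by blast
  then obtain \<pi> where pi: "\<pi> \<in> policies M" "average_cost M \<pi> x < \<infinity>"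
    unfolding average_value_def INF_less_iff by blast
  then have "acoe_constant M < \<infinity>"
    using acoe_constant_le_average_cost[OF pi(1) x(1)] by (auto intro: le_less_trans)
  then show ?thesis unfolding acoe_constant_eq by (cases limit_gain) auto
qed

text \<open>
  Splitting \<open>optimal_value\<close> into its minimum and the relative value turns the discounted optimality equation into one
  whose constant is the gain: of the minimum on the left, the share \<open>\<alpha>\<close> cancels against the right-hand side.
\<close>

lemma relative_optimality_equation:
  assumes \<alpha>: "0 \<le> \<alpha>" "\<alpha> < 1" and x: "x \<in> X"
  shows "a \<in> A \<Longrightarrow> gain \<alpha> + relative_value \<alpha> x \<le> bellman_value \<alpha> (relative_value \<alpha>) (x, a)"
    and "\<exists>a\<in>A. bellman_value \<alpha> (relative_value \<alpha>) (x, a) = gain \<alpha> + relative_value \<alpha> x"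
proof -
  let ?c = "ennreal \<alpha> * min_value \<alpha>"
  have fin: "?c \<noteq> top" using min_value_finite[OF \<alpha>] by (simp add: ennreal_mult_eq_top_iff)
  have split_bellman: "bellman_value \<alpha> (optimal_value \<alpha>) (x, a) = ?c + bellman_value \<alpha> (relative_value \<alpha>) (x, a)"
    if a: "a \<in> A" for a
  proof -
    have z: "(x, a) \<in> X \<times> A" using x a by simp
    interpret prob_space "trans_prob M (x, a)" by (rule trans_prob_kernel(1)[OF z])
    have [measurable]: "relative_value \<alpha> \<in> borel_measurable (trans_prob M (x, a))"
      using relative_value_measurable by (simp add: measurable_cong_sets[OF trans_prob_kernel(2)[OF z] refl])
    have "(\<integral>\<^sup>+ y. optimal_value \<alpha> y \<partial>trans_prob M (x, a)) =
        (\<integral>\<^sup>+ y. min_value \<alpha> + relative_value \<alpha> y \<partial>trans_prob M (x, a))"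
      by (intro nn_integral_cong optimal_value_eq) (simp add: trans_prob_kernel(3)[OF z])
    also have "\<dots> = min_value \<alpha> + (\<integral>\<^sup>+ y. relative_value \<alpha> y \<partial>trans_prob M (x, a))"
      by (subst nn_integral_add) (simp_all add: emeasure_space_1)
    finally show ?thesis by (simp add: bellman_value_def algebra_simps)
  qed
  have "min_value \<alpha> = gain \<alpha> + ?c"
    using \<alpha> by (simp add: gain_def distrib_right[symmetric] ennreal_plus[symmetric] del: ennreal_plus)
  then have opt: "optimal_value \<alpha> x = ?c + (gain \<alpha> + relative_value \<alpha> x)"
    using optimal_value_eq[OF x, of \<alpha>] by (simp add: ac_simps)
  show "gain \<alpha> + relative_value \<alpha> x \<le> bellman_value \<alpha> (relative_value \<alpha>) (x, a)" if a: "a \<in> A"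
  proof -
    have "optimal_value \<alpha> x \<le> bellman_value \<alpha> (optimal_value \<alpha>) (x, a)"
      unfolding optimality_equation[OF \<alpha>(1) x] by (rule INF_lower[OF a])
    then show ?thesis
      unfolding opt split_bellman[OF a] using fin by (simp add: ennreal_add_left_cancel_le)
  qed
  obtain a where a: "a \<in> A" "bellman_value \<alpha> (optimal_value \<alpha>) (x, a) =
      (INF a\<in>A. bellman_value \<alpha> (optimal_value \<alpha>) (x, a))"
  proof (rule lsc_minimum_attained[of X A "bellman_value \<alpha> (optimal_value \<alpha>)" x])
    show "(INF a\<in>A. bellman_value \<alpha> (optimal_value \<alpha>) (x, a)) < top"
      using optimal_value_finite[OF assms] optimality_equation[OF \<alpha>(1) x] by simp
  qed (use x in \<open>simp_all add: lsc_on_bellman_value lsc_on_optimal_value action_compact_bellman_value\<close>)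
  have "?c + bellman_value \<alpha> (relative_value \<alpha>) (x, a) = bellman_value \<alpha> (optimal_value \<alpha>) (x, a)"
    by (rule split_bellman[OF a(1), symmetric])
  also have "\<dots> = optimal_value \<alpha> x" unfolding a(2) by (rule optimality_equation[OF \<alpha>(1) x, symmetric])
  also note opt
  finally have "bellman_value \<alpha> (relative_value \<alpha>) (x, a) = gain \<alpha> + relative_value \<alpha> x"
    using fin by (simp only: ennreal_add_left_cancel infinity_ennreal_def) simp
  with a(1) show "\<exists>a\<in>A. bellman_value \<alpha> (relative_value \<alpha>) (x, a) = gain \<alpha> + relative_value \<alpha> x" by blast
qed

end

section \<open>The average-cost optimality equation\<close>

context average_cost_mdp
begin

text \<open>The infimum in the optimality equation is finite at every state, so it cannot be taken over an empty set.\<close>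

lemma actions_nonempty: "A \<noteq> {}"
proof -
  obtain x where x: "x \<in> X" using states_nonempty by auto
  obtain a where "a \<in> A" using relative_optimality_equation(2)[OF order_refl zero_less_one x] by blast
  then show ?thesis by blast
qed

lemma bellman_value_cong:
  assumes "z \<in> X \<times> A" "\<And>y. y \<in> X \<Longrightarrow> V y = W y"
  shows "bellman_value \<alpha> V z = bellman_value \<alpha> W z"
proof -
  have "(\<integral>\<^sup>+ y. V y \<partial>trans_prob M z) = (\<integral>\<^sup>+ y. W y \<partial>trans_prob M z)"
    by (rule nn_integral_cong) (simp add: trans_prob_kernel(3)[OF assms(1)] assms(2))
  then show ?thesis by (simp add: bellman_value_def)
qed

context
  fixes \<beta> :: "nat \<Rightarrow> real" and l :: "'x \<Rightarrow> real"
  assumes \<beta>: "\<And>n. 0 \<le> \<beta> n" "\<And>n. \<beta> n < 1" "incseq \<beta>" "\<beta> \<longlonglongrightarrow> 1"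
    and equi: "\<And>x e. x \<in> X \<Longrightarrow> 0 < e \<Longrightarrow> \<exists>G. openin (top_of_set X) G \<and> x \<in> G \<and>
      (\<forall>y\<in>G. \<forall>n. \<bar>enn2real (relative_value (\<beta> n) y) - enn2real (relative_value (\<beta> n) x)\<bar> < e)"
    and conv: "\<And>x. x \<in> X \<Longrightarrow> (\<lambda>n. enn2real (relative_value (\<beta> n) x)) \<longlonglongrightarrow> l x"
begin

abbreviation "tail_INF N y \<equiv> INF n\<in>{N..}. ennreal (enn2real (relative_value (\<beta> n) y))"

lemma relative_value_real: "x \<in> X \<Longrightarrow> ennreal (enn2real (relative_value (\<beta> n) x)) = relative_value (\<beta> n) x"
  using relative_value_finite[OF \<beta>(1,2)] by simp

lemma relative_value_tendsto: "x \<in> X \<Longrightarrow> (\<lambda>n. relative_value (\<beta> n) x) \<longlonglongrightarrow> ennreal (l x)"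
  using tendsto_ennrealI[OF conv] by (simp add: relative_value_real)

lemma lsc_on_tail_INF: "lsc_on X (tail_INF N)"
  by (rule equicontinuous_lsc_tail_INF[OF equi]) simp_all

lemma SUP_tail_INF:
  assumes "x \<in> X" shows "(SUP N. tail_INF N x) = ennreal (l x)"
  using lim_imp_Liminf[OF sequentially_bot tendsto_ennrealI[OF conv[OF assms]]]
  by (simp add: liminf_SUP_INF)

lemma lsc_on_limit: "lsc_on X (\<lambda>x. ennreal (l x))"
proof -
  have "lsc_on X (\<lambda>x. SUP N. tail_INF N x)" by (intro lsc_on_SUP lsc_on_tail_INF)
  then show ?thesis by (simp add: lsc_on_def SUP_tail_INF)
qed

lemma limit_gain_plus_tendsto:
  "x \<in> X \<Longrightarrow> (\<lambda>n. gain (\<beta> n) + relative_value (\<beta> n) x) \<longlonglongrightarrow> limit_gain + ennreal (l x)"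
  by (intro tendsto_add gain_sequence_tendsto \<beta> relative_value_tendsto)

text \<open>
  For \<open>N \<le> k\<close> the Bellman value of the \<open>N\<close>-th tail infimum is at most that of the \<open>k\<close>-th relative value, whose minimum is
  \<open>gain + relative_value\<close>. Letting \<open>k\<close> and then \<open>N\<close> tend to infinity, with the interchange of minimum and increasing
  limit, gives a single action that works in the limit.
\<close>

lemma limit_optimality_attained:
  assumes x: "x \<in> X"
  shows "\<exists>a\<in>A. bellman_value 1 (\<lambda>y. ennreal (l y)) (x, a) \<le> limit_gain + ennreal (l x)"
proof -
  let ?F = "\<lambda>N. bellman_value (\<beta> N) (tail_INF N)"
  have le: "(INF a\<in>A. ?F N (x, a)) \<le> limit_gain + ennreal (l x)" for N
  proof (rule LIMSEQ_le_const[OF limit_gain_plus_tendsto[OF x]])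
    have "(INF a\<in>A. ?F N (x, a)) \<le> gain (\<beta> k) + relative_value (\<beta> k) x" if k: "N \<le> k" for k
    proof -
      obtain a where a: "a \<in> A" "bellman_value (\<beta> k) (relative_value (\<beta> k)) (x, a) = gain (\<beta> k) + relative_value (\<beta> k) x"
        using relative_optimality_equation(2)[OF \<beta>(1,2) x] by blast
      have "(INF a\<in>A. ?F N (x, a)) \<le> ?F N (x, a)" by (rule INF_lower[OF a(1)])
      also have "\<dots> \<le> bellman_value (\<beta> k) (relative_value (\<beta> k)) (x, a)"
      proof (rule bellman_value_mono)
        show "\<beta> N \<le> \<beta> k" using \<beta>(3) k by (simp add: incseq_def)
        show "tail_INF N y \<le> relative_value (\<beta> k) y" if "y \<in> X" for y
          using k that by (intro INF_lower2[of k]) (simp_all add: relative_value_real)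
      qed (use x a \<beta> in auto)
      finally show ?thesis unfolding a(2) .
    qed
    then show "\<exists>n0. \<forall>k\<ge>n0. (INF a\<in>A. ?F N (x, a)) \<le> gain (\<beta> k) + relative_value (\<beta> k) x" by blast
  qed
  have tail_mono: "tail_INF m y \<le> tail_INF n y" if "m \<le> n" for m n y
    using that by (intro INF_superset_mono) auto
  obtain a where a: "a \<in> A" "\<And>N. ?F N (x, a) \<le> limit_gain + ennreal (l x)"
  proof (rule increasing_lsc_minimiser[of X A ?F x "limit_gain + ennreal (l x)"])
    show "lsc_on (X \<times> A) (?F n)" for n by (rule lsc_on_bellman_value[OF lsc_on_tail_INF])
    show "action_compact X A (?F 0)" by (rule action_compact_bellman_value)
    show "?F m (x, a) \<le> ?F n (x, a)" if "a \<in> A" "m \<le> n" for m n a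
      using that x \<beta> by (intro bellman_value_mono tail_mono) (auto simp: incseq_def)
    show "limit_gain + ennreal (l x) < top" using limit_gain_finite by (simp add: ennreal_add_less_top)
  qed (use x le in \<open>auto\<close>)
  have z: "(x, a) \<in> X \<times> A" using x a(1) by simp
  have "bellman_value 1 (\<lambda>y. ennreal (l y)) (x, a) = bellman_value 1 (\<lambda>y. SUP N. tail_INF N y) (x, a)"
    using SUP_tail_INF by (intro bellman_value_cong[OF z]) simp
  also have "\<dots> = (SUP N. ?F N (x, a))"
    by (rule bellman_value_SUP[OF z lsc_on_tail_INF \<beta>(3,1,4) tail_mono])
  also have "\<dots> \<le> limit_gain + ennreal (l x)" by (intro SUP_least a(2))
  finally show ?thesis using a(1) by blast
qed

text \<open>For a fixed action the discounted equations pass to the limit by dominated convergence.\<close>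

lemma limit_optimality_lower:
  fixes U :: "'x \<Rightarrow> real"
  assumes U: "U \<in> borel_measurable (state_space M)"
    and dom: "\<And>n y. y \<in> X \<Longrightarrow> relative_value (\<beta> n) y \<le> ennreal (U y)"
    and z: "x \<in> X" "a \<in> A" and int: "(\<integral>\<^sup>+ y. ennreal (U y) \<partial>trans_prob M (x, a)) < \<infinity>"
  shows "limit_gain + ennreal (l x) \<le> bellman_value 1 (\<lambda>y. ennreal (l y)) (x, a)"
proof (rule LIMSEQ_le)
  have za: "(x, a) \<in> X \<times> A" using z by simp
  note tk = trans_prob_kernel[OF za]
  show "(\<lambda>n. gain (\<beta> n) + relative_value (\<beta> n) x) \<longlonglongrightarrow> limit_gain + ennreal (l x)"
    by (rule limit_gain_plus_tendsto[OF z(1)])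
  show "\<exists>N. \<forall>n\<ge>N. gain (\<beta> n) + relative_value (\<beta> n) x \<le> bellman_value (\<beta> n) (relative_value (\<beta> n)) (x, a)"
    using relative_optimality_equation(1)[OF \<beta>(1,2) z] by blast
  have I: "(\<lambda>n. \<integral>\<^sup>+ y. relative_value (\<beta> n) y \<partial>trans_prob M (x, a)) \<longlonglongrightarrow>
      (\<integral>\<^sup>+ y. ennreal (l y) \<partial>trans_prob M (x, a))"
  proof (rule nn_integral_dominated_convergence[where w="\<lambda>y. ennreal (U y)"])
    show "relative_value (\<beta> n) \<in> borel_measurable (trans_prob M (x, a))" for n
      using relative_value_measurable by (simp add: measurable_cong_sets[OF tk(2) refl])
    show "(\<lambda>y. ennreal (l y)) \<in> borel_measurable (trans_prob M (x, a))"
      using measurable_state[OF lsc_on_limit] by (simp add: measurable_cong_sets[OF tk(2) refl])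
    show "(\<lambda>y. ennreal (U y)) \<in> borel_measurable (trans_prob M (x, a))"
      using U by (simp add: measurable_cong_sets[OF tk(2) refl])
    show "AE y in trans_prob M (x, a). relative_value (\<beta> n) y \<le> ennreal (U y)" for n
      by (rule AE_I2) (simp add: tk dom)
    show "AE y in trans_prob M (x, a). (\<lambda>n. relative_value (\<beta> n) y) \<longlonglongrightarrow> ennreal (l y)"
      by (rule AE_I2) (simp add: tk relative_value_tendsto)
    show "(\<integral>\<^sup>+ y. ennreal (U y) \<partial>trans_prob M (x, a)) < \<infinity>" by (rule int)
  qed
  have "(\<integral>\<^sup>+ y. ennreal (l y) \<partial>trans_prob M (x, a)) \<le> (\<integral>\<^sup>+ y. ennreal (U y) \<partial>trans_prob M (x, a))"
  proof (rule nn_integral_mono)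
    fix y assume "y \<in> space (trans_prob M (x, a))"
    then have y: "y \<in> X" by (simp add: tk)
    show "ennreal (l y) \<le> ennreal (U y)"
      by (rule LIMSEQ_le_const2[OF relative_value_tendsto[OF y]]) (use dom[OF y] in blast)
  qed
  then have "(\<integral>\<^sup>+ y. ennreal (l y) \<partial>trans_prob M (x, a)) \<noteq> top" using int by (auto simp: top_unique)
  then have "(\<lambda>n. ennreal (\<beta> n) * (\<integral>\<^sup>+ y. relative_value (\<beta> n) y \<partial>trans_prob M (x, a))) \<longlonglongrightarrow>
      ennreal 1 * (\<integral>\<^sup>+ y. ennreal (l y) \<partial>trans_prob M (x, a))"
    by (intro tendsto_mult_ennreal tendsto_ennrealI \<beta>(4) I) auto
  then show "(\<lambda>n. bellman_value (\<beta> n) (relative_value (\<beta> n)) (x, a)) \<longlonglongrightarrow> bellman_value 1 (\<lambda>y. ennreal (l y)) (x, a)"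
    unfolding bellman_value_def by (intro tendsto_add tendsto_const)
qed

end

lemma acoe_rhs_eq:
  assumes u: "\<And>y. y \<in> X \<Longrightarrow> u y = enn2ereal (v y)" and z: "x \<in> X" "a \<in> A"
  shows "acoe_rhs M u x a = enn2ereal (bellman_value 1 v (x, a)) - ereal R"
proof -
  have za: "(x, a) \<in> X \<times> A" using z by simp
  have "eintegral (trans_prob M (x, a)) u = eintegral (trans_prob M (x, a)) (\<lambda>y. enn2ereal (v y))"
    by (rule eintegral_cong) (simp add: trans_prob_kernel(3)[OF za] u)
  also have "\<dots> = enn2ereal (\<integral>\<^sup>+ y. v y \<partial>trans_prob M (x, a))" by (rule eintegral_enn2ereal)
  finally have "acoe_rhs M u x a =
      (enn2ereal (shifted_cost (x, a)) - ereal R) + (enn2ereal (\<integral>\<^sup>+ y. v y \<partial>trans_prob M (x, a)) - ereal 0)"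
    unfolding acoe_rhs_def cost_eq[OF za] by (simp add: zero_ereal_def[symmetric])
  also have "\<dots> = enn2ereal (bellman_value 1 v (x, a)) - ereal R"
    unfolding ereal_plus_minus_const by (simp add: bellman_value_def)
  finally show ?thesis .
qed

lemma enn2ereal_minus_eq_iff: "enn2ereal a - ereal r = enn2ereal b - ereal r \<longleftrightarrow> a = b"
  by (cases a; cases b) auto

text \<open>
  In both members of the equation the shift of the cost appears as the same constant \<open>- R\<close>, so the equation can be
  read in \<open>[0, \<infinity>]\<close>.
\<close>

lemma satisfies_acoe_iff:
  assumes u: "\<And>y. y \<in> X \<Longrightarrow> u y = enn2ereal (v y)"
  shows "satisfies_acoe M u \<phi> \<longleftrightarrow> \<phi> \<in> stationary_maps M \<and>
    (\<forall>x\<in>X. bellman_value 1 v (x, \<phi> x) = limit_gain + v x \<and>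
      bellman_value 1 v (x, \<phi> x) = (INF a\<in>A. bellman_value 1 v (x, a)))"
proof -
  have "(acoe_constant M + u x = acoe_rhs M u x (\<phi> x) \<and>
        acoe_rhs M u x (\<phi> x) = (INF a\<in>A. acoe_rhs M u x a)) \<longleftrightarrow>
      (bellman_value 1 v (x, \<phi> x) = limit_gain + v x \<and>
        bellman_value 1 v (x, \<phi> x) = (INF a\<in>A. bellman_value 1 v (x, a)))"
    if phi: "\<phi> \<in> stationary_maps M" and x: "x \<in> X" for x
  proof -
    have a: "\<phi> x \<in> A" using measurable_space[of \<phi> "state_space M" "action_space M" x] phi x
      by (simp add: stationary_maps_def)
    have rhs: "acoe_rhs M u x (\<phi> x) = enn2ereal (bellman_value 1 v (x, \<phi> x)) - ereal R"
      by (intro acoe_rhs_eq[where v=v] u x a)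
    have lhs: "acoe_constant M + u x = enn2ereal (limit_gain + v x) - ereal R"
      using ereal_plus_minus_const[of limit_gain R "v x" 0]
      by (simp add: acoe_constant_eq u[OF x] zero_ereal_def[symmetric])
    have "(INF a\<in>A. acoe_rhs M u x a) = (INF a\<in>A. enn2ereal (bellman_value 1 v (x, a)) + ereal (- R))"
    proof (rule INF_cong[OF refl])
      fix a assume "a \<in> A"
      then have "acoe_rhs M u x a = enn2ereal (bellman_value 1 v (x, a)) - ereal R"
        by (intro acoe_rhs_eq[where v=v] u x)
      then show "acoe_rhs M u x a = enn2ereal (bellman_value 1 v (x, a)) + ereal (- R)"
        by (simp add: minus_ereal_def)
    qed
    also have "\<dots> = (INF a\<in>A. enn2ereal (bellman_value 1 v (x, a))) + ereal (- R)"
      using actions_nonempty by (intro INF_ereal_add_left) auto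
    also have "(INF a\<in>A. enn2ereal (bellman_value 1 v (x, a))) = enn2ereal (INF a\<in>A. bellman_value 1 v (x, a))"
      by (simp add: Inf_ennreal.rep_eq image_comp comp_def)
    finally have inf: "(INF a\<in>A. acoe_rhs M u x a) = enn2ereal (INF a\<in>A. bellman_value 1 v (x, a)) - ereal R"
      by (simp add: minus_ereal_def)
    show ?thesis
      unfolding lhs inf rhs enn2ereal_minus_eq_iff
      by (rule conj_cong[OF eq_commute refl])
  qed
  then show ?thesis unfolding satisfies_acoe_def by blast
qed

text \<open>The \<open>N\<close>-stage cost is at most \<open>N * limit_gain + v x - N * R\<close>, and \<open>v x / N\<close> tends to zero.\<close>

lemma average_cost_le_limit_gain:
  assumes phi: "\<phi> \<in> stationary_maps M" and v: "v \<in> borel_measurable (state_space M)"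
    and x: "x \<in> X" and fin: "v x < top"
    and le: "\<And>y. y \<in> X \<Longrightarrow> bellman_value 1 v (y, \<phi> y) \<le> limit_gain + v y"
  shows "average_cost M (stationary_policy M \<phi>) x \<le> enn2ereal limit_gain - ereal R"
proof -
  let ?p = "stationary_policy M \<phi>"
  have pol: "?p \<in> policies M" by (rule stationary_policy_in_policies[OF mdp phi])
  obtain g where g: "limit_gain = ennreal g" "0 \<le> g" using limit_gain_finite by (cases limit_gain) auto
  obtain w where w: "v x = ennreal w" "0 \<le> w" using fin by (cases "v x") auto
  have bound: "ereal (1 / real N) * finite_horizon_cost M N 1 ?p x \<le> ereal (g - R + w / real N)" if N: "0 < N" for N
  proof -
    have "(\<Sum>k<N. ennreal (1 ^ k) * expected_cost ?p x k) \<le> of_nat N * limit_gain + v x"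
      by (rule stationary_cost_upper_bound[OF pol x refl phi v _ _ le]) simp_all
    then have "(\<Sum>k<N. expected_cost ?p x k) \<le> ennreal (real N * g + w)"
      using g w by (simp add: ennreal_of_nat_eq_real_of_nat ennreal_mult[symmetric])
    then obtain s where s: "(\<Sum>k<N. expected_cost ?p x k) = ennreal s" "0 \<le> s" "s \<le> real N * g + w"
      using g(2) w(2) by (cases "\<Sum>k<N. expected_cost ?p x k") (auto simp: top_unique simp del: ennreal_plus)
    have "(s - real N * R) / real N \<le> g - R + w / real N"
      using s(3) N by (simp add: divide_simps algebra_simps)
    then show ?thesis
      unfolding finite_horizon_cost_eq[OF pol x] using s(1,2) by simp
  qed
  have "average_cost M ?p x \<le> limsup (\<lambda>N. ereal (g - R + w / real N))"
    unfolding average_cost_def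
    by (rule Limsup_mono) (use bound in \<open>auto simp: eventually_sequentially intro!: exI[of _ 1]\<close>)
  also have "\<dots> = ereal (g - R + 0)"
    by (intro lim_imp_Limsup tendsto_ereal tendsto_add tendsto_const lim_const_over_n sequentially_bot)
  finally show ?thesis using g by simp
qed

text \<open>
  The optimality equation bounds the average cost of the policy by the constant, and the Abelian inequality bounds
  the constant by the average cost of every policy.
\<close>

lemma acoe_policy_optimal:
  assumes phi: "\<phi> \<in> stationary_maps M" and v: "v \<in> borel_measurable (state_space M)"
    and fin: "\<And>x. x \<in> X \<Longrightarrow> v x < top"
    and le: "\<And>y. y \<in> X \<Longrightarrow> bellman_value 1 v (y, \<phi> y) \<le> limit_gain + v y"
  shows "average_cost_optimal M (stationary_policy M \<phi>)"
  unfolding average_cost_optimal_def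
proof (intro conjI ballI)
  show pol: "stationary_policy M \<phi> \<in> policies M" by (rule stationary_policy_in_policies[OF mdp phi])
  fix x assume x: "x \<in> X"
  show "average_cost M (stationary_policy M \<phi>) x = average_value M x"
  proof (rule antisym)
    have "average_cost M (stationary_policy M \<phi>) x \<le> acoe_constant M"
      unfolding acoe_constant_eq by (rule average_cost_le_limit_gain[OF phi v x fin[OF x] le])
    also have "\<dots> \<le> average_value M x"
      unfolding average_value_def by (intro INF_greatest acoe_constant_le_average_cost x)
    finally show "average_cost M (stationary_policy M \<phi>) x \<le> average_value M x" .
    show "average_value M x \<le> average_cost M (stationary_policy M \<phi>) x"
      unfolding average_value_def by (rule INF_lower[OF pol])
  qed
qed

end

theorem theorem3p2:
  fixes M :: "('x::polish_space, 'a::polish_space) mdp"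
    and \<alpha> :: "nat \<Rightarrow> real"
    and U :: "'x \<Rightarrow> real"
  assumes "is_mdp M"
    and "assumption_W M"
    and "assumption_B M"
    and "\<And>n. 0 \<le> \<alpha> n \<and> \<alpha> n < 1"
    and "incseq \<alpha>"
    and "\<alpha> \<longlonglongrightarrow> 1"
    and "equicontinuous_on (states M) (range (\<lambda>n. disc_relative_value M (\<alpha> n)))"
    and "U \<in> borel_measurable (state_space M)"
    and "\<And>x. x \<in> states M \<Longrightarrow> 0 \<le> U x"
    and "\<And>x n. x \<in> states M \<Longrightarrow> disc_relative_value M (\<alpha> n) x \<le> ereal (U x)"
    and "\<And>x a. x \<in> states M \<Longrightarrow> a \<in> actions M \<Longrightarrow>
           (\<integral>\<^sup>+ y. ennreal (U y) \<partial>trans_prob M (x, a)) < \<infinity>"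
  shows "\<exists>r :: nat \<Rightarrow> nat. strict_mono r \<and>
    (let u = avg_relative_value M (\<alpha> \<circ> r) in
       (\<forall>x\<in>states M. (\<lambda>k. disc_relative_value M (\<alpha> (r k)) x) \<longlonglongrightarrow> u x) \<and>
       (\<forall>x\<in>states M. 0 \<le> u x \<and> u x < \<infinity>) \<and>
       continuous_on (states M) u \<and>
       (\<exists>\<phi>. satisfies_acoe M u \<phi>) \<and>
       (\<forall>\<phi>. satisfies_acoe M u \<phi> \<longrightarrow> average_cost_optimal M (stationary_policy M \<phi>)))"
proof -
  obtain b :: real where b: "\<And>z. z \<in> states M \<times> actions M \<Longrightarrow> ereal b \<le> cost M z"
    using assms(2) by (auto simp: assumption_W_def)
  define R where "R = max 0 (- b)"
  interpret average_cost_mdp M R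
  proof unfold_locales
    fix z assume z: "z \<in> states M \<times> actions M"
    have "- R \<le> b" by (simp add: R_def)
    then have "- ereal R \<le> ereal b" by simp
    also have "\<dots> \<le> cost M z" by (rule b[OF z])
    finally show "- ereal R \<le> cost M z" .
  qed (use assms in \<open>auto simp: assumption_W_def R_def\<close>)
  define f where "f n x = enn2real (relative_value (\<alpha> n) x)" for n x
  have \<alpha>: "0 \<le> \<alpha> n" "\<alpha> n < 1" for n using assms(4) by auto
  have drv: "disc_relative_value M (\<alpha> n) x = ereal (f n x)" if "x \<in> X" for n x
    using relative_value_finite[OF \<alpha> that, of n]
    unfolding f_def disc_relative_value_eq[OF \<alpha> that] by (cases "relative_value (\<alpha> n) x") auto
  have f0: "0 \<le> f n x" for n x by (simp add: f_def)
  have equi: "\<exists>G. openin (top_of_set X) G \<and> x \<in> G \<and> (\<forall>y\<in>G. \<forall>n. \<bar>f n y - f n x\<bar> < e)"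
    if x: "x \<in> X" and e: "0 < e" for x e
  proof -
    obtain G where G: "openin (top_of_set X) G" "x \<in> G"
      "\<forall>y\<in>G. \<forall>h\<in>range (\<lambda>n. disc_relative_value M (\<alpha> n)). \<bar>h y - h x\<bar> < ereal e"
      using assms(7) x e unfolding equicontinuous_on_def by blast
    have "G \<subseteq> X" using openin_imp_subset[OF G(1)] .
    have "\<bar>f n y - f n x\<bar> < e" if y: "y \<in> G" for y n
    proof -
      have "\<bar>disc_relative_value M (\<alpha> n) y - disc_relative_value M (\<alpha> n) x\<bar> < ereal e"
        using G(3) y by blast
      then show ?thesis using drv[OF x] drv[of y] y \<open>G \<subseteq> X\<close> by auto
    qed
    with G(1,2) show ?thesis by blast
  qed
  have bound: "\<bar>f n x\<bar> \<le> U x" if "x \<in> X" for n x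
    using assms(10)[OF that, of n] f0[of n x] by (simp add: drv[OF that])
  obtain r l where r: "strict_mono r" and lim: "\<And>x. x \<in> X \<Longrightarrow> (\<lambda>k. f (r k) x) \<longlonglongrightarrow> l x"
    by (rule equicontinuous_subsequence[of X f U, OF equi bound]) (assumption+, rule that)
  have equi_r: "\<exists>G. openin (top_of_set X) G \<and> x \<in> G \<and> (\<forall>y\<in>G. \<forall>n. \<bar>f (r n) y - f (r n) x\<bar> < e)"
    if "x \<in> X" "0 < e" for x e
    using equi[OF that] by blast
  have l0: "0 \<le> l x" if "x \<in> X" for x
    by (rule LIMSEQ_le_const[OF lim[OF that]]) (use f0 in blast)
  define u where "u = avg_relative_value M (\<alpha> \<circ> r)"
  have u: "u x = ereal (l x)" if x: "x \<in> X" for x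
  proof -
    let ?F = "sequentially \<times>\<^sub>F inf (nhds x) (principal X)"
    have "((\<lambda>(n, y). f (r n) y) \<longlongrightarrow> l x) ?F"
      by (rule equicontinuous_joint_limit[OF equi_r[OF x] lim[OF x]])
    then have "((\<lambda>p. ereal (case p of (n, y) \<Rightarrow> f (r n) y)) \<longlongrightarrow> ereal (l x)) ?F"
      by (rule tendsto_ereal)
    moreover have "\<forall>\<^sub>F p in ?F. ereal (case p of (n, y) \<Rightarrow> f (r n) y) =
        (case p of (n, y) \<Rightarrow> disc_relative_value M ((\<alpha> \<circ> r) n) y)"
    proof -
      have "\<forall>\<^sub>F y in inf (nhds x) (principal X). y \<in> X" by (simp add: eventually_inf_principal)
      then have "\<forall>\<^sub>F p in ?F. True \<and> snd p \<in> X"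
        by (intro eventually_prodI[where P="\<lambda>_. True"]) simp_all
      then show ?thesis by eventually_elim (auto simp: drv)
    qed
    ultimately have *: "((\<lambda>(n, y). disc_relative_value M ((\<alpha> \<circ> r) n) y) \<longlongrightarrow> ereal (l x)) ?F"
      by (rule Lim_transform_eventually)
    have "inf (nhds x) (principal X) \<noteq> bot"
      using x by (auto simp: trivial_limit_def eventually_inf_principal dest: eventually_nhds_x_imp_x)
    then have "?F \<noteq> bot" by (simp add: prod_filter_eq_bot)
    from lim_imp_Liminf[OF this *] show ?thesis
      by (simp add: u_def avg_relative_value_def)
  qed
  let ?v = "\<lambda>y. ennreal (l y)"
  have uv: "u x = enn2ereal (?v x)" if "x \<in> X" for x using u[OF that] l0[OF that] by simp
  have \<beta>: "0 \<le> \<alpha> (r n)" "\<alpha> (r n) < 1" "incseq (\<lambda>n. \<alpha> (r n))" "(\<lambda>n. \<alpha> (r n)) \<longlonglongrightarrow> 1" for n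
    using \<alpha> assms(5) strict_mono_leD[OF r] LIMSEQ_subseq_LIMSEQ[OF assms(6) r]
    by (auto simp: incseq_def comp_def)
  note limit_facts = \<beta> equi_r[unfolded f_def] lim[unfolded f_def]
  have lsc: "lsc_on X ?v" by (rule lsc_on_limit[OF limit_facts])
  have eq: "(INF a\<in>A. bellman_value 1 ?v (x, a)) = limit_gain + ?v x" if x: "x \<in> X" for x
  proof (rule antisym)
    obtain a where "a \<in> A" "bellman_value 1 ?v (x, a) \<le> limit_gain + ?v x"
      using limit_optimality_attained[OF limit_facts x] by blast
    then show "(INF a\<in>A. bellman_value 1 ?v (x, a)) \<le> limit_gain + ?v x" by (rule INF_lower2)
    show "limit_gain + ?v x \<le> (INF a\<in>A. bellman_value 1 ?v (x, a))"
    proof (rule INF_greatest)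
      fix a assume a: "a \<in> A"
      have dom: "relative_value (\<alpha> (r n)) y \<le> ennreal (U y)" if "y \<in> X" for n y
        using bound[OF that, of "r n"] relative_value_finite[OF \<alpha> that, of "r n"] unfolding f_def
        by (cases "relative_value (\<alpha> (r n)) y") (auto intro: ennreal_leI)
      show "limit_gain + ?v x \<le> bellman_value 1 ?v (x, a)"
        by (rule limit_optimality_lower[OF limit_facts assms(8) dom x a assms(11)[OF x a]])
    qed
  qed
  have acoe_iff: "satisfies_acoe M u \<phi> \<longleftrightarrow> \<phi> \<in> stationary_maps M \<and>
      (\<forall>x\<in>X. bellman_value 1 ?v (x, \<phi> x) = limit_gain + ?v x \<and>
        bellman_value 1 ?v (x, \<phi> x) = (INF a\<in>A. bellman_value 1 ?v (x, a)))" for \<phi>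
    by (rule satisfies_acoe_iff) (rule uv)
  show ?thesis
  proof (intro exI[of _ r] conjI r, unfold Let_def u_def[symmetric], intro conjI ballI allI impI)
    fix x assume x: "x \<in> X"
    show "(\<lambda>k. disc_relative_value M (\<alpha> (r k)) x) \<longlonglongrightarrow> u x"
      unfolding drv[OF x] u[OF x] by (intro tendsto_ereal lim x)
    show "0 \<le> u x" "u x < \<infinity>" using l0[OF x] by (simp_all add: u[OF x])
  next
    have "continuous_on X (\<lambda>x. ereal (l x))"
      by (intro continuous_on_ereal equicontinuous_limit_continuous[OF equi_r lim])
    then show "continuous_on X u" using u by (simp cong: continuous_on_cong)
  next
    obtain \<phi> where phi: "\<phi> \<in> restrict_space borel X \<rightarrow>\<^sub>M restrict_space borel A"
      and min: "\<And>x. x \<in> X \<Longrightarrow> bellman_value 1 ?v (x, \<phi> x) = (INF a\<in>A. bellman_value 1 ?v (x, a))"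
    proof (rule lsc_minimiser_selection[of X A "bellman_value 1 ?v"])
      show "(INF a\<in>A. bellman_value 1 ?v (x, a)) < top" if "x \<in> X" for x
        using limit_gain_finite by (simp add: eq[OF that] ennreal_add_less_top)
    qed (assumption | rule lsc_on_bellman_value[OF lsc] action_compact_bellman_value that)+
    have "satisfies_acoe M u \<phi>"
      unfolding acoe_iff using phi min eq
      by (simp add: stationary_maps_def state_space_def action_space_def)
    then show "\<exists>\<phi>. satisfies_acoe M u \<phi>" by blast
  next
    fix \<phi> assume "satisfies_acoe M u \<phi>"
    then show "average_cost_optimal M (stationary_policy M \<phi>)"
      unfolding acoe_iff by (intro acoe_policy_optimal[of \<phi> ?v] measurable_state[OF lsc]) auto
  qed
qed

end
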